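(* Let $f:\mathbb{R}\to\mathbb{R}$ be an odd polynomial, let $p/n=\gamma+O(n^{-1/2})$ and $m/\sqrt n\to\beta$ with $\gamma,\beta\in(0,\infty)$, and set $\beta_n:=m/\sqrt n$ and $\tau:=\tau(f,\beta_n,\lambda)$. Define $$\boldsymbol A(f):=a_1(\boldsymbol Y-\boldsymbol I_p)+\tau\,\boldsymbol v\boldsymbol v^\top+\boldsymbol K_0(f-a_1h_1).$$ Then $$\|\boldsymbol K(f)-\boldsymbol A(f)\|_2\prec n^{-1/4}.$$
   Context: Setting. For each $n$ let $p=p(n)$ and $m=m(n)\le p$ be positive integers. Let $\lambda\ge1$ be fixed, and let $\boldsymbol v=\boldsymbol v^{(n)}\in\mathbb{R}^p$ be deterministic with $\sqrt m\,v_i\in\{-1,1\}$ for $1\le i\le m$ and $v_i=0$ for $i>m$. Let $\boldsymbol Z\in\mathbb{R}^{n\times p}$ have i.i.d. $\mathcal N(0,1)$ entries, $\boldsymbol\Sigma:=(\lambda-1)\boldsymbol v\boldsymbol v^\top+\boldsymbol I_p$, $\boldsymbol S:=n^{-1}\boldsymbol Z^\top\boldsymbol Z$, $\boldsymbol Y:=\boldsymbol\Sigma^{1/2}\boldsymbol S\boldsymbol\Sigma^{1/2}$. Kernel matrices. For $f:\mathbb{R}\to\mathbb{R}$, $\boldsymbol K(f),\boldsymbol K_0(f)\in\mathbb{R}^{p\times p}$ have zero diagonal and off-diagonal entries $(\boldsymbol K(f))_{ij}=n^{-1/2}f(\sqrt n\,\boldsymbol Y_{ij})$ and $(\boldsymbol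 K_0(f))_{ij}=n^{-1/2}f(\sqrt n\,\boldsymbol S_{ij})$, $i\ne j$. Hermite notation. $\phi(z)=(2\pi)^{-1/2}e^{-z^2/2}$, $\langle f,g\rangle_\phi=\int fg\,\phi$, $\{h_k\}_{k\ge0}$ are the Hermite polynomials normalized so that $\langle h_k,h_\ell\rangle_\phi=\mathbf 1_{k=\ell}$ (positive leading coefficient; $h_1(x)=x$), $a_k:=\langle f,h_k\rangle_\phi$, and $$\tau(f,b,\lambda):=\sum_{\ell=3}^\infty\frac{a_\ell(\lambda-1)^\ell}{\sqrt{\ell!}\,b^{\ell-1}}.$$ Stochastic domination. For nonnegative random variables, $\xi_n\prec\zeta_n$ means: for all $\varepsilon,D>0$ there is $n_{\varepsilon,D}$ such that $\mathbb P(\xi_n>n^\varepsilon\zeta_n)\le n^{-D}$ for all $n\ge n_{\varepsilon,D}$. $\|\cdot\|_2$ is the operator norm. *)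

theory Defs
  imports
    "HOL-Probability.Probability"
    "HOL-Library.Landau_Symbols"
    "HOL-Computational_Algebra.Polynomial"
    "Jordan_Normal_Form.Matrix"
begin

(* Matrix sizes depend on n, so vectors and matrices are those of
   Jordan_Normal_Form (explicit dimensions, indices starting at 0). *)

unbundle no vec_syntax
unbundle no inner_syntax
hide_const (open) Module.smult

definition l2_norm_vec :: "real vec \<Rightarrow> real" where
  "l2_norm_vec x = sqrt (x \<bullet> x)"

definition op_norm :: "real mat \<Rightarrow> real" where
  "op_norm A = (SUP x \<in> {x \<in> carrier_vec (dim_col A). l2_norm_vec x = 1}. l2_norm_vec (A *\<^sub>v x))"

definition pos_semidef :: "real mat \<Rightarrow> bool" where
  "pos_semidef A \<longleftrightarrow> A\<^sup>T = A \<and> (\<forall>x \<in> carrier_vec (dim_col A). 0 \<le> x \<bullet> (A *\<^sub>v x))"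

(* Meaningful for positive semidefinite A, where the root exists and is unique. *)
definition psd_sqrt :: "real mat \<Rightarrow> real mat" where
  "psd_sqrt A = (THE R. pos_semidef R \<and> R * R = A)"

definition outer_prod :: "real vec \<Rightarrow> real vec \<Rightarrow> real mat" where
  "outer_prod u w = mat (dim_vec u) (dim_vec w) (\<lambda>(i, j). u $ i * w $ j)"

definition spiked_cov :: "real \<Rightarrow> real vec \<Rightarrow> real mat" where
  "spiked_cov lam v = (lam - 1) \<cdot>\<^sub>m outer_prod v v + 1\<^sub>m (dim_vec v)"

definition white_cov :: "nat \<Rightarrow> real mat \<Rightarrow> real mat" where
  "white_cov n Z = (1 / real n) \<cdot>\<^sub>m (Z\<^sup>T * Z)"

definition sample_cov :: "nat \<Rightarrow> real \<Rightarrow> real vec \<Rightarrow> real mat \<Rightarrow> real mat" where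
  "sample_cov n lam v Z =
     psd_sqrt (spiked_cov lam v) * white_cov n Z * psd_sqrt (spiked_cov lam v)"

(* K(f) is kernel_mat n f Y and K_0(f) is kernel_mat n f S. *)
definition kernel_mat :: "nat \<Rightarrow> (real \<Rightarrow> real) \<Rightarrow> real mat \<Rightarrow> real mat" where
  "kernel_mat n f B = mat (dim_row B) (dim_col B)
     (\<lambda>(i, j). if i = j then 0 else f (sqrt (real n) * B $$ (i, j)) / sqrt (real n))"

definition gauss_inner :: "(real \<Rightarrow> real) \<Rightarrow> (real \<Rightarrow> real) \<Rightarrow> real" where
  "gauss_inner f g = (LINT x|lborel. f x * g x * std_normal_density x)"

(* Monic ("probabilists'") Hermite polynomials. *)
fun He :: "nat \<Rightarrow> real poly" where
  "He 0 = 1"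
| "He (Suc 0) = [:0, 1:]"
| "He (Suc (Suc k)) = [:0, 1:] * He (Suc k) - smult (real (Suc k)) (He k)"

definition hermite :: "nat \<Rightarrow> real \<Rightarrow> real" where
  "hermite k x = poly (He k) x / sqrt (fact k)"

definition hermite_coeff :: "(real \<Rightarrow> real) \<Rightarrow> nat \<Rightarrow> real" where
  "hermite_coeff f k = gauss_inner f (hermite k)"

(* The series starts at l = 3, hence the index shift. *)
definition tau :: "(real \<Rightarrow> real) \<Rightarrow> real \<Rightarrow> real \<Rightarrow> real" where
  "tau f b lam = (\<Sum>k. let l = k + 3 in
     hermite_coeff f l * (lam - 1) ^ l / (sqrt (fact l) * b ^ (l - 1)))"

definition approx_mat ::
  "nat \<Rightarrow> real \<Rightarrow> real vec \<Rightarrow> real \<Rightarrow> (real \<Rightarrow> real) \<Rightarrow> real mat \<Rightarrow> real mat" where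
  "approx_mat n lam v b f Z =
     hermite_coeff f 1 \<cdot>\<^sub>m (sample_cov n lam v Z - 1\<^sub>m (dim_vec v))
     + tau f b lam \<cdot>\<^sub>m outer_prod v v
     + kernel_mat n (\<lambda>x. f x - hermite_coeff f 1 * hermite 1 x) (white_cov n Z)"

(* Each xi n, zeta n lives on its own probability space M n, so nothing is
   assumed about the joint law for different n. *)
definition stoch_dominated ::
  "(nat \<Rightarrow> 'a measure) \<Rightarrow> (nat \<Rightarrow> 'a \<Rightarrow> real) \<Rightarrow> (nat \<Rightarrow> 'a \<Rightarrow> real) \<Rightarrow> bool" where
  "stoch_dominated M xi zeta \<longleftrightarrow>
     (\<forall>eps > 0. \<forall>D > 0. \<exists>N. \<forall>n \<ge> N.
        measure (M n) {w \<in> space (M n). xi n w > real n powr eps * zeta n w} \<le> real n powr (- D))"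

definition iid_std_normal_mat :: "'a measure \<Rightarrow> nat \<Rightarrow> nat \<Rightarrow> ('a \<Rightarrow> real mat) \<Rightarrow> bool" where
  "iid_std_normal_mat M n p Z \<longleftrightarrow>
     (\<forall>w \<in> space M. Z w \<in> carrier_mat n p) \<and>
     (\<forall>i < n. \<forall>j < p. distributed M lborel (\<lambda>w. Z w $$ (i, j)) std_normal_density) \<and>
     prob_space.indep_vars M (\<lambda>_. borel) (\<lambda>ij w. Z w $$ ij) ({..<n} \<times> {..<p})"

(* Checks that hermite is the orthonormal family with positive leading
   coefficients and hermite 1 x = x. *)

lemma hermite_1: "hermite 1 x = x"
  by (simp add: hermite_def)

lemma He_degree_lead: "degree (He k) = k \<and> lead_coeff (He k) = 1"
proof (induction k rule: He.induct)
  case (3 k)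
  have c: "coeff (He (Suc (Suc k))) (Suc (Suc k)) = 1"
  proof -
    have "coeff (He k) (Suc (Suc k)) = 0" using 3 by (simp add: coeff_eq_0)
    moreover have "coeff (He (Suc k)) (Suc k) = 1" using 3 by metis
    ultimately show ?thesis by simp
  qed
  have "degree ([:0, 1:] * He (Suc k)) \<le> Suc (Suc k)"
    using 3 by (simp add: degree_pCons_le[THEN order_trans])
  moreover have "degree (smult (real (Suc k)) (He k)) \<le> Suc (Suc k)"
    using 3 degree_smult_le[of "real (Suc k)" "He k"] by linarith
  ultimately have "degree (He (Suc (Suc k))) \<le> Suc (Suc k)"
    unfolding He.simps by (rule degree_diff_le)
  moreover have "Suc (Suc k) \<le> degree (He (Suc (Suc k)))"
    using c by (intro le_degree) simp
  ultimately show ?case using c by (metis le_antisym)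
qed auto

definition gauss_mean :: "real poly \<Rightarrow> real" where
  "gauss_mean q = (LINT x|lborel. poly q x * std_normal_density x)"

lemma integrable_poly_gauss: "integrable lborel (\<lambda>x. poly q x * std_normal_density x)"
proof -
  have "integrable lborel (\<lambda>x. \<Sum>i\<le>degree q. coeff q i * (std_normal_density x * x ^ i))"
    by (intro Bochner_Integration.integrable_sum integrable_mult_right integrable_std_normal_moment)
  then show ?thesis by (simp add: poly_altdef sum_distrib_left sum_distrib_right ac_simps)
qed

lemma gauss_mean_add: "gauss_mean (p + q) = gauss_mean p + gauss_mean q"
  using integrable_poly_gauss[of p] integrable_poly_gauss[of q]
  by (simp add: gauss_mean_def distrib_right)

lemma gauss_mean_smult: "gauss_mean (smult c q) = c * gauss_mean q"
  by (simp add: gauss_mean_def mult.assoc)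

lemma gauss_mean_diff: "gauss_mean (p - q) = gauss_mean p - gauss_mean q"
  using gauss_mean_add[of p "smult (-1) q"] gauss_mean_smult[of "-1" q] by simp

lemma gauss_mean_monom_even: "gauss_mean (monom 1 (2 * k)) = fact (2 * k) / (2 ^ k * fact k)"
  using has_bochner_integral_integral_eq[OF std_normal_moment_even[of k]]
  by (simp add: gauss_mean_def poly_monom mult.commute)

lemma gauss_mean_monom_odd: "gauss_mean (monom 1 (2 * k + 1)) = 0"
  using has_bochner_integral_integral_eq[OF std_normal_moment_odd[of k]]
  by (simp add: gauss_mean_def poly_monom mult.commute mult.left_commute)

lemma gauss_mean_by_parts_monom:
  "gauss_mean ([:0, 1:] * monom 1 k) = gauss_mean (pderiv (monom 1 k))"
proof (cases k)
  case 0
  then show ?thesis using gauss_mean_monom_odd[of 0]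
    by (simp add: monom_altdef gauss_mean_def)
next
  case (Suc j)
  have 1: "[:0, 1:] * monom 1 k = (monom 1 (Suc (Suc j)) :: real poly)"
    by (simp add: Suc monom_altdef)
  have 2: "pderiv (monom 1 k) = smult (real (Suc j)) (monom 1 j :: real poly)"
    by (simp add: Suc pderiv_monom smult_monom)
  show ?thesis
  proof (cases "even j")
    case True
    then obtain i where i: "j = 2 * i" by auto
    have "fact (2 * Suc i) = 2 * real (Suc i) * (real (Suc (2 * i)) * fact (2 * i))"
      by (simp add: algebra_simps)
    then have f: "fact (2 * Suc i) / (2 ^ Suc i * fact (Suc i))
        = real (Suc (2 * i)) * (fact (2 * i) / (2 ^ i * fact i))"
      by (simp add: divide_simps del: of_nat_Suc)
    show ?thesis unfolding 1 2 gauss_mean_smult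
      using gauss_mean_monom_even[of i] gauss_mean_monom_even[of "Suc i"] f by (simp add: i)
  next
    case False
    then obtain i where i: "j = 2 * i + 1" by (auto elim: oddE)
    show ?thesis unfolding 1 2 gauss_mean_smult
      using gauss_mean_monom_odd[of i] gauss_mean_monom_odd[of "Suc i"]
      by (simp add: i)
  qed
qed

lemma gauss_mean_sum: "gauss_mean (\<Sum>i\<in>I. g i) = (\<Sum>i\<in>I. gauss_mean (g i))"
proof (induction I rule: infinite_finite_induct)
  case (insert x F)
  then show ?case by (simp add: gauss_mean_add)
qed (simp_all add: gauss_mean_def)

lemma pderiv_sum_poly: "pderiv (\<Sum>i\<in>I. g i) = (\<Sum>i\<in>I. pderiv (g i :: real poly))"
  by (induction I rule: infinite_finite_induct) (simp_all add: pderiv_add)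

lemma gauss_mean_by_parts: "gauss_mean ([:0, 1:] * q) = gauss_mean (pderiv q)"
proof -
  have *: "gauss_mean ([:0, 1:] * (\<Sum>i\<le>n. smult (c i) (monom 1 i)))
      = gauss_mean (pderiv (\<Sum>i\<le>n. smult (c i) (monom 1 i)))" for n and c :: "nat \<Rightarrow> real"
    by (simp only: sum_distrib_left mult_smult_right pderiv_sum_poly pderiv_smult
        gauss_mean_sum gauss_mean_smult gauss_mean_by_parts_monom)
  have "(\<Sum>i\<le>degree q. smult (coeff q i) (monom 1 i)) = q"
    by (simp add: smult_monom poly_as_sum_of_monoms)
  with *[where n = "degree q" and c = "coeff q"] show ?thesis by (simp only:)
qed

lemma He_Suc: "He (Suc k) = [:0, 1:] * He k - pderiv (He k) \<and>
    pderiv (He (Suc k)) = smult (real (Suc k)) (He k)"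
proof (induction k)
  case 0
  show ?case by (simp add: pderiv_pCons)
next
  case (Suc k)
  have 1: "He (Suc (Suc k)) = [:0, 1:] * He (Suc k) - pderiv (He (Suc k))"
    by (simp only: He.simps(3) Suc[THEN conjunct2])
  have x: "pderiv [:0, 1:] = (1 :: real poly)" by (simp add: pderiv_pCons)
  have "pderiv (He (Suc (Suc k)))
      = He (Suc k) + [:0, 1:] * smult (real (Suc k)) (He k) - smult (real (Suc k)) (pderiv (He k))"
    unfolding 1 pderiv_diff pderiv_mult x using Suc
    by (simp add: pderiv_smult algebra_simps del: He.simps)
  also have "\<dots> = He (Suc k) + smult (real (Suc k)) ([:0, 1:] * He k - pderiv (He k))"
    by (simp add: smult_diff_right)
  also have "\<dots> = smult (real (Suc (Suc k))) (He (Suc k))"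
    unfolding Suc[THEN conjunct1, symmetric] of_nat_Suc[of "Suc k"] smult_add_left smult_1_left ..
  finally show ?case using 1 by simp
qed

lemma gauss_mean_He:
  "gauss_mean (He k * He l) = (if k = l then fact k else 0)"
proof (induction k arbitrary: l)
  case 0
  show ?case
  proof (cases l)
    case 0
    then show ?thesis using gauss_mean_monom_even[of 0] by (simp add: gauss_mean_def poly_monom)
  next
    case (Suc j)
    then show ?thesis
      using He_Suc[of j] gauss_mean_by_parts[of "He j"] by (simp add: gauss_mean_diff del: He.simps(3))
  qed
next
  case (Suc k)
  have "gauss_mean (He (Suc k) * He l)
      = gauss_mean ([:0, 1:] * (He k * He l)) - gauss_mean (pderiv (He k) * He l)"
    using He_Suc[of k] by (simp add: left_diff_distrib gauss_mean_diff mult.assoc)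
  also have "\<dots> = gauss_mean (He k * pderiv (He l))"
    unfolding gauss_mean_by_parts pderiv_mult gauss_mean_add by (simp add: mult.commute)
  also have "\<dots> = (if Suc k = l then fact (Suc k) else 0)"
  proof (cases l)
    case 0
    then show ?thesis by (simp add: gauss_mean_def)
  next
    case (Suc j)
    then show ?thesis using Suc.IH[of j]
      by (simp add: He_Suc[of j, THEN conjunct2] gauss_mean_smult del: He.simps)
  qed
  finally show ?case .
qed

lemma hermite_orthonormal:
  "gauss_inner (hermite k) (hermite l) = (if k = l then 1 else 0)"
proof -
  have "gauss_inner (hermite k) (hermite l)
      = gauss_mean (smult (1 / (sqrt (fact k) * sqrt (fact l))) (He k * He l))"
    by (simp add: gauss_inner_def gauss_mean_def hermite_def field_simps)
  then show ?thesis by (simp add: gauss_mean_smult gauss_mean_He)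
qed

end

theory Submission
  imports Defs "HOL-Real_Asymp.Real_Asymp"
begin

text \<open>The root of the population covariance is \<open>I + (sqrt \<lambda> - 1) v v\<^sup>T\<close>, so off the diagonal
  \<open>sqrt n Y\<^sub>i\<^sub>j = x\<^sub>i\<^sub>j + \<theta>\<^sub>i\<^sub>j + \<delta>\<^sub>i\<^sub>j\<close> with \<open>x\<^sub>i\<^sub>j = sqrt n S\<^sub>i\<^sub>j\<close>, a shift
  \<open>\<theta>\<^sub>i\<^sub>j = (\<lambda> - 1) sqrt n v\<^sub>i v\<^sub>j\<close> of order 1 supported on the \<open>m \<times> m\<close> block, and a remainder \<open>\<delta>\<^sub>i\<^sub>j\<close> of
  order \<open>n^(-1/4)\<close> that vanishes unless \<open>i\<close> or \<open>j\<close> lies in the support of \<open>v\<close>. Put \<open>g = f - a\<^sub>1 h\<^sub>1\<close>.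

  On the \<open>m \<times> m\<close> block the contribution of \<open>\<delta>\<close> is small in Frobenius norm. The Gaussian mean of
  \<open>g (x + \<theta>) - g x\<close> is given by the Hermite expansion and equals the \<open>\<tau>\<close> term exactly; what remains is a
  combination of centered monomials \<open>x^k - E \<xi>^k\<close>. On the \<open>(p - m) \<times> m\<close> block \<open>\<delta>\<close> has rank one, the first
  order term is \<open>g' x \<delta>\<close> where \<open>E g' \<xi> = 0\<close>, and the second order term is small in Frobenius norm.

  Thus only the operator norms of the blocks \<open>(x\<^sub>i\<^sub>j^k - E \<xi>^k)\<close> matter. Reveal the columns of \<open>Z\<close> one at a
  time. Row t of the strictly lower triangular block is a function y of the new column, and its conditional
  covariance is bounded by a constant because the previous columns are nearly orthonormal. The Gram matrix A
  of the rows becomes \<open>A + y y\<^sup>T\<close>, and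
  \<open>tr (A + y y\<^sup>T)^k \<le> tr A^k + 2^k \<Sum>\<^sub>j\<^sub><\<^sub>k \<rho>^j \<langle>A^(k-1-j) y, y\<rangle>\<close> for \<open>|y|\<^sup>2 \<le> \<rho>\<close>. Taking expectations gives a
  recursion that bounds \<open>E tr A^k\<close> for every k, hence the norm up to factors \<open>n^\<epsilon>\<close>.\<close>

section \<open>Rank-one updates of positive semidefinite operators\<close>

text \<open>The rate comes from two norms. Up to factors \<open>n^\<epsilon>\<close>, a centered
  monomial has norm n^(1/4) on the m x m block, where m is of order sqrt n, and n^(1/2) on the (p -
  m) x m block. The kernel divides both by sqrt n, and on the second block the rank-one weight
  \<delta> contributes another n^(-1/4). Oddness makes the mean of the shifted kernel rank one: on
  the block \<theta> takes the two values +-(\<lambda> - 1) / \<beta>_n, and an odd function of a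
  sign is a multiple of that sign, hence of v_i v_j. Entries of one row are dependent given the
  past, with off-diagonal second moments of order T / sqrt n. A row meets only m of them, so the
  second moment matrix stays of order T. In the trace inequality A and y y^T do not commute. Each
  word of the expansion is a product of moments <A^a y, y>; these are log-convex in a, so two of
  them merge into one at the price of a factor |y|^2. The result is linear in the moments, so its
  mean needs only second moments of y, and no eigenvalues appear.\<close>

definition ip :: "nat \<Rightarrow> (nat \<Rightarrow> real) \<Rightarrow> (nat \<Rightarrow> real) \<Rightarrow> real" where
  "ip m x y = (\<Sum>i<m. x i * y i)"

lemma ip_commute: "ip m x y = ip m y x"
  by (simp add: ip_def mult.commute)

lemma ip_add_scale_left: "ip m (\<lambda>i. x i + c * z i) w = ip m x w + c * ip m z w"
  by (simp add: ip_def sum.distrib sum_distrib_left algebra_simps)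

lemma ip_add_scale_right: "ip m w (\<lambda>i. x i + c * z i) = ip m w x + c * ip m w z"
  by (simp add: ip_def sum.distrib sum_distrib_left algebra_simps)

lemma ip_self_nonneg: "0 \<le> ip m x x"
  by (simp add: ip_def sum_nonneg)

definition unit_fun :: "nat \<Rightarrow> nat \<Rightarrow> real" where
  "unit_fun l i = (if i = l then 1 else 0)"

lemma ip_unit_fun: "l < m \<Longrightarrow> ip m x (unit_fun l) = x l"
  by (simp add: ip_def unit_fun_def if_distrib[of "\<lambda>c. _ * c"] sum.delta cong: if_cong)

definition op_trace :: "nat \<Rightarrow> ((nat \<Rightarrow> real) \<Rightarrow> nat \<Rightarrow> real) \<Rightarrow> real" where
  "op_trace m F = (\<Sum>l<m. F (unit_fun l) l)"

text \<open>No sign of \<open>d\<close> is assumed: a large \<open>c\<close> excludes d < 0, and d =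
  0 forces b = 0. So Cauchy-Schwarz becomes available for forms that are only semidefinite.\<close>

lemma discriminant_le:
  fixes a b d :: real
  assumes "\<And>c. 0 \<le> a + 2 * c * b + c * c * d"
  shows "b * b \<le> a * d"
proof (cases "d = 0")
  case True
  have "b = 0"
  proof (rule ccontr)
    assume "b \<noteq> 0"
    then show False using assms[of "- (a + 1) / (2 * b)"] True by (simp add: field_simps)
  qed
  then show ?thesis using True by simp
next
  case False
  have a: "0 \<le> a" using assms[of 0] by simp
  have d: "0 < d"
  proof (rule ccontr)
    assume "\<not> 0 < d"
    then have d: "d < 0" using False by simp
    \<comment> \<open>Chosen so that 2 b + c d \<le> - (a + 1); as c \<ge> 1, the quadratic is then
      at most -1.\<close>
    define c where "c = (\<bar>b\<bar> * 2 + a + 1) / (- d) + 1"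
    have c1: "c \<ge> 1" using a d by (simp add: c_def divide_nonneg_neg)
    have "c * (- d) = \<bar>b\<bar> * 2 + a + 1 - d" using d by (simp add: c_def field_simps)
    then have "c * d \<le> - (\<bar>b\<bar> * 2 + a + 1)" using d by linarith
    then have "2 * b + c * d \<le> - (a + 1)" by linarith
    then have "c * (2 * b + c * d) \<le> c * (- (a + 1))" using c1 by (intro mult_left_mono) auto
    also have "\<dots> \<le> 1 * (- (a + 1))" using c1 a by (intro mult_right_mono_neg) auto
    finally have "a + 2 * c * b + c * c * d \<le> -1" by (simp add: algebra_simps)
    then show False using assms[of c] by linarith
  qed
  have "0 \<le> (a + 2 * (- b / d) * b + (- b / d) * (- b / d) * d) * d"
    using assms[of "- b / d"] d by (intro mult_nonneg_nonneg) auto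
  also have "\<dots> = a * d - b * b" using d by (simp add: field_simps)
  finally show ?thesis by simp
qed

text \<open>Vectors are functions of which only the values below \<open>m\<close> enter
  \<open>ip\<close>, and operators act on such functions, so \<open>A ^^ k\<close> is available and
  the dimension is a mere parameter. Linearity is an equality of functions, so that it passes to
  compositions by rewriting.\<close>

locale psd_op =
  fixes m :: nat and A :: "(nat \<Rightarrow> real) \<Rightarrow> nat \<Rightarrow> real"
  assumes lin: "A (\<lambda>i. x i + c * z i) = (\<lambda>i. A x i + c * A z i)"
    and sym: "ip m (A x) z = ip m x (A z)"
    and psd: "0 \<le> ip m (A x) x"
begin

lemma cauchy_schwarz: "ip m (A x) z * ip m (A x) z \<le> ip m (A x) x * ip m (A z) z"
proof (rule discriminant_le)
  fix c
  have "ip m (A z) x = ip m (A x) z" by (subst sym) (simp add: ip_commute)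
  then have "ip m (A (\<lambda>i. x i + c * z i)) (\<lambda>i. x i + c * z i)
      = ip m (A x) x + 2 * c * ip m (A x) z + c * c * ip m (A z) z"
    by (simp add: lin ip_add_scale_left ip_add_scale_right algebra_simps)
  then show "0 \<le> ip m (A x) x + 2 * c * ip m (A x) z + c * c * ip m (A z) z"
    using psd[of "\<lambda>i. x i + c * z i"] by simp
qed

lemma diag_nonneg: "l < m \<Longrightarrow> 0 \<le> A (unit_fun l) l"
  using psd[of "unit_fun l"] by (simp add: ip_unit_fun)

lemma op_trace_nonneg: "0 \<le> op_trace m A"
  by (auto simp: op_trace_def intro!: sum_nonneg diag_nonneg)

text \<open>The 2 x 2 principal form tested at (1, 1) and (1, -1). The additive bound is weaker than
  the one by products, but it sums to the trace.\<close>

lemma entry_le: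
  assumes "i < m" "j < m"
  shows "2 * \<bar>A (unit_fun j) i\<bar> \<le> A (unit_fun i) i + A (unit_fun j) j"
proof -
  have s: "A (unit_fun i) j = A (unit_fun j) i"
    using sym[of "unit_fun i" "unit_fun j"] assms ip_unit_fun[of j m "A (unit_fun i)"]
      ip_unit_fun[of i m "A (unit_fun j)"] by (simp add: ip_commute)
  have q: "0 \<le> A (unit_fun i) i + 2 * c * A (unit_fun j) i + c * c * A (unit_fun j) j" for c
    using psd[of "\<lambda>k. unit_fun i k + c * unit_fun j k"] assms s
    by (simp add: lin ip_add_scale_left ip_add_scale_right ip_unit_fun algebra_simps)
  show ?thesis using q[of 1] q[of "-1"] by auto
qed

text \<open>The trace dominates the largest eigenvalue. Put q = <A x, x>: Cauchy-Schwarz for A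
  bounds the square of the l-th entry of A x by q times the l-th diagonal entry of A, and summing
  over l gives q^2 \<le> q |x|^2 tr A.\<close>

lemma quadratic_le_trace: "ip m (A x) x \<le> ip m x x * op_trace m A"
proof -
  let ?q = "ip m (A x) x"
  have "?q * ?q = (\<Sum>l<m. A x l * x l)\<^sup>2" by (simp add: ip_def power2_eq_square)
  also have "\<dots> \<le> (\<Sum>l<m. (A x l)\<^sup>2) * (\<Sum>l<m. (x l)\<^sup>2)"
    by (rule Cauchy_Schwarz_ineq_sum)
  also have "\<dots> \<le> (\<Sum>l<m. ?q * A (unit_fun l) l) * (\<Sum>l<m. (x l)\<^sup>2)"
  proof (intro mult_right_mono sum_mono sum_nonneg)
    fix l assume "l \<in> {..<m}"
    then show "(A x l)\<^sup>2 \<le> ?q * A (unit_fun l) l"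
      using cauchy_schwarz[of x "unit_fun l"] by (simp add: ip_unit_fun power2_eq_square)
  qed auto
  also have "\<dots> = ?q * (ip m x x * op_trace m A)"
    by (simp add: ip_def op_trace_def sum_distrib_left[symmetric] power2_eq_square)
  finally have *: "?q * ?q \<le> ?q * (ip m x x * op_trace m A)" .
  show ?thesis
  proof (cases "?q = 0")
    case True
    then show ?thesis using ip_self_nonneg[of m x] op_trace_nonneg by simp
  next
    case False
    then have "0 < ?q" using psd[of x] by linarith
    then show ?thesis using * mult_le_cancel_left_pos by blast
  qed
qed

text \<open>Two factors are stripped at a time: A^(j+2) = A A^j A is a congruence of A^j, which
  keeps symmetry and positivity.\<close>

lemma psd_op_funpow: "psd_op m (A ^^ k)"
proof (induction k rule: nat_less_induct)
  case (1 k)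
  consider "k = 0" | "k = 1" | j where "k = Suc (Suc j)"
    by (metis One_nat_def not0_implies_Suc)
  then show ?case
  proof cases
    case 1
    then show ?thesis by (simp add: psd_op_def ip_self_nonneg)
  next
    case 2
    then show ?thesis using psd_op_axioms by simp
  next
    case 3
    then interpret j: psd_op m "A ^^ j" using 1 by simp
    have e: "A ^^ k = (\<lambda>x. A ((A ^^ j) (A x)))"
      by (simp add: 3 fun_eq_iff funpow_swap1)
    show ?thesis unfolding e
    proof
      fix x z c
      show "A ((A ^^ j) (A (\<lambda>i. x i + c * z i)))
          = (\<lambda>i. A ((A ^^ j) (A x)) i + c * A ((A ^^ j) (A z)) i)"
        by (simp add: lin j.lin)
      show "ip m (A ((A ^^ j) (A x))) z = ip m x (A ((A ^^ j) (A z)))"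
        by (simp add: sym j.sym)
      show "0 \<le> ip m (A ((A ^^ j) (A x))) x"
        by (simp add: sym j.psd)
    qed
  qed
qed

text \<open>The a-th moment of the spectral measure of \<open>A\<close> at \<open>y\<close>.
  Nonnegativity and log-convexity of the sequence replace the measure itself.\<close>

definition moment :: "(nat \<Rightarrow> real) \<Rightarrow> nat \<Rightarrow> real" where
  "moment y a = ip m ((A ^^ a) y) y"

lemma moment_nonneg: "0 \<le> moment y a"
  using psd_op.psd[OF psd_op_funpow] by (simp add: moment_def)

lemma moment_0: "moment y 0 = ip m y y"
  by (simp add: moment_def)

lemma moment_square_le: "moment y (Suc a) * moment y (Suc a) \<le> moment y a * moment y (Suc (Suc a))"
proof -
  interpret a: psd_op m "A ^^ a" by (rule psd_op_funpow)
  have "ip m ((A ^^ a) y) (A y) = moment y (Suc a)"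
    by (simp add: moment_def sym)
  moreover have "ip m ((A ^^ a) (A y)) (A y) = moment y (Suc (Suc a))"
    by (simp add: moment_def sym[symmetric] funpow_swap1)
  ultimately show ?thesis using a.cauchy_schwarz[of y "A y"] by (simp add: moment_def)
qed

text \<open>Log-convexity says that the ratios of consecutive moments do not decrease. Division is
  avoided by multiplying with \<open>moment y b\<close>; if that vanishes, so does the next
  moment.\<close>

lemma moment_shift_le: "a \<le> b \<Longrightarrow> moment y (Suc a) * moment y b \<le> moment y a * moment y (Suc b)"
proof (induction b rule: dec_induct)
  case base
  then show ?case by simp
next
  case (step b)
  show ?case
  proof (cases "moment y b = 0")
    case True
    then have "moment y (Suc b) * moment y (Suc b) \<le> 0" using moment_square_le[of y b] by simp
    then have "moment y (Suc b) = 0" using moment_nonneg[of y "Suc b"] by (simp add: mult_le_0_iff)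
    then show ?thesis using moment_nonneg by (simp add: moment_nonneg)
  next
    case False
    then have p: "0 < moment y b" using moment_nonneg[of y b] by linarith
    have "moment y b * (moment y (Suc a) * moment y (Suc b))
        = (moment y (Suc a) * moment y b) * moment y (Suc b)" by simp
    also have "\<dots> \<le> (moment y a * moment y (Suc b)) * moment y (Suc b)"
      by (intro mult_right_mono step.IH moment_nonneg)
    also have "\<dots> = moment y a * (moment y (Suc b) * moment y (Suc b))" by simp
    also have "\<dots> \<le> moment y a * (moment y b * moment y (Suc (Suc b)))"
      by (intro mult_left_mono moment_square_le moment_nonneg)
    also have "\<dots> = moment y b * (moment y a * moment y (Suc (Suc b)))" by simp
    finally show ?thesis using p by simp
  qed
qed

text \<open>Moving one unit from the smaller exponent to the larger one does not decrease the
  product; repeat until the smaller exponent is 0, where the moment is |y|^2.\<close>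

lemma moment_mult_le: "moment y a * moment y b \<le> moment y 0 * moment y (a + b)"
proof -
  have *: "a \<le> b \<Longrightarrow> moment y a * moment y b \<le> moment y 0 * moment y (a + b)" for a b
  proof (induction a arbitrary: b)
    case (Suc a)
    have "moment y (Suc a) * moment y b \<le> moment y a * moment y (Suc b)"
      using Suc.prems by (intro moment_shift_le) simp
    also have "\<dots> \<le> moment y 0 * moment y (a + Suc b)"
      using Suc.prems by (intro Suc.IH) simp
    finally show ?case by simp
  qed simp
  show ?thesis
  proof (cases "a \<le> b")
    case False
    then have "moment y b * moment y a \<le> moment y 0 * moment y (b + a)" by (intro *) simp
    then show ?thesis by (simp add: ac_simps)
  qed (rule *)
qed

text \<open>Jensen's inequality for the spectral measure at \<open>x\<close>, followed by the trace
  bound for the power. Because a high power is used, passing from the norm to the trace costs only a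
  factor m^(1/(k+1)).\<close>

lemma quadratic_power_le: "ip m (A x) x ^ Suc k \<le> ip m x x ^ Suc k * op_trace m (A ^^ Suc k)"
proof -
  have "moment x 1 ^ Suc k \<le> moment x 0 ^ k * moment x (Suc k)"
  proof (induction k)
    case (Suc k)
    have "moment x 1 ^ Suc (Suc k) = moment x 1 * moment x 1 ^ Suc k" by simp
    also have "\<dots> \<le> moment x 1 * (moment x 0 ^ k * moment x (Suc k))"
      by (intro mult_left_mono Suc.IH moment_nonneg)
    also have "\<dots> = moment x 0 ^ k * (moment x 1 * moment x (Suc k))" by simp
    also have "\<dots> \<le> moment x 0 ^ k * (moment x 0 * moment x (1 + Suc k))"
      by (intro mult_left_mono moment_mult_le zero_le_power moment_nonneg)
    finally show ?case by (simp add: ac_simps)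
  qed simp
  also have "\<dots> \<le> moment x 0 ^ k * (ip m x x * op_trace m (A ^^ Suc k))"
    unfolding moment_def[of x "Suc k"]
    by (intro mult_left_mono psd_op.quadratic_le_trace[OF psd_op_funpow] zero_le_power moment_nonneg)
  finally show ?thesis by (simp add: moment_def ac_simps)
qed

lemma rank_one_psd_op: "psd_op m (\<lambda>x i. A x i + ip m y x * y i)"
proof
  fix x z c
  show "(\<lambda>i. A (\<lambda>i. x i + c * z i) i + ip m y (\<lambda>i. x i + c * z i) * y i)
      = (\<lambda>i. A x i + ip m y x * y i + c * (A z i + ip m y z * y i))"
    by (simp add: lin ip_add_scale_right algebra_simps)
  show "ip m (\<lambda>i. A x i + ip m y x * y i) z = ip m x (\<lambda>i. A z i + ip m y z * y i)"
    by (simp add: ip_add_scale_left ip_add_scale_right sym ip_commute[of m x y])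
  show "0 \<le> ip m (\<lambda>i. A x i + ip m y x * y i) x"
    by (simp add: ip_add_scale_left psd)
qed

text \<open>Splitting off one factor \<open>N\<close> gives two branches. Its \<open>A\<close> part
  moves to the left by symmetry and raises \<open>a\<close>. Its rank-one part leaves
  \<open>moment y a\<close> times a form with exponent 0 on the left, and the resulting product of
  moments is merged at the price \<open>rho\<close>. The factor 2^b counts the branches.\<close>

lemma rank_one_mixed_le:
  assumes rho: "ip m y y \<le> rho"
  defines "N \<equiv> \<lambda>x i. A x i + ip m y x * y i"
  shows "ip m ((A ^^ a) y) ((N ^^ b) y) \<le> 2 ^ b * (\<Sum>j\<le>b. rho ^ j * moment y (a + b - j))"
proof (induction b arbitrary: a)
  case 0
  show ?case by (simp add: moment_def)
next
  case (Suc b)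
  have N_app: "N x = (\<lambda>i. A x i + ip m y x * y i)" for x by (simp add: N_def)
  have r0: "0 \<le> rho" using rho ip_self_nonneg[of m y] by linarith
  let ?t = "\<lambda>j. rho ^ j * moment y (a + Suc b - j)"
  have t0: "0 \<le> ?t j" for j using r0 moment_nonneg by simp
  have "ip m ((A ^^ a) y) ((N ^^ Suc b) y)
      = ip m ((A ^^ Suc a) y) ((N ^^ b) y) + moment y a * ip m ((A ^^ 0) y) ((N ^^ b) y)"
    by (simp add: N_app[of "(N ^^ b) y"] ip_add_scale_right sym moment_def)
  also have "\<dots> \<le> 2 ^ b * (\<Sum>j\<le>b. rho ^ j * moment y (Suc a + b - j))
      + moment y a * (2 ^ b * (\<Sum>j\<le>b. rho ^ j * moment y (0 + b - j)))"
    by (intro add_mono mult_left_mono Suc.IH moment_nonneg)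
  also have "moment y a * (2 ^ b * (\<Sum>j\<le>b. rho ^ j * moment y (0 + b - j)))
      = 2 ^ b * (\<Sum>j\<le>b. rho ^ j * (moment y a * moment y (b - j)))"
    by (simp add: sum_distrib_left ac_simps)
  also have "\<dots> \<le> 2 ^ b * (\<Sum>j\<le>b. rho ^ j * (rho * moment y (a + b - j)))"
  proof (intro mult_left_mono sum_mono)
    fix j assume "j \<in> {..b}"
    then have "a + (b - j) = a + b - j" by simp
    then have "moment y a * moment y (b - j) \<le> moment y 0 * moment y (a + b - j)"
      using moment_mult_le[of y a "b - j"] by simp
    also have "\<dots> \<le> rho * moment y (a + b - j)"
      using rho moment_nonneg by (intro mult_right_mono) (simp_all add: moment_0)
    finally show "moment y a * moment y (b - j) \<le> rho * moment y (a + b - j)" .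
  qed (use r0 in auto)
  also have "(\<Sum>j\<le>b. rho ^ j * (rho * moment y (a + b - j))) = (\<Sum>j\<le>b. ?t (Suc j))"
    by (simp add: ac_simps)
  also have "(\<Sum>j\<le>b. ?t (Suc j)) \<le> (\<Sum>j\<le>Suc b. ?t j)"
    unfolding sum.atMost_Suc_shift using t0[of 0] by simp
  also have "(\<Sum>j\<le>b. rho ^ j * moment y (Suc a + b - j)) = (\<Sum>j\<le>b. ?t j)" by simp
  also have "(\<Sum>j\<le>b. ?t j) \<le> (\<Sum>j\<le>Suc b. ?t j)" using t0[of "Suc b"] by simp
  finally show ?case by (simp add: mult_left_mono)
qed

text \<open>Telescoping: N^k - A^k is the sum of A^(k-1-i) (N - A) N^i, and N - A = y y^T.\<close>

lemma rank_one_bilinear: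
  fixes y :: "nat \<Rightarrow> real"
  defines "N \<equiv> \<lambda>x i. A x i + ip m y x * y i"
  shows "ip m ((N ^^ k) x) z = ip m ((A ^^ k) x) z
    + (\<Sum>i<k. ip m ((A ^^ (k - 1 - i)) y) z * ip m ((N ^^ i) y) x)"
proof (induction k arbitrary: z)
  case 0
  show ?case by simp
next
  case (Suc k)
  have N_app: "N x = (\<lambda>i. A x i + ip m y x * y i)" for x by (simp add: N_def)
  interpret N: psd_op m N unfolding N_def by (rule rank_one_psd_op)
  interpret Nk: psd_op m "N ^^ k" by (rule N.psd_op_funpow)
  have "ip m ((N ^^ Suc k) x) z = ip m ((N ^^ k) x) (N z)" by (simp add: N.sym)
  also have "\<dots> = ip m ((N ^^ k) x) (A z) + ip m y z * ip m ((N ^^ k) x) y"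
    by (simp add: N_app[of z] ip_add_scale_right)
  also have "ip m ((N ^^ k) x) y = ip m ((N ^^ k) y) x"
    by (subst Nk.sym) (rule ip_commute)
  also have "ip m ((N ^^ k) x) (A z) = ip m ((A ^^ Suc k) x) z
      + (\<Sum>i<k. ip m ((A ^^ (Suc k - 1 - i)) y) z * ip m ((N ^^ i) y) x)"
  proof -
    have "ip m ((A ^^ (k - 1 - i)) y) (A z) = ip m ((A ^^ (Suc k - 1 - i)) y) z" if "i < k" for i
    proof -
      have "Suc k - 1 - i = Suc (k - 1 - i)" using that by simp
      then show ?thesis by (simp add: sym)
    qed
    then show ?thesis unfolding Suc.IH by (simp add: sym)
  qed
  finally show ?case by simp
qed

text \<open>Under the trace each telescoping term becomes <A^(k-1-i) y, N^i y>, a mixed form with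
  exponents adding to k - 1. The bound is linear in the moments of \<open>y\<close>, so its mean is
  controlled by the second moments of the entries of \<open>y\<close>.\<close>

lemma rank_one_trace_le:
  assumes rho: "ip m y y \<le> rho"
  shows "op_trace m ((\<lambda>x i. A x i + ip m y x * y i) ^^ k)
    \<le> op_trace m (A ^^ k) + 2 ^ k * (\<Sum>j<k. rho ^ j * moment y (k - 1 - j))"
proof -
  define N where "N = (\<lambda>x i. A x i + ip m y x * y i)"
  have r0: "0 \<le> rho" using rho ip_self_nonneg[of m y] by linarith
  let ?t = "\<lambda>j. rho ^ j * moment y (k - 1 - j)"
  have t0: "0 \<le> ?t j" for j using r0 moment_nonneg by simp
  have "op_trace m (N ^^ k) = (\<Sum>l<m. ip m ((N ^^ k) (unit_fun l)) (unit_fun l))"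
    by (simp add: op_trace_def ip_unit_fun)
  also have "\<dots> = (\<Sum>l<m. ip m ((A ^^ k) (unit_fun l)) (unit_fun l)
    + (\<Sum>i<k. ip m ((A ^^ (k - 1 - i)) y) (unit_fun l) * ip m ((N ^^ i) y) (unit_fun l)))"
    unfolding N_def by (subst rank_one_bilinear) simp
  also have "\<dots> = op_trace m (A ^^ k) + (\<Sum>i<k. ip m ((A ^^ (k - 1 - i)) y) ((N ^^ i) y))"
    by (simp add: op_trace_def ip_unit_fun sum.distrib ip_def[of m "(A ^^ _) y" "(N ^^ _) y"]
        sum.swap[of _ "{..<k}"])
  finally have e: "op_trace m (N ^^ k)
    = op_trace m (A ^^ k) + (\<Sum>i<k. ip m ((A ^^ (k - 1 - i)) y) ((N ^^ i) y))" .
  have le: "(\<Sum>i<k. ip m ((A ^^ (k - 1 - i)) y) ((N ^^ i) y)) \<le> (\<Sum>i<k. 2 ^ i * (\<Sum>j<k. ?t j))"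
  proof (intro sum_mono)
    fix i assume i: "i \<in> {..<k}"
    have "ip m ((A ^^ (k - 1 - i)) y) ((N ^^ i) y)
        \<le> 2 ^ i * (\<Sum>j\<le>i. rho ^ j * moment y (k - 1 - i + i - j))"
      unfolding N_def by (rule rank_one_mixed_le[OF rho])
    also have "(\<Sum>j\<le>i. rho ^ j * moment y (k - 1 - i + i - j)) = (\<Sum>j\<le>i. ?t j)"
      using i by simp
    also have "\<dots> \<le> (\<Sum>j<k. ?t j)"
      using i t0 by (intro sum_mono2) auto
    finally show "ip m ((A ^^ (k - 1 - i)) y) ((N ^^ i) y) \<le> 2 ^ i * (\<Sum>j<k. ?t j)" by simp
  qed
  have "(\<Sum>i<k. 2 ^ i * (\<Sum>j<k. ?t j)) = (\<Sum>i<k. 2 ^ i) * (\<Sum>j<k. ?t j)"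
    by (rule sum_distrib_right[symmetric])
  moreover have "(\<Sum>i<k. 2 ^ i) * (\<Sum>j<k. ?t j) \<le> 2 ^ k * (\<Sum>j<k. ?t j)"
  proof (rule mult_right_mono)
    show "(\<Sum>i<k. 2 ^ i) \<le> (2::real) ^ k" by (simp add: geometric_sum)
    show "0 \<le> (\<Sum>j<k. ?t j)" using t0 by (intro sum_nonneg)
  qed
  ultimately show ?thesis using e le unfolding N_def by linarith
qed

text \<open>A covariance C with diagonal at most cd and off-diagonal entries at most co satisfies
  \<open>C \<le> (cd + m co) I\<close> when tested against positive semidefinite operators.\<close>
lemma weighted_entries_le:
  assumes d: "\<And>i. i < m \<Longrightarrow> \<bar>C i i\<bar> \<le> cd" and o: "\<And>i j. i < m \<Longrightarrow> j < m \<Longrightarrow> i \<noteq> j \<Longrightarrow> \<bar>C i j\<bar> \<le> co"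
    and co: "0 \<le> co"
  shows "(\<Sum>i<m. \<Sum>j<m. A (unit_fun j) i * C i j) \<le> (cd + real m * co) * op_trace m A"
proof -
  let ?B = "\<lambda>i j. A (unit_fun j) i"
  have "?B i j * C i j \<le> (if i = j then cd * ?B i i else 0) + (?B i i + ?B j j) / 2 * co"
    if "i < m" "j < m" for i j
  proof (cases "i = j")
    case True
    have "?B i i * C i i \<le> ?B i i * cd"
      using d[OF that(1)] diag_nonneg[OF that(1)] by (intro mult_left_mono) auto
    then show ?thesis using True co diag_nonneg[OF that(1)] by (simp add: mult.commute add_increasing2)
  next
    case False
    have "?B i j * C i j \<le> \<bar>?B i j\<bar> * \<bar>C i j\<bar>" by (metis abs_ge_self abs_mult)
    also have "\<dots> \<le> ((?B i i + ?B j j) / 2) * co"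
      using entry_le[OF that] o[OF that False] by (intro mult_mono) auto
    finally show ?thesis using False by simp
  qed
  then have "(\<Sum>i<m. \<Sum>j<m. ?B i j * C i j)
      \<le> (\<Sum>i<m. \<Sum>j<m. (if i = j then cd * ?B i i else 0) + (?B i i + ?B j j) / 2 * co)"
    by (intro sum_mono) auto
  also have "\<dots> = (cd + real m * co) * op_trace m A"
  proof -
    have "(\<Sum>i<m. \<Sum>j<m. (if i = j then cd * ?B i i else 0)) = cd * op_trace m A"
      by (simp add: op_trace_def sum_distrib_left)
    moreover have "(\<Sum>i<m. \<Sum>j<m. (?B i i + ?B j j) / 2 * co) = real m * co * op_trace m A"
      by (simp add: op_trace_def sum.distrib add_divide_distrib distrib_right
          sum_divide_distrib[symmetric] sum_distrib_right[symmetric] sum_distrib_left[symmetric])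
    ultimately show ?thesis by (simp add: sum.distrib distrib_right)
  qed
  finally show ?thesis .
qed

lemma op_apply: "l < m \<Longrightarrow> A y l = (\<Sum>i<m. A (unit_fun l) i * y i)"
  using sym[of y "unit_fun l"] ip_unit_fun[of l m "A y"] by (simp add: ip_def ip_commute mult.commute)

end

text \<open>For the matrix Y with rows y_s this is Y^T Y. It acts on the m columns, so the space
  stays fixed while rows are added.\<close>

definition gram :: "nat \<Rightarrow> (nat \<Rightarrow> nat \<Rightarrow> real) \<Rightarrow> nat \<Rightarrow> (nat \<Rightarrow> real) \<Rightarrow> nat \<Rightarrow> real" where
  "gram m y t x i = (\<Sum>s<t. ip m (y s) x * y s i)"

lemma gram_Suc: "gram m y (Suc t) = (\<lambda>x i. gram m y t x i + ip m (y t) x * y t i)"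
  by (simp add: gram_def fun_eq_iff)

lemma psd_op_gram: "psd_op m (gram m y t)"
proof (induction t)
  case 0
  show ?case by (simp add: psd_op_def gram_def ip_def)
next
  case (Suc t)
  then show ?case unfolding gram_Suc by (rule psd_op.rank_one_psd_op)
qed

lemma ip_gram: "ip m (gram m y t x) x = (\<Sum>s<t. (ip m (y s) x)\<^sup>2)"
proof (induction t)
  case 0
  show ?case by (simp add: gram_def ip_def)
next
  case (Suc t)
  then show ?case by (simp add: gram_Suc ip_add_scale_left power2_eq_square)
qed

lemma gram_cong: "(\<And>s. s < t \<Longrightarrow> y s = y' s) \<Longrightarrow> gram m y t = gram m y' t"
  unfolding gram_def by (intro ext sum.cong) auto

lemma sum_ip_sq_le:
  assumes "op_trace m (gram m y t ^^ Suc k) \<le> L ^ Suc k" "0 \<le> L"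
  shows "(\<Sum>s<t. (ip m (y s) x)\<^sup>2) \<le> L * ip m x x"
proof -
  have "ip m (gram m y t x) x ^ Suc k \<le> ip m x x ^ Suc k * L ^ Suc k"
    using psd_op.quadratic_power_le[OF psd_op_gram, of m y t x k]
      mult_left_mono[OF assms(1) zero_le_power[OF ip_self_nonneg], of m x "Suc k"] by linarith
  then have "ip m (gram m y t x) x ^ Suc k \<le> (L * ip m x x) ^ Suc k"
    by (simp add: power_mult_distrib ac_simps)
  then have "ip m (gram m y t x) x \<le> L * ip m x x"
    by (rule power_le_imp_le_base) (use assms(2) ip_self_nonneg[of m x] in simp)
  then show ?thesis by (simp add: ip_gram)
qed

section \<open>Gaussian moments\<close>

definition gmom :: "nat \<Rightarrow> real" where
  "gmom k = gauss_mean (monom 1 k)"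

lemma gmom_0: "gmom 0 = 1"
  using gauss_mean_monom_even[of 0] by (simp add: gmom_def)

lemma gmom_even: "gmom (2 * k) = fact (2 * k) / (2 ^ k * fact k)"
  by (simp add: gmom_def gauss_mean_monom_even)

lemma gmom_odd: "odd k \<Longrightarrow> gmom k = 0"
  using gauss_mean_monom_odd by (auto simp: gmom_def elim!: oddE)

lemma gmom_nonneg: "0 \<le> gmom k"
proof (cases "even k")
  case True
  then obtain i where "k = 2 * i" by auto
  then show ?thesis by (simp add: gmom_even)
qed (simp add: gmom_odd)

context prob_space
begin

lemma std_normal_moment:
  assumes "distributed M lborel X std_normal_density"
  shows "integrable M (\<lambda>w. X w ^ k)" and "expectation (\<lambda>w. X w ^ k) = gmom k"
proof -
  show "integrable M (\<lambda>w. X w ^ k)"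
    using distributed_integrable[OF assms, of "\<lambda>x. x ^ k"] integrable_std_normal_moment[of k]
    by simp
  show "expectation (\<lambda>w. X w ^ k) = gmom k"
    using distributed_integral[OF assms, of "\<lambda>x. x ^ k"]
    by (simp add: gmom_def gauss_mean_def poly_monom mult.commute)
qed

lemma lincomb_normal:
  assumes J: "finite J" "indep_vars (\<lambda>_. borel) W J"
    and W: "\<And>l. l \<in> J \<Longrightarrow> distributed M lborel (W l) std_normal_density"
    and pos: "0 < (\<Sum>l\<in>J. (a l)\<^sup>2)"
  shows "distributed M lborel (\<lambda>w. \<Sum>l\<in>J. a l * W l w) (normal_density 0 (sqrt (\<Sum>l\<in>J. (a l)\<^sup>2)))"
proof -
  \<comment> \<open>Zero coefficients would contribute normal laws of standard deviation 0, which
    have no density; they are dropped here and put back at the end.\<close>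
  let ?J = "{l \<in> J. a l \<noteq> 0}"
  have ne: "?J \<noteq> {}"
  proof
    assume "?J = {}"
    then have "(\<Sum>l\<in>J. (a l)\<^sup>2) = 0" by (intro sum.neutral) auto
    then show False using pos by simp
  qed
  have ind: "indep_vars (\<lambda>_. borel) (\<lambda>l w. a l * W l w) ?J"
    by (rule indep_vars_compose2[OF indep_vars_subset[OF J(2)]]) auto
  have d: "distributed M lborel (\<lambda>w. a l * W l w) (normal_density 0 \<bar>a l\<bar>)" if "l \<in> ?J" for l
    using normal_density_affine[of "W l" 0 1 "a l" 0] W[of l] that by simp
  have "distributed M lborel (\<lambda>w. \<Sum>l\<in>?J. a l * W l w)
      (normal_density (\<Sum>l\<in>?J. 0) (sqrt (\<Sum>l\<in>?J. \<bar>a l\<bar>\<^sup>2)))"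
    using J ne ind d by (intro sum_indep_normal) auto
  moreover have "(\<Sum>l\<in>?J. a l * W l w) = (\<Sum>l\<in>J. a l * W l w)" for w
    using J by (intro sum.mono_neutral_left) auto
  moreover have "(\<Sum>l\<in>?J. (a l)\<^sup>2) = (\<Sum>l\<in>J. (a l)\<^sup>2)"
    using J by (intro sum.mono_neutral_left) auto
  ultimately show ?thesis by simp
qed

lemma lincomb_moment:
  assumes J: "finite J" "indep_vars (\<lambda>_. borel) W J"
    and W: "\<And>l. l \<in> J \<Longrightarrow> distributed M lborel (W l) std_normal_density"
  shows "integrable M (\<lambda>w. (\<Sum>l\<in>J. a l * W l w) ^ k)" (is ?int)
    and "expectation (\<lambda>w. (\<Sum>l\<in>J. a l * W l w) ^ k) = sqrt (\<Sum>l\<in>J. (a l)\<^sup>2) ^ k * gmom k" (is ?eq)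
proof -
  let ?s = "sqrt (\<Sum>l\<in>J. (a l)\<^sup>2)" and ?S = "\<lambda>w. \<Sum>l\<in>J. a l * W l w"
  have "?int \<and> ?eq"
  proof (cases "(\<Sum>l\<in>J. (a l)\<^sup>2) = 0")
    case True
    then have "\<forall>l\<in>J. a l = 0" using J by (subst (asm) sum_nonneg_eq_0_iff) auto
    then have "?S w = 0" for w by simp
    then show ?thesis using True by (cases k) (simp_all add: gmom_0 prob_space)
  next
    case False
    then have pos: "0 < (\<Sum>l\<in>J. (a l)\<^sup>2)"
      by (simp add: less_le sum_nonneg)
    then have s: "0 < ?s" by simp
    have "distributed M lborel ?S (normal_density 0 ?s)"
      by (rule lincomb_normal[OF J W pos])
    then have d: "distributed M lborel (\<lambda>w. ?S w / ?s) std_normal_density"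
      using normal_standard_normal_convert[OF s, of ?S 0] by simp
    have e: "?S w ^ k = ?s ^ k * (?S w / ?s) ^ k" for w
      using s by (simp add: power_divide)
    show ?thesis unfolding e using std_normal_moment[OF d, of k] by simp
  qed
  then show ?int ?eq by auto
qed

lemma prod_power_integrable:
  fixes X Y :: "'a \<Rightarrow> real"
  assumes X: "\<And>k. integrable M (\<lambda>w. X w ^ k)" and Y: "\<And>k. integrable M (\<lambda>w. Y w ^ k)"
  shows "integrable M (\<lambda>w. X w ^ i * Y w ^ j)"
proof (rule Bochner_Integration.integrable_bound)
  show "integrable M (\<lambda>w. X w ^ (2 * i) + Y w ^ (2 * j))" using X Y by simp
  have [measurable]: "X \<in> borel_measurable M" "Y \<in> borel_measurable M"
    using X[of 1] Y[of 1] by (auto dest!: borel_measurable_integrable)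
  show "(\<lambda>w. X w ^ i * Y w ^ j) \<in> borel_measurable M" by measurable
  show "AE w in M. norm (X w ^ i * Y w ^ j) \<le> norm (X w ^ (2 * i) + Y w ^ (2 * j))"
  proof (rule AE_I2)
    fix w
    have "2 * \<bar>X w ^ i * Y w ^ j\<bar> \<le> (X w ^ i)\<^sup>2 + (Y w ^ j)\<^sup>2"
      using sum_squares_bound[of "\<bar>X w ^ i\<bar>" "\<bar>Y w ^ j\<bar>"] by (simp add: abs_mult)
    moreover have "0 \<le> (X w ^ i)\<^sup>2 + (Y w ^ j)\<^sup>2" by simp
    moreover have "(X w ^ i)\<^sup>2 = X w ^ (2 * i)" "(Y w ^ j)\<^sup>2 = Y w ^ (2 * j)"
      by (simp_all add: power_mult[symmetric] mult.commute)
    ultimately show "norm (X w ^ i * Y w ^ j) \<le> norm (X w ^ (2 * i) + Y w ^ (2 * j))"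
      unfolding real_norm_def by linarith
  qed
qed

text \<open>\<open>E (X + \<beta> Y)^(2k)\<close> is \<open>gmom (2 k)\<close> times the k-th power of the variance of \<open>X + \<beta> Y\<close>;
  the mixed moment is read off by comparing the coefficients of \<open>\<beta>^k\<close>.\<close>
lemma joint_moment:
  fixes a b :: "'b \<Rightarrow> real" and W :: "'b \<Rightarrow> 'a \<Rightarrow> real"
  assumes J: "finite J" "indep_vars (\<lambda>_. borel) W J"
    and W: "\<And>l. l \<in> J \<Longrightarrow> distributed M lborel (W l) std_normal_density"
  defines "X \<equiv> \<lambda>w. \<Sum>l\<in>J. a l * W l w" and "Y \<equiv> \<lambda>w. \<Sum>l\<in>J. b l * W l w"
  shows "real (2 * k choose k) * expectation (\<lambda>w. X w ^ k * Y w ^ k)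
    = gmom (2 * k) * coeff ([:\<Sum>l\<in>J. (a l)\<^sup>2, 2 * (\<Sum>l\<in>J. a l * b l), \<Sum>l\<in>J. (b l)\<^sup>2:] ^ k) k"
proof -
  define q where "q = [:\<Sum>l\<in>J. (a l)\<^sup>2, 2 * (\<Sum>l\<in>J. a l * b l), \<Sum>l\<in>J. (b l)\<^sup>2:]"
  have X: "integrable M (\<lambda>w. X w ^ k)" for k unfolding X_def by (rule lincomb_moment[OF J W])
  have Y: "integrable M (\<lambda>w. Y w ^ k)" for k unfolding Y_def by (rule lincomb_moment[OF J W])
  have XY: "integrable M (\<lambda>w. Y w ^ i * X w ^ j)" for i j
    by (rule prod_power_integrable[OF Y X])
  let ?c = "\<lambda>i. real (2 * k choose i) * expectation (\<lambda>w. Y w ^ i * X w ^ (2 * k - i))"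
  define P where "P = (\<Sum>i\<le>2 * k. monom (?c i) i)"
  have "P = smult (gmom (2 * k)) (q ^ k)"
  proof (rule poly_eq_poly_eq_iff[THEN iffD1], rule ext)
    fix x
    have lin: "x * Y w + X w = (\<Sum>l\<in>J. (a l + x * b l) * W l w)" for w
      by (simp add: X_def Y_def sum_distrib_left sum.distrib algebra_simps)
    have var: "(\<Sum>l\<in>J. (a l + x * b l)\<^sup>2) = poly q x"
      by (simp add: q_def power2_eq_square sum_distrib_left sum.distrib algebra_simps)
    have "poly P x = (\<Sum>i\<le>2 * k. x ^ i * ?c i)"
      by (simp add: P_def poly_sum poly_monom mult.commute)
    also have "\<dots> = (\<Sum>i\<le>2 * k. expectation (\<lambda>w.
        real (2 * k choose i) * x ^ i * (Y w ^ i * X w ^ (2 * k - i))))"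
      by (simp only: integral_mult_right_zero) (simp only: ac_simps)
    also have "\<dots> = expectation (\<lambda>w. \<Sum>i\<le>2 * k.
        real (2 * k choose i) * x ^ i * (Y w ^ i * X w ^ (2 * k - i)))"
      by (rule Bochner_Integration.integral_sum[symmetric]) (intro integrable_mult_right XY)
    also have "\<dots> = expectation (\<lambda>w. (x * Y w + X w) ^ (2 * k))"
      by (simp only: binomial_ring power_mult_distrib mult.assoc)
    also have "\<dots> = sqrt (poly q x) ^ (2 * k) * gmom (2 * k)"
      unfolding lin var[symmetric] by (rule lincomb_moment[OF J W])
    also have "sqrt (poly q x) ^ (2 * k) = poly q x ^ k"
    proof -
      have "0 \<le> poly q x" unfolding var[symmetric] by (simp add: sum_nonneg)
      then show ?thesis by (simp add: power_mult)
    qed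
    finally show "poly P x = poly (smult (gmom (2 * k)) (q ^ k)) x" by simp
  qed
  then have "coeff P k = coeff (smult (gmom (2 * k)) (q ^ k)) k" by simp
  moreover have "coeff P k = ?c k"
    by (simp add: P_def coeff_sum sum.delta)
  moreover have "(\<lambda>w. X w ^ k * Y w ^ k) = (\<lambda>w. Y w ^ k * X w ^ (2 * k - k))"
    by (simp add: mult_2 mult.commute fun_eq_iff)
  ultimately show ?thesis unfolding q_def by (simp only: coeff_smult)
qed

end

section \<open>Coefficients of powers of a quadratic close to 1 + x^2\<close>

fun coeff_lip :: "nat \<Rightarrow> real" where
  "coeff_lip 0 = 0"
| "coeff_lip (Suc k) = 6 * coeff_lip k + 4 * 2 ^ k"

lemma coeff_lip_nonneg: "0 \<le> coeff_lip k"
  by (induction k) auto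

lemma coeff_trinomial_Suc:
  "coeff ([:s, r, t:] ^ Suc k) i = s * coeff ([:s, r, t:] ^ k) i
    + (if i = 0 then 0 else r * coeff ([:s, r, t:] ^ k) (i - 1))
    + (if i < 2 then 0 else t * coeff ([:s, r, t:] ^ k) (i - 2) :: real)"
proof (cases i)
  case (Suc j)
  then show ?thesis by (cases j) (simp_all add: mult_pCons_left)
qed (simp add: mult_pCons_left)

lemma coeff_trinomial_base_le: "\<bar>coeff ([:1, 0, 1:] ^ k :: real poly) i\<bar> \<le> 2 ^ k"
proof (induction k arbitrary: i)
  case 0
  show ?case by (simp add: coeff_1)
next
  case (Suc k)
  have "\<bar>coeff ([:1, 0, 1:] ^ Suc k :: real poly) i\<bar>
      \<le> \<bar>coeff ([:1, 0, 1:] ^ k :: real poly) i\<bar> + \<bar>coeff ([:1, 0, 1:] ^ k :: real poly) (i - 2)\<bar>"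
    unfolding coeff_trinomial_Suc by (auto intro: abs_triangle_ineq)
  also have "\<dots> \<le> 2 ^ k + 2 ^ k" by (intro add_mono Suc)
  finally show ?case by simp
qed

text \<open>In \<open>joint_moment\<close> the variance of X + \<beta> Y is a quadratic in \<beta>.
  For nearly orthonormal coefficient vectors it is close to 1 + \<beta>^2, and this closeness is
  carried to the coefficients of its powers. The bound \<open>eta\<close> \<le> 1 keeps
  \<open>s\<close> and \<open>t\<close> below 2.\<close>

lemma coeff_trinomial_lipschitz:
  fixes s r t eta :: real
  assumes "\<bar>s - 1\<bar> \<le> eta" "\<bar>r\<bar> \<le> eta" "\<bar>t - 1\<bar> \<le> eta" "eta \<le> 1"
  shows "\<bar>coeff ([:s, 2 * r, t:] ^ k) i - coeff ([:1, 0, 1:] ^ k) i\<bar> \<le> coeff_lip k * eta"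
proof (induction k arbitrary: i)
  case 0
  show ?case by simp
next
  case (Suc k)
  have e0: "0 \<le> eta" using assms(2) by linarith
  let ?P = "\<lambda>i. coeff ([:s, 2 * r, t:] ^ k) i" and ?Q = "\<lambda>i. coeff ([:1, 0, 1:] ^ k :: real poly) i"
  have near: "\<bar>u * ?P i - ?Q i\<bar> \<le> 2 * (coeff_lip k * eta) + 2 ^ k * eta" if u: "\<bar>u - 1\<bar> \<le> eta" for u i
  proof -
    have "u * ?P i - ?Q i = u * (?P i - ?Q i) + ?Q i * (u - 1)" by (simp add: algebra_simps)
    also have "\<bar>\<dots>\<bar> \<le> \<bar>u\<bar> * \<bar>?P i - ?Q i\<bar> + \<bar>?Q i\<bar> * \<bar>u - 1\<bar>"
      using abs_triangle_ineq[of "u * (?P i - ?Q i)" "?Q i * (u - 1)"] by (simp add: abs_mult)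
    also have "\<dots> \<le> 2 * (coeff_lip k * eta) + 2 ^ k * eta"
      using u assms(4) Suc.IH[of i] coeff_trinomial_base_le[of k i] by (intro add_mono mult_mono) auto
    finally show ?thesis .
  qed
  have small: "\<bar>2 * r * ?P i\<bar> \<le> 2 * (coeff_lip k * eta) + 2 * (2 ^ k * eta)" for i
  proof -
    have "\<bar>?P i\<bar> \<le> coeff_lip k * eta + 2 ^ k"
      using Suc.IH[of i] coeff_trinomial_base_le[of k i] by linarith
    moreover have "coeff_lip k * eta \<le> coeff_lip k * 1"
      using coeff_lip_nonneg assms(4) by (intro mult_left_mono)
    ultimately have "\<bar>?P i\<bar> \<le> coeff_lip k + 2 ^ k" by linarith
    then have "\<bar>r\<bar> * \<bar>?P i\<bar> \<le> eta * (coeff_lip k + 2 ^ k)"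
      using assms(2) e0 by (intro mult_mono) auto
    then show ?thesis by (simp add: abs_mult algebra_simps)
  qed
  have nonneg: "0 \<le> coeff_lip k * eta" "0 \<le> 2 ^ k * eta" using coeff_lip_nonneg e0 by auto
  have "\<bar>coeff ([:s, 2 * r, t:] ^ Suc k) i - coeff ([:1, 0, 1:] ^ Suc k) i\<bar>
      \<le> \<bar>s * ?P i - ?Q i\<bar> + (if i = 0 then 0 else \<bar>2 * r * ?P (i - 1)\<bar>)
        + (if i < 2 then 0 else \<bar>t * ?P (i - 2) - ?Q (i - 2)\<bar>)"
    unfolding coeff_trinomial_Suc by (auto; linarith)
  \<comment> \<open>Up to the factor \<open>eta\<close>, each outer term gives 2
    \<open>coeff_lip k\<close> + 2^k and the middle one 2 \<open>coeff_lip k\<close> + 2 * 2^k; this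
    is the origin of the recursion for \<open>coeff_lip\<close>.\<close>
  also have "\<dots> \<le> 6 * (coeff_lip k * eta) + 4 * (2 ^ k * eta)"
    using near[OF assms(1), of i] small[of "i - 1"] near[OF assms(3), of "i - 2"] nonneg
    by (auto simp: split: if_splits)
  also have "\<dots> = coeff_lip (Suc k) * eta" by (simp add: algebra_simps)
  finally show ?case .
qed

text \<open>The constant coefficient of (s + x^2)^k.\<close>

lemma power_near_one:
  fixes s eta :: real
  assumes "\<bar>s - 1\<bar> \<le> eta" "eta \<le> 1"
  shows "\<bar>s ^ k - 1\<bar> \<le> coeff_lip k * eta"
  using coeff_trinomial_lipschitz[of s eta 0 1 k 0] assms by (simp add: coeff_0_power)

text \<open>The value of \<open>joint_moment\<close> at orthonormal coefficient vectors, where X and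
  Y are independent and E X^k Y^k = (gmom k)^2. For odd k both sides vanish; for k = 2 i the
  coefficient is the binomial of k over i and factorials cancel.\<close>

lemma gmom_binomial:
  "gmom (2 * k) * coeff ([:1, 0, 1:] ^ k) k = real (2 * k choose k) * (gmom k)\<^sup>2"
proof -
  have "[:1, 0, 1:] = monom 1 2 + (1 :: real poly)"
    by (simp add: monom_altdef numeral_2_eq_2 one_pCons)
  then have "[:1, 0, 1:] ^ k = (\<Sum>j\<le>k. monom (real (k choose j)) (2 * j))"
    by (simp add: binomial_ring monom_power of_nat_poly smult_monom)
  then have c: "coeff ([:1, 0, 1:] ^ k) k = (\<Sum>j\<le>k. if 2 * j = k then real (k choose j) else 0)"
    by (simp add: coeff_sum)
  show ?thesis
  proof (cases "even k")
    case False
    then have "coeff ([:1, 0, 1:] ^ k) k = (0::real)" unfolding c by (intro sum.neutral) auto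
    then show ?thesis using False by (simp add: gmom_odd)
  next
    case True
    then obtain i where i: "k = 2 * i" by auto
    have "coeff ([:1, 0, 1:] ^ k) k = (\<Sum>j\<le>k. if j = i then real (k choose j) else 0)"
      unfolding c by (intro sum.cong) (auto simp: i)
    also have "\<dots> = real (k choose i)" by (simp add: i)
    finally have c': "coeff ([:1, 0, 1:] ^ k) k = real (k choose i)" .
    have b1: "real (k choose i) = fact k / (fact i * fact i)"
      using binomial_fact[of i k, where 'a = real] by (simp add: i)
    have b2: "real (2 * k choose k) = fact (2 * k) / (fact k * fact k)"
      using binomial_fact[of k "2 * k", where 'a = real] by simp
    have g: "gmom k = fact k / (2 ^ i * fact i)" using gmom_even[of i] i by simp
    have t: "(2::real) ^ k = 2 ^ i * 2 ^ i" by (simp add: i mult_2 power_add)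
    have "F / (T * T * K) * (K / (I * I)) = F / (K * K) * (K / (T * I))\<^sup>2"
      if "K \<noteq> 0" for F T K I :: real
      using that by (simp add: power2_eq_square)
    then show ?thesis unfolding c' gmom_even b1 b2 g t by simp
  qed
qed

text \<open>One constant for two bounds. The terms with \<open>coeff_lip\<close> bound the
  off-diagonal second moments, through the joint moment and the two means. The terms 2^k gmom (2 k)
  and (gmom k)^2 bound the diagonal ones, where the variance is at most 2.\<close>

definition kernel_const :: "nat \<Rightarrow> real" where
  "kernel_const k = gmom (2 * k) * (coeff_lip k + 2 ^ k) + (gmom k)\<^sup>2 * (2 * coeff_lip (k div 2) + 1)"

lemma kernel_const_nonneg: "0 \<le> kernel_const k"
  by (simp add: kernel_const_def gmom_nonneg coeff_lip_nonneg)

context prob_space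
begin

lemma lincomb_kernel_cov:
  fixes a b :: "'b \<Rightarrow> real" and W :: "'b \<Rightarrow> 'a \<Rightarrow> real"
  assumes J: "finite J" "indep_vars (\<lambda>_. borel) W J"
    and W: "\<And>l. l \<in> J \<Longrightarrow> distributed M lborel (W l) std_normal_density"
  defines "X \<equiv> \<lambda>w. \<Sum>l\<in>J. a l * W l w" and "Y \<equiv> \<lambda>w. \<Sum>l\<in>J. b l * W l w"
  shows "integrable M (\<lambda>w. (X w ^ k - gmom k) * (Y w ^ k - gmom k))"
    and "expectation (\<lambda>w. (X w ^ k - gmom k) * (Y w ^ k - gmom k))
      = expectation (\<lambda>w. X w ^ k * Y w ^ k) - gmom k * expectation (\<lambda>w. X w ^ k)
        - gmom k * expectation (\<lambda>w. Y w ^ k) + (gmom k)\<^sup>2"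
proof -
  have X: "integrable M (\<lambda>w. X w ^ k)" for k unfolding X_def by (rule lincomb_moment[OF J W])
  have Y: "integrable M (\<lambda>w. Y w ^ k)" for k unfolding Y_def by (rule lincomb_moment[OF J W])
  have XY: "integrable M (\<lambda>w. X w ^ k * Y w ^ k)" by (rule prod_power_integrable[OF X Y])
  have e: "(X w ^ k - gmom k) * (Y w ^ k - gmom k)
      = X w ^ k * Y w ^ k - gmom k * X w ^ k - gmom k * Y w ^ k + (gmom k)\<^sup>2" for w
    by (simp add: algebra_simps power2_eq_square)
  show "integrable M (\<lambda>w. (X w ^ k - gmom k) * (Y w ^ k - gmom k))"
    unfolding e using X Y XY by simp
  show "expectation (\<lambda>w. (X w ^ k - gmom k) * (Y w ^ k - gmom k))
      = expectation (\<lambda>w. X w ^ k * Y w ^ k) - gmom k * expectation (\<lambda>w. X w ^ k)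
        - gmom k * expectation (\<lambda>w. Y w ^ k) + (gmom k)\<^sup>2"
    unfolding e using X Y XY by (simp add: prob_space)
qed

text \<open>The centering is by the limit \<open>gmom k\<close> and not by the actual means, so the
  product is expanded around (gmom k)^2: the joint moment and both means are within
  O(\<open>eta\<close>) of their values for independent standard normals. For odd k the mean terms
  carry the factor gmom k = 0.\<close>

lemma lincomb_kernel_cov_le:
  assumes J: "finite J" "indep_vars (\<lambda>_. borel) W J"
    and W: "\<And>l. l \<in> J \<Longrightarrow> distributed M lborel (W l) std_normal_density"
    and a: "\<bar>(\<Sum>l\<in>J. (a l)\<^sup>2) - 1\<bar> \<le> eta" and b: "\<bar>(\<Sum>l\<in>J. (b l)\<^sup>2) - 1\<bar> \<le> eta"
    and ab: "\<bar>\<Sum>l\<in>J. a l * b l\<bar> \<le> eta" and eta: "eta \<le> 1"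
  shows "\<bar>expectation (\<lambda>w. ((\<Sum>l\<in>J. a l * W l w) ^ k - gmom k) * ((\<Sum>l\<in>J. b l * W l w) ^ k - gmom k))\<bar>
    \<le> kernel_const k * eta"
proof -
  define X where "X = (\<lambda>w. \<Sum>l\<in>J. a l * W l w)"
  define Y where "Y = (\<lambda>w. \<Sum>l\<in>J. b l * W l w)"
  have e0: "0 \<le> eta" using ab by linarith
  have g0: "0 \<le> gmom k" "0 \<le> gmom (2 * k)" by (rule gmom_nonneg)+
  have one: "\<bar>gmom k * (expectation (\<lambda>w. (\<Sum>l\<in>J. c l * W l w) ^ k) - gmom k)\<bar>
      \<le> (gmom k)\<^sup>2 * coeff_lip (k div 2) * eta"
    if c: "\<bar>(\<Sum>l\<in>J. (c l)\<^sup>2) - 1\<bar> \<le> eta" for c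
  proof (cases "even k")
    case False
    then show ?thesis by (simp add: gmom_odd)
  next
    case True
    then obtain i where i: "k = 2 * i" by auto
    let ?s = "\<Sum>l\<in>J. (c l)\<^sup>2"
    have "sqrt ?s ^ k = ?s ^ i" by (simp add: i power_mult sum_nonneg)
    then have "gmom k * (expectation (\<lambda>w. (\<Sum>l\<in>J. c l * W l w) ^ k) - gmom k)
        = (gmom k)\<^sup>2 * (?s ^ i - 1)"
      using lincomb_moment(2)[OF J W, where a = c and k = k] by (simp add: power2_eq_square[of "gmom k"] algebra_simps)
    then have "\<bar>gmom k * (expectation (\<lambda>w. (\<Sum>l\<in>J. c l * W l w) ^ k) - gmom k)\<bar>
        = (gmom k)\<^sup>2 * \<bar>?s ^ i - 1\<bar>" by (simp add: abs_mult)
    also have "\<dots> \<le> (gmom k)\<^sup>2 * (coeff_lip i * eta)"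
      using power_near_one[OF c eta, of i] by (intro mult_left_mono) auto
    finally show ?thesis by (simp add: i)
  qed
  define E where "E = expectation (\<lambda>w. X w ^ k * Y w ^ k)"
  define B where "B = real (2 * k choose k)"
  \<comment> \<open>The binomial coefficient from \<open>joint_moment\<close> is at least 1, so
    dividing it out does not enlarge the error.\<close>
  have B: "1 \<le> B" unfolding B_def by (simp add: Suc_leI)
  let ?c = "coeff ([:\<Sum>l\<in>J. (a l)\<^sup>2, 2 * (\<Sum>l\<in>J. a l * b l), \<Sum>l\<in>J. (b l)\<^sup>2:] ^ k) k"
  have "B * (E - (gmom k)\<^sup>2) = gmom (2 * k) * (?c - coeff ([:1, 0, 1:] ^ k) k)"
    using joint_moment[OF J W, where a = a and b = b and k = k] gmom_binomial[of k]
    by (simp add: B_def E_def X_def Y_def algebra_simps)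
  then have "B * \<bar>E - (gmom k)\<^sup>2\<bar> = gmom (2 * k) * \<bar>?c - coeff ([:1, 0, 1:] ^ k) k\<bar>"
    using B g0 abs_mult[of B "E - (gmom k)\<^sup>2"] abs_mult[of "gmom (2 * k)" "?c - coeff ([:1, 0, 1:] ^ k) k"]
    by simp
  also have "\<dots> \<le> gmom (2 * k) * (coeff_lip k * eta)"
    using g0 by (intro mult_left_mono coeff_trinomial_lipschitz a b ab eta)
  finally have BE: "B * \<bar>E - (gmom k)\<^sup>2\<bar> \<le> gmom (2 * k) * (coeff_lip k * eta)" .
  have "1 * \<bar>E - (gmom k)\<^sup>2\<bar> \<le> B * \<bar>E - (gmom k)\<^sup>2\<bar>" using B by (intro mult_right_mono) auto
  then have E: "\<bar>E - (gmom k)\<^sup>2\<bar> \<le> gmom (2 * k) * (coeff_lip k * eta)"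
    using order_trans[OF _ BE] by simp
  have "expectation (\<lambda>w. (X w ^ k - gmom k) * (Y w ^ k - gmom k))
      = (E - (gmom k)\<^sup>2) - gmom k * (expectation (\<lambda>w. X w ^ k) - gmom k)
        - gmom k * (expectation (\<lambda>w. Y w ^ k) - gmom k)"
    using lincomb_kernel_cov(2)[OF J W, where a = a and b = b and k = k]
    by (simp add: E_def X_def Y_def power2_eq_square algebra_simps)
  then have "\<bar>expectation (\<lambda>w. (X w ^ k - gmom k) * (Y w ^ k - gmom k))\<bar>
      \<le> gmom (2 * k) * (coeff_lip k * eta) + (gmom k)\<^sup>2 * coeff_lip (k div 2) * eta
        + (gmom k)\<^sup>2 * coeff_lip (k div 2) * eta"
    using E one[OF a] one[OF b] unfolding X_def Y_def by linarith
  also have "\<dots> \<le> kernel_const k * eta"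
  proof -
    have "0 \<le> gmom (2 * k) * 2 ^ k * eta" "0 \<le> (gmom k)\<^sup>2 * eta" using g0 e0 by auto
    then show ?thesis by (simp add: kernel_const_def algebra_simps)
  qed
  finally show ?thesis unfolding X_def Y_def .
qed

lemma lincomb_kernel_var_le:
  assumes J: "finite J" "indep_vars (\<lambda>_. borel) W J"
    and W: "\<And>l. l \<in> J \<Longrightarrow> distributed M lborel (W l) std_normal_density"
    and a: "\<bar>(\<Sum>l\<in>J. (a l)\<^sup>2) - 1\<bar> \<le> 1"
  shows "\<bar>expectation (\<lambda>w. ((\<Sum>l\<in>J. a l * W l w) ^ k - gmom k) * ((\<Sum>l\<in>J. a l * W l w) ^ k - gmom k))\<bar>
    \<le> kernel_const k"
proof -
  let ?s = "\<Sum>l\<in>J. (a l)\<^sup>2"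
  have g0: "0 \<le> gmom k" "0 \<le> gmom (2 * k)" by (rule gmom_nonneg)+
  have s: "0 \<le> ?s" "?s \<le> 2" using a by (auto simp: sum_nonneg)
  have "expectation (\<lambda>w. (\<Sum>l\<in>J. a l * W l w) ^ k * (\<Sum>l\<in>J. a l * W l w) ^ k) = sqrt ?s ^ (2 * k) * gmom (2 * k)"
    using lincomb_moment(2)[OF J W, where a = a and k = "2 * k"] by (simp add: power_add[symmetric] mult_2)
  also have "sqrt ?s ^ (2 * k) = ?s ^ k" using s by (simp add: power_mult)
  also have "?s ^ k * gmom (2 * k) \<le> 2 ^ k * gmom (2 * k)"
    using s g0 by (intro mult_right_mono power_mono) auto
  finally have 1: "expectation (\<lambda>w. (\<Sum>l\<in>J. a l * W l w) ^ k * (\<Sum>l\<in>J. a l * W l w) ^ k) \<le> 2 ^ k * gmom (2 * k)" .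
  have "0 \<le> expectation (\<lambda>w. (\<Sum>l\<in>J. a l * W l w) ^ k)"
    using lincomb_moment(2)[OF J W, where a = a and k = k] g0 s by simp
  then have 2: "0 \<le> gmom k * expectation (\<lambda>w. (\<Sum>l\<in>J. a l * W l w) ^ k)" using g0 by simp
  have 3: "0 \<le> expectation (\<lambda>w. ((\<Sum>l\<in>J. a l * W l w) ^ k - gmom k) * ((\<Sum>l\<in>J. a l * W l w) ^ k - gmom k))"
    by (intro Bochner_Integration.integral_nonneg) auto
  have 4: "2 ^ k * gmom (2 * k) + (gmom k)\<^sup>2 \<le> kernel_const k"
  proof -
    have "0 \<le> gmom (2 * k) * coeff_lip k" "0 \<le> (gmom k)\<^sup>2 * coeff_lip (k div 2)"
      using g0 coeff_lip_nonneg by auto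
    then show ?thesis by (simp add: kernel_const_def algebra_simps)
  qed
  show ?thesis using 1 2 3 4 lincomb_kernel_cov(2)[OF J W, where a = a and b = a and k = k] by linarith
qed

end

section \<open>The trace recursion for centered kernel blocks\<close>

text \<open>Conditioning on the coordinates in \<open>A\<close> without conditional expectations:
  independence makes the joint law of the two groups of coordinates a product, and Tonelli
  integrates over \<open>B\<close> with \<open>A\<close> frozen. The nonnegative integral asks for
  no integrability in advance, so integrability can be a result of the recursion.\<close>

lemma (in prob_space) nn_integral_freeze:
  fixes X :: "'i \<Rightarrow> 'a \<Rightarrow> real" and F G :: "('i \<Rightarrow> real) \<Rightarrow> ennreal"
  assumes ind: "indep_vars (\<lambda>_. borel) X I" and AB: "A \<inter> B = {}" "A \<subseteq> I" "B \<subseteq> I"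
    and F: "F \<in> borel_measurable (PiM (A \<union> B) (\<lambda>_. borel))"
    and G: "G \<in> borel_measurable (PiM A (\<lambda>_. borel))"
    and le: "\<And>a. (\<integral>\<^sup>+ w. F (merge A B (a, \<lambda>i\<in>B. X i w)) \<partial>M) \<le> G a"
  shows "(\<integral>\<^sup>+ w. F (\<lambda>i\<in>A \<union> B. X i w) \<partial>M) \<le> (\<integral>\<^sup>+ w. G (\<lambda>i\<in>A. X i w) \<partial>M)"
proof -
  let ?PA = "PiM A (\<lambda>_. borel :: real measure)" and ?PB = "PiM B (\<lambda>_. borel :: real measure)"
  let ?XA = "\<lambda>w. \<lambda>i\<in>A. X i w" and ?XB = "\<lambda>w. \<lambda>i\<in>B. X i w"
  have iv: "indep_var ?PA ?XA ?PB ?XB" by (rule indep_var_restrict[OF ind AB])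
  then have rv: "?XA \<in> measurable M ?PA" "?XB \<in> measurable M ?PB"
    and eq: "distr M ?PA ?XA \<Otimes>\<^sub>M distr M ?PB ?XB = distr M (?PA \<Otimes>\<^sub>M ?PB) (\<lambda>w. (?XA w, ?XB w))"
    unfolding indep_var_distribution_eq by auto
  note [measurable] = rv F G
  interpret B: prob_space "distr M ?PB ?XB" by (rule prob_space_distr) (rule rv)
  have FM: "(\<lambda>x. F (merge A B x)) \<in> borel_measurable (?PA \<Otimes>\<^sub>M ?PB)" by measurable
  have "(\<integral>\<^sup>+ w. F (\<lambda>i\<in>A \<union> B. X i w) \<partial>M) = (\<integral>\<^sup>+ w. F (merge A B (?XA w, ?XB w)) \<partial>M)"
    by (intro nn_integral_cong arg_cong[where f = F])
       (auto simp: fun_eq_iff merge_def restrict_def)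
  also have "\<dots> = (\<integral>\<^sup>+ x. F (merge A B x) \<partial>distr M (?PA \<Otimes>\<^sub>M ?PB) (\<lambda>w. (?XA w, ?XB w)))"
    by (subst nn_integral_distr) (use FM in measurable)
  also have "\<dots> = (\<integral>\<^sup>+ a. \<integral>\<^sup>+ b. F (merge A B (a, b)) \<partial>distr M ?PB ?XB \<partial>distr M ?PA ?XA)"
    unfolding eq[symmetric]
    by (subst B.nn_integral_fst[symmetric]) (use FM in simp_all)
  also have "\<dots> \<le> (\<integral>\<^sup>+ a. G a \<partial>distr M ?PA ?XA)"
  proof (intro nn_integral_mono)
    fix a assume "a \<in> space (distr M ?PA ?XA)"
    then have "(\<lambda>b. F (merge A B (a, b))) \<in> borel_measurable ?PB"
      using measurable_compose[OF measurable_Pair1' FM, of a] by simp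
    then show "(\<integral>\<^sup>+ b. F (merge A B (a, b)) \<partial>distr M ?PB ?XB) \<le> G a"
      using le[of a] rv by (subst nn_integral_distr) auto
  qed
  also have "\<dots> = (\<integral>\<^sup>+ w. G (?XA w) \<partial>M)"
    by (subst nn_integral_distr) (use rv G in auto)
  finally show ?thesis .
qed

lemma (in psd_op) moment_zero_vector: "moment (\<lambda>i. 0) b = 0"
  by (simp add: moment_def ip_def)

lemma (in psd_op) moment_expand: "moment y b = (\<Sum>i<m. \<Sum>j<m. (A ^^ b) (unit_fun j) i * (y i * y j))"
proof -
  interpret b: psd_op m "A ^^ b" by (rule psd_op_funpow)
  have "moment y b = (\<Sum>j<m. \<Sum>i<m. (A ^^ b) (unit_fun j) i * (y i * y j))"
    unfolding moment_def ip_def by (intro sum.cong refl, subst b.op_apply) (auto simp: sum_distrib_right mult.assoc)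
  then show ?thesis by (subst sum.swap)
qed

text \<open>The moment is a quadratic form in \<open>y\<close> with matrix A^b, so its mean sees
  only the second moments of \<open>y\<close>. Their domination by a multiple of the identity turns
  it into a trace of A^b, which closes the recursion.\<close>

lemma (in prob_space) expectation_moment_le:
  assumes A: "psd_op m A"
    and int: "\<And>i j. i < m \<Longrightarrow> j < m \<Longrightarrow> integrable M (\<lambda>w. y w i * y w j)"
    and d: "\<And>i. i < m \<Longrightarrow> \<bar>expectation (\<lambda>w. y w i * y w i)\<bar> \<le> cd"
    and o: "\<And>i j. i < m \<Longrightarrow> j < m \<Longrightarrow> i \<noteq> j \<Longrightarrow> \<bar>expectation (\<lambda>w. y w i * y w j)\<bar> \<le> co"
    and co: "0 \<le> co"
  shows "integrable M (\<lambda>w. psd_op.moment m A (y w) b)"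
    and "expectation (\<lambda>w. psd_op.moment m A (y w) b) \<le> (cd + real m * co) * op_trace m (A ^^ b)"
proof -
  interpret A: psd_op m A by (rule A)
  interpret b: psd_op m "A ^^ b" by (rule A.psd_op_funpow)
  show "integrable M (\<lambda>w. A.moment (y w) b)"
    unfolding A.moment_expand using int by (intro Bochner_Integration.integrable_sum integrable_mult_right) auto
  have "expectation (\<lambda>w. A.moment (y w) b)
      = (\<Sum>i<m. \<Sum>j<m. (A ^^ b) (unit_fun j) i * expectation (\<lambda>w. y w i * y w j))"
  proof -
    have "expectation (\<lambda>w. A.moment (y w) b)
        = (\<Sum>i<m. expectation (\<lambda>w. \<Sum>j<m. (A ^^ b) (unit_fun j) i * (y w i * y w j)))"
      unfolding A.moment_expand using int
      by (intro Bochner_Integration.integral_sum Bochner_Integration.integrable_sum integrable_mult_right) auto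
    also have "\<dots> = (\<Sum>i<m. \<Sum>j<m. expectation (\<lambda>w. (A ^^ b) (unit_fun j) i * (y w i * y w j)))"
      using int by (intro sum.cong refl Bochner_Integration.integral_sum integrable_mult_right) auto
    finally show ?thesis by simp
  qed
  also have "\<dots> \<le> (cd + real m * co) * op_trace m (A ^^ b)"
    by (rule b.weighted_entries_le[OF d o co])
  finally show "expectation (\<lambda>w. A.moment (y w) b) \<le> (cd + real m * co) * op_trace m (A ^^ b)" .
qed

text \<open>This is \<open>sqrt n S\<^sub>i\<^sub>j\<close> for the data matrix u.\<close>
definition gcov :: "nat \<Rightarrow> (nat \<times> nat \<Rightarrow> real) \<Rightarrow> nat \<Rightarrow> nat \<Rightarrow> real" where
  "gcov n u i j = (\<Sum>l<n. u (l, i) * u (l, j)) / sqrt (real n)"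

text \<open>In terms of the data matrix: on the first q columns every entry of S - I is at most T /
  sqrt n.\<close>

definition near_iso :: "nat \<Rightarrow> real \<Rightarrow> nat \<Rightarrow> (nat \<times> nat \<Rightarrow> real) \<Rightarrow> bool" where
  "near_iso n T q u \<longleftrightarrow> (\<forall>i<q. \<bar>gcov n u i i - sqrt (real n)\<bar> \<le> T \<and> (\<forall>j<q. j \<noteq> i \<longrightarrow> \<bar>gcov n u i j\<bar> \<le> T))"

text \<open>The truncation makes the row length bounded and the conditional covariance of the row small for
  every past, as the trace recursion requires; it is inactive on the event \<open>near_iso n T p\<close>.\<close>
definition krow :: "nat \<Rightarrow> nat \<Rightarrow> nat \<Rightarrow> real \<Rightarrow> real \<Rightarrow> (nat \<times> nat \<Rightarrow> real) \<Rightarrow> nat \<Rightarrow> nat \<Rightarrow> real" where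
  "krow n m k T rho u t i = (if i < min t m \<and> near_iso n T (min t m) u
      \<and> (\<Sum>j<min t m. (gcov n u t j ^ k - gmom k)\<^sup>2) \<le> rho then gcov n u t i ^ k - gmom k else 0)"

lemma gcov_cong: "(\<And>l. l < n \<Longrightarrow> u (l, i) = u' (l, i)) \<Longrightarrow> (\<And>l. l < n \<Longrightarrow> u (l, j) = u' (l, j)) \<Longrightarrow>
    gcov n u i j = gcov n u' i j"
  unfolding gcov_def by (intro arg_cong2[where f = "(/)"] sum.cong) auto

lemma near_iso_cong:
  assumes "\<And>l i. l < n \<Longrightarrow> i < q \<Longrightarrow> u (l, i) = u' (l, i)"
  shows "near_iso n T q u = near_iso n T q u'"
proof -
  have "gcov n u i j = gcov n u' i j" if "i < q" "j < q" for i j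
    using assms that by (intro gcov_cong) auto
  then show ?thesis unfolding near_iso_def by auto
qed

text \<open>Adaptedness: the rows before t, and hence their Gram operator, are functions of the
  columns before t and stay fixed while column t is integrated out.\<close>

lemma krow_cong:
  assumes "\<And>l i. l < n \<Longrightarrow> i \<le> t \<Longrightarrow> u (l, i) = u' (l, i)"
  shows "krow n m k T rho u t = krow n m k T rho u' t"
proof
  fix i
  have g: "gcov n u t j = gcov n u' t j" if "j < min t m" for j
    using assms that by (intro gcov_cong) auto
  have "near_iso n T (min t m) u = near_iso n T (min t m) u'"
    using assms by (intro near_iso_cong) auto
  moreover have "(\<Sum>j<min t m. (gcov n u t j ^ k - gmom k)\<^sup>2) = (\<Sum>j<min t m. (gcov n u' t j ^ k - gmom k)\<^sup>2)"
    by (intro sum.cong refl) (simp only: g lessThan_iff)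
  ultimately show "krow n m k T rho u t i = krow n m k T rho u' t i"
    unfolding krow_def using g[of i] by simp
qed

lemma ip_krow_le: "0 \<le> rho \<Longrightarrow> ip m (krow n m k T rho u t) (krow n m k T rho u t) \<le> rho"
proof (cases "near_iso n T (min t m) u \<and> (\<Sum>j<min t m. (gcov n u t j ^ k - gmom k)\<^sup>2) \<le> rho")
  case True
  have "ip m (krow n m k T rho u t) (krow n m k T rho u t)
      = (\<Sum>j<m. if j < min t m then (gcov n u t j ^ k - gmom k)\<^sup>2 else 0)"
    unfolding ip_def krow_def using True by (intro sum.cong) (auto simp: power2_eq_square)
  also have "\<dots> = (\<Sum>j<min t m. (gcov n u t j ^ k - gmom k)\<^sup>2)"
    by (rule sum.mono_neutral_cong_right) auto
  finally show ?thesis using True by simp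
next
  case False
  then have "krow n m k T rho u t = (\<lambda>i. 0)" by (auto simp: krow_def fun_eq_iff)
  moreover assume "0 \<le> rho"
  ultimately show ?thesis by (simp add: ip_def)
qed

lemma gcov_measurable:
  assumes "{..<n} \<times> {i, j} \<subseteq> C"
  shows "(\<lambda>u. gcov n u i j) \<in> borel_measurable (PiM C (\<lambda>_. borel))"
proof -
  have "(\<lambda>u. u (l, i)) \<in> borel_measurable (PiM C (\<lambda>_. borel :: real measure))"
       "(\<lambda>u. u (l, j)) \<in> borel_measurable (PiM C (\<lambda>_. borel :: real measure))" if "l < n" for l
    using assms that by (auto intro!: measurable_component_singleton)
  then show ?thesis unfolding gcov_def
    by (intro borel_measurable_divide borel_measurable_sum borel_measurable_times borel_measurable_const) auto
qed

lemma near_iso_measurable: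
  assumes "{..<n} \<times> {..<q} \<subseteq> C"
  shows "Measurable.pred (PiM C (\<lambda>_. borel)) (near_iso n T q)"
proof -
  have [measurable]: "(\<lambda>u. gcov n u i j) \<in> borel_measurable (PiM C (\<lambda>_. borel))"
    if "i \<in> {..<q}" "j \<in> {..<q}" for i j
    using assms that by (intro gcov_measurable) auto
  have "Measurable.pred (PiM C (\<lambda>_. borel)) (\<lambda>u. \<forall>i\<in>{..<q}. \<bar>gcov n u i i - sqrt (real n)\<bar> \<le> T
      \<and> (\<forall>j\<in>{..<q}. j \<noteq> i \<longrightarrow> \<bar>gcov n u i j\<bar> \<le> T))"
    by measurable
  then show ?thesis by (simp add: near_iso_def[abs_def] Ball_def)
qed

lemma krow_measurable:
  assumes "{..<n} \<times> {..t} \<subseteq> C"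
  shows "(\<lambda>u. krow n m k T rho u t i) \<in> borel_measurable (PiM C (\<lambda>_. borel))"
proof (cases "i < min t m")
  case True
  have [measurable]: "(\<lambda>u. gcov n u t j) \<in> borel_measurable (PiM C (\<lambda>_. borel))" if "j < min t m" for j
    using assms that by (intro gcov_measurable) auto
  have [measurable]: "Measurable.pred (PiM C (\<lambda>_. borel)) (near_iso n T (min t m))"
    using assms by (intro near_iso_measurable) auto
  have [measurable]: "(\<lambda>u. \<Sum>j<min t m. (gcov n u t j ^ k - gmom k)\<^sup>2) \<in> borel_measurable (PiM C (\<lambda>_. borel))"
    by (intro borel_measurable_sum) simp
  have [measurable]: "(\<lambda>u. gcov n u t i) \<in> borel_measurable (PiM C (\<lambda>_. borel))"
    using True by simp
  show ?thesis unfolding krow_def using True by measurable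
next
  case False
  then have "(\<lambda>u. krow n m k T rho u t i) = (\<lambda>u. 0)" by (auto simp: krow_def fun_eq_iff)
  then show ?thesis by simp
qed

lemma gram_power_measurable:
  assumes "\<And>s i. s < t \<Longrightarrow> (\<lambda>u. y u s i) \<in> borel_measurable N"
  shows "(\<lambda>u. (gram m (y u) t ^^ k) x i) \<in> borel_measurable N"
proof (induction k arbitrary: i)
  case 0
  show ?case by simp
next
  case (Suc k)
  then show ?case using assms
    by (simp add: gram_def[of m _ t "_ x"] ip_def)
qed

lemma op_trace_gram_measurable:
  assumes "\<And>s i. s < t \<Longrightarrow> (\<lambda>u. y u s i) \<in> borel_measurable N"
  shows "(\<lambda>u. op_trace m (gram m (y u) t ^^ k)) \<in> borel_measurable N"
  unfolding op_trace_def by (intro borel_measurable_sum gram_power_measurable assms)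

section \<open>Mean traces of the random Gram operators\<close>

locale gaussian_matrix = prob_space M for M :: "'a measure" +
  fixes n p :: nat and z :: "nat \<times> nat \<Rightarrow> 'a \<Rightarrow> real"
  assumes n_pos: "0 < n"
    and std: "\<And>l j. l < n \<Longrightarrow> j < p \<Longrightarrow> distributed M lborel (z (l, j)) std_normal_density"
    and indep: "indep_vars (\<lambda>_. borel) z ({..<n} \<times> {..<p})"
begin

abbreviation arr :: "'a \<Rightarrow> nat \<times> nat \<Rightarrow> real" where
  "arr w \<equiv> \<lambda>x. z x w"

lemma z_measurable: "l < n \<Longrightarrow> j < p \<Longrightarrow> z (l, j) \<in> borel_measurable M"
  using std[of l j] by (simp add: distributed_def)

lemma sum_column: "(\<Sum>x\<in>{..<n} \<times> {t}. f x) = (\<Sum>l<n. f (l, t))" for f :: "nat \<times> nat \<Rightarrow> real"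
proof -
  have "{..<n} \<times> {t} = (\<lambda>l. (l, t)) ` {..<n}" by auto
  then show ?thesis by (simp add: sum.reindex inj_on_def)
qed

lemma arr_restrict_measurable:
  assumes F: "F \<in> borel_measurable (PiM ({..<n} \<times> {..<t}) (\<lambda>_. borel))" and t: "t \<le> p"
    and eq: "\<And>u. F (restrict u ({..<n} \<times> {..<t})) = F u"
  shows "(\<lambda>w. F (arr w)) \<in> borel_measurable M"
proof -
  have "(\<lambda>w. \<lambda>x\<in>{..<n} \<times> {..<t}. z x w) \<in> measurable M (PiM ({..<n} \<times> {..<t}) (\<lambda>_. borel))"
    using t by (intro measurable_restrict) (auto intro: z_measurable)
  from measurable_compose[OF this F] show ?thesis
    using eq[of "arr _"] by simp
qed

context
  fixes m k :: nat and T rho :: real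
  assumes T: "0 \<le> T" "T \<le> sqrt (real n)" and rho: "0 \<le> rho"
begin

definition ktrace :: "nat \<Rightarrow> nat \<Rightarrow> (nat \<times> nat \<Rightarrow> real) \<Rightarrow> real" where
  "ktrace t q u = op_trace m (gram m (krow n m k T rho u) t ^^ q)"

text \<open>The factor cd + m co of \<open>expectation_moment_le\<close>, with cd =
  \<open>kernel_const k\<close> and co = \<open>kernel_const k\<close> T / sqrt n. For m of order
  sqrt n it is of order T.\<close>

definition kvar :: real where
  "kvar = kernel_const k * (1 + real m * (T / sqrt (real n)))"

lemma kvar_nonneg: "0 \<le> kvar"
  using T by (simp add: kvar_def kernel_const_nonneg)

lemma ktrace_nonneg: "0 \<le> ktrace t q u"
  unfolding ktrace_def
  by (rule psd_op.op_trace_nonneg[OF psd_op.psd_op_funpow[OF psd_op_gram]])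

lemma ktrace_cong:
  assumes "\<And>l i. l < n \<Longrightarrow> i < t \<Longrightarrow> u (l, i) = u' (l, i)"
  shows "ktrace t q u = ktrace t q u'"
  unfolding ktrace_def using assms
  by (intro arg_cong[where f = "\<lambda>A. op_trace m (A ^^ q)"] gram_cong krow_cong) auto

lemma ktrace_PiM_measurable:
  "ktrace t q \<in> borel_measurable (PiM ({..<n} \<times> {..<t}) (\<lambda>_. borel))"
  unfolding ktrace_def by (intro op_trace_gram_measurable krow_measurable) auto

lemma ktrace_measurable:
  assumes "t \<le> p"
  shows "(\<lambda>w. ktrace t q (arr w)) \<in> borel_measurable M"
  by (rule arr_restrict_measurable[OF ktrace_PiM_measurable assms]) (rule ktrace_cong, auto)

text \<open>With the past \<open>a\<close> frozen, the entries of the new row are powers of linear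
  forms in column t whose coefficient vectors, the old columns divided by sqrt n, are nearly
  orthonormal when \<open>good\<close> holds. If \<open>good\<close> fails, the row is zero.\<close>

lemma ktrace_step_frozen:
  assumes t: "t < p"
  shows "(\<integral>\<^sup>+ w. ennreal (ktrace (Suc t) q (merge ({..<n} \<times> {..<t}) ({..<n} \<times> {t}) (a, \<lambda>x\<in>{..<n} \<times> {t}. z x w))) \<partial>M)
    \<le> ennreal (ktrace t q a + 2 ^ q * (\<Sum>j<q. rho ^ j * (kvar * ktrace t (q - 1 - j) a)))"
proof -
  define A where "A = gram m (krow n m k T rho a) t"
  interpret A: psd_op m A unfolding A_def by (rule psd_op_gram)
  define u where "u w = merge ({..<n} \<times> {..<t}) ({..<n} \<times> {t}) (a, \<lambda>x\<in>{..<n} \<times> {t}. z x w)" for w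
  define X where "X i w = (\<Sum>x\<in>{..<n} \<times> {t}. (a (fst x, i) / sqrt (real n)) * z x w)" for i w
  define eta where "eta = T / sqrt (real n)"
  have eta: "0 \<le> eta" "eta \<le> 1" using T n_pos by (auto simp: eta_def)
  define good where "good = near_iso n T (min t m) a"
  \<comment> \<open>The new row without the length test. That test depends on column t and would
    spoil the Gaussian moments. Since \<open>krow\<close> is either this row or zero, dropping the
    test can only increase the moments.\<close>
  define y where "y w i = (if good \<and> i < min t m then X i w ^ k - gmom k else 0)" for w i
  have u_past: "u w (l, i) = a (l, i)" if "l < n" "i < t" for w l i
    using that by (simp add: u_def merge_def)
  have u_now: "u w (l, t) = z (l, t) w" if "l < n" for w l
    using that by (simp add: u_def merge_def)
  have uX: "gcov n (u w) t i = X i w" if "i < t" for w i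
    unfolding gcov_def X_def sum_column using that
    by (simp add: u_past u_now sum_divide_distrib mult.commute)
  have ind: "indep_vars (\<lambda>_. borel) z ({..<n} \<times> {t})"
    using t by (intro indep_vars_subset[OF indep]) auto
  have stdt: "distributed M lborel (z x) std_normal_density" if "x \<in> {..<n} \<times> {t}" for x
    using that t std by auto
  have cov: "(\<Sum>x\<in>{..<n} \<times> {t}. (a (fst x, i) / sqrt (real n)) * (a (fst x, j) / sqrt (real n)))
      = gcov n a i j / sqrt (real n)" for i j
    unfolding sum_column gcov_def by (simp add: sum_divide_distrib)
  have var: "\<bar>(\<Sum>x\<in>{..<n} \<times> {t}. (a (fst x, i) / sqrt (real n))\<^sup>2) - 1\<bar> \<le> eta"
    if "good" "i < min t m" for i
  proof -
    have "(\<Sum>x\<in>{..<n} \<times> {t}. (a (fst x, i) / sqrt (real n))\<^sup>2) - 1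
        = (gcov n a i i - sqrt (real n)) / sqrt (real n)"
      unfolding power2_eq_square cov using n_pos by (simp add: diff_divide_distrib)
    then show ?thesis using that n_pos
      by (simp add: good_def near_iso_def eta_def divide_right_mono)
  qed
  have covle: "\<bar>\<Sum>x\<in>{..<n} \<times> {t}. (a (fst x, i) / sqrt (real n)) * (a (fst x, j) / sqrt (real n))\<bar> \<le> eta"
    if "good" "i < min t m" "j < min t m" "i \<noteq> j" for i j
    unfolding cov using that n_pos by (simp add: good_def near_iso_def eta_def divide_right_mono)
  have yX: "(\<lambda>w. y w i * y w j) = (if good \<and> i < min t m \<and> j < min t m
      then (\<lambda>w. (X i w ^ k - gmom k) * (X j w ^ k - gmom k)) else (\<lambda>w. 0))" for i j
    by (auto simp: y_def fun_eq_iff)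
  have int: "integrable M (\<lambda>w. y w i * y w j)" for i j
  proof -
    have "integrable M (\<lambda>w. (X i w ^ k - gmom k) * (X j w ^ k - gmom k))"
      unfolding X_def by (rule lincomb_kernel_cov(1)[OF _ ind stdt]) auto
    then show ?thesis unfolding yX by simp
  qed
  have d: "\<bar>expectation (\<lambda>w. y w i * y w i)\<bar> \<le> kernel_const k" for i
  proof (cases "good \<and> i < min t m")
    case True
    have "\<bar>expectation (\<lambda>w. (X i w ^ k - gmom k) * (X i w ^ k - gmom k))\<bar> \<le> kernel_const k"
      unfolding X_def by (rule lincomb_kernel_var_le[OF _ ind stdt])
        (use var[of i] eta True in auto)
    then show ?thesis unfolding yX using True by simp
  next
    case False
    then have "(\<lambda>w. y w i * y w i) = (\<lambda>w. 0)" unfolding yX by auto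
    then show ?thesis using kernel_const_nonneg by simp
  qed
  have o: "\<bar>expectation (\<lambda>w. y w i * y w j)\<bar> \<le> kernel_const k * eta" if "i \<noteq> j" for i j
  proof (cases "good \<and> i < min t m \<and> j < min t m")
    case True
    have "\<bar>expectation (\<lambda>w. (X i w ^ k - gmom k) * (X j w ^ k - gmom k))\<bar> \<le> kernel_const k * eta"
      unfolding X_def by (rule lincomb_kernel_cov_le[OF _ ind stdt])
        (use var covle eta True that in auto)
    then show ?thesis unfolding yX using True by simp
  next
    case False
    then have "(\<lambda>w. y w i * y w j) = (\<lambda>w. 0)" unfolding yX by auto
    then show ?thesis using kernel_const_nonneg eta by simp
  qed
  have co0: "0 \<le> kernel_const k * eta" using kernel_const_nonneg eta by simp
  have E1: "integrable M (\<lambda>w. A.moment (y w) b)" for b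
    by (rule expectation_moment_le(1)[where y = y, OF A.psd_op_axioms int d o co0])
  have E2: "expectation (\<lambda>w. A.moment (y w) b) \<le> kvar * ktrace t b a" for b
  proof -
    have "expectation (\<lambda>w. A.moment (y w) b)
        \<le> (kernel_const k + real m * (kernel_const k * eta)) * op_trace m (A ^^ b)"
      by (rule expectation_moment_le(2)[where y = y, OF A.psd_op_axioms int d o co0])
    also have "kernel_const k + real m * (kernel_const k * eta) = kvar"
      by (simp add: kvar_def eta_def algebra_simps)
    finally show ?thesis by (simp add: ktrace_def A_def)
  qed
  have mom: "A.moment (krow n m k T rho (u w) t) b \<le> A.moment (y w) b" for w b
  proof (cases "good \<and> (\<Sum>j<min t m. (gcov n (u w) t j ^ k - gmom k)\<^sup>2) \<le> rho")
    case True
    have "near_iso n T (min t m) (u w) = good"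
      unfolding good_def by (rule near_iso_cong) (simp add: u_past)
    then have "krow n m k T rho (u w) t = y w"
      using True by (auto simp: krow_def y_def fun_eq_iff uX)
    then show ?thesis by simp
  next
    case False
    have "near_iso n T (min t m) (u w) = good"
      unfolding good_def by (rule near_iso_cong) (simp add: u_past)
    then have "krow n m k T rho (u w) t = (\<lambda>i. 0)"
      using False by (auto simp: krow_def fun_eq_iff)
    then show ?thesis by (simp add: A.moment_zero_vector A.moment_nonneg)
  qed
  have gram: "gram m (krow n m k T rho (u w)) t = A" for w
    unfolding A_def by (intro gram_cong krow_cong) (simp add: u_past)
  have le: "ktrace (Suc t) q (u w) \<le> ktrace t q a + 2 ^ q * (\<Sum>j<q. rho ^ j * A.moment (y w) (q - 1 - j))" for w
  proof -
    have "ktrace (Suc t) q (u w)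
        \<le> ktrace t q a + 2 ^ q * (\<Sum>j<q. rho ^ j * A.moment (krow n m k T rho (u w) t) (q - 1 - j))"
      unfolding ktrace_def gram_Suc gram A_def[symmetric]
      by (rule A.rank_one_trace_le[OF ip_krow_le[OF rho]])
    also have "\<dots> \<le> ktrace t q a + 2 ^ q * (\<Sum>j<q. rho ^ j * A.moment (y w) (q - 1 - j))"
      using rho by (intro add_left_mono mult_left_mono sum_mono mom) auto
    finally show ?thesis .
  qed
  let ?R = "\<lambda>w. ktrace t q a + 2 ^ q * (\<Sum>j<q. rho ^ j * A.moment (y w) (q - 1 - j))"
  have "(\<integral>\<^sup>+ w. ennreal (ktrace (Suc t) q (u w)) \<partial>M) \<le> (\<integral>\<^sup>+ w. ennreal (?R w) \<partial>M)"
    by (intro nn_integral_mono ennreal_leI le)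
  also have "\<dots> = ennreal (expectation ?R)"
  proof (rule nn_integral_eq_integral)
    show "integrable M ?R" using E1 by simp
    show "AE w in M. 0 \<le> ?R w"
      using rho by (intro AE_I2 add_nonneg_nonneg ktrace_nonneg mult_nonneg_nonneg sum_nonneg A.moment_nonneg) auto
  qed
  also have "expectation ?R = ktrace t q a + 2 ^ q * (\<Sum>j<q. rho ^ j * expectation (\<lambda>w. A.moment (y w) (q - 1 - j)))"
    using E1 by (simp add: prob_space)
  also have "\<dots> \<le> ktrace t q a + 2 ^ q * (\<Sum>j<q. rho ^ j * (kvar * ktrace t (q - 1 - j) a))"
    using rho by (intro add_left_mono mult_left_mono sum_mono E2) auto
  finally show ?thesis unfolding u_def by (simp add: ennreal_leI)
qed

lemma ktrace_step:
  assumes t: "t < p" and int: "\<And>q'. q' \<le> q \<Longrightarrow> integrable M (\<lambda>w. ktrace t q' (arr w))"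
  shows "integrable M (\<lambda>w. ktrace (Suc t) q (arr w))"
    and "expectation (\<lambda>w. ktrace (Suc t) q (arr w)) \<le> expectation (\<lambda>w. ktrace t q (arr w))
      + 2 ^ q * (\<Sum>j<q. rho ^ j * (kvar * expectation (\<lambda>w. ktrace t (q - 1 - j) (arr w))))"
proof -
  let ?A = "{..<n} \<times> {..<t}" and ?B = "{..<n} \<times> {t}"
  let ?g = "\<lambda>a. ktrace t q a + 2 ^ q * (\<Sum>j<q. rho ^ j * (kvar * ktrace t (q - 1 - j) a))"
  have AB: "?A \<union> ?B = {..<n} \<times> {..<Suc t}" by auto
  have g0: "0 \<le> ?g a" for a
    using rho kvar_nonneg by (intro add_nonneg_nonneg ktrace_nonneg mult_nonneg_nonneg sum_nonneg) auto
  have c1: "ktrace (Suc t) q (\<lambda>x\<in>?A \<union> ?B. z x w) = ktrace (Suc t) q (arr w)" for w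
    by (rule ktrace_cong) auto
  have c2: "ktrace t q' (\<lambda>x\<in>?A. z x w) = ktrace t q' (arr w)" for w q'
    by (rule ktrace_cong) auto
  have "(\<integral>\<^sup>+ w. ennreal (ktrace (Suc t) q (\<lambda>x\<in>?A \<union> ?B. z x w)) \<partial>M)
      \<le> (\<integral>\<^sup>+ w. ennreal (?g (\<lambda>x\<in>?A. z x w)) \<partial>M)"
  proof (rule nn_integral_freeze[OF indep])
    show "(\<lambda>u. ennreal (ktrace (Suc t) q u)) \<in> borel_measurable (PiM (?A \<union> ?B) (\<lambda>_. borel))"
      unfolding AB using ktrace_PiM_measurable by measurable
    show "(\<lambda>a. ennreal (?g a)) \<in> borel_measurable (PiM ?A (\<lambda>_. borel))"
      using ktrace_PiM_measurable[of t] by simp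
  qed (use t ktrace_step_frozen[OF t] in auto)
  then have le: "(\<integral>\<^sup>+ w. ennreal (ktrace (Suc t) q (arr w)) \<partial>M) \<le> (\<integral>\<^sup>+ w. ennreal (?g (arr w)) \<partial>M)"
    unfolding c1 c2 .
  have gi: "integrable M (\<lambda>w. ?g (arr w))"
    using int by (intro Bochner_Integration.integrable_add integrable_mult_right Bochner_Integration.integrable_sum) auto
  have "(\<integral>\<^sup>+ w. ennreal (?g (arr w)) \<partial>M) = ennreal (expectation (\<lambda>w. ?g (arr w)))"
    by (rule nn_integral_eq_integral[OF gi]) (intro AE_I2 g0)
  also have "expectation (\<lambda>w. ?g (arr w)) = expectation (\<lambda>w. ktrace t q (arr w))
      + 2 ^ q * (\<Sum>j<q. rho ^ j * (kvar * expectation (\<lambda>w. ktrace t (q - 1 - j) (arr w))))" (is "_ = ?R")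
  proof -
    have "expectation (\<lambda>w. \<Sum>j<q. rho ^ j * (kvar * ktrace t (q - 1 - j) (arr w)))
        = (\<Sum>j<q. expectation (\<lambda>w. rho ^ j * (kvar * ktrace t (q - 1 - j) (arr w))))"
      using int by (intro Bochner_Integration.integral_sum integrable_mult_right) auto
    moreover have "expectation (\<lambda>w. ?g (arr w)) = expectation (\<lambda>w. ktrace t q (arr w))
      + expectation (\<lambda>w. 2 ^ q * (\<Sum>j<q. rho ^ j * (kvar * ktrace t (q - 1 - j) (arr w))))"
      using int by (intro Bochner_Integration.integral_add integrable_mult_right Bochner_Integration.integrable_sum) auto
    ultimately show ?thesis by simp
  qed
  finally have le': "(\<integral>\<^sup>+ w. ennreal (ktrace (Suc t) q (arr w)) \<partial>M) \<le> ennreal ?R" using le by simp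
  have R0: "0 \<le> ?R"
    using rho kvar_nonneg ktrace_nonneg
    by (intro add_nonneg_nonneg mult_nonneg_nonneg sum_nonneg Bochner_Integration.integral_nonneg) auto
  have meas: "(\<lambda>w. ktrace (Suc t) q (arr w)) \<in> borel_measurable M" using t by (intro ktrace_measurable) simp
  show i: "integrable M (\<lambda>w. ktrace (Suc t) q (arr w))"
  proof (rule integrableI_nonneg[OF meas])
    show "AE w in M. 0 \<le> ktrace (Suc t) q (arr w)" by (intro AE_I2 ktrace_nonneg)
    show "(\<integral>\<^sup>+ w. ennreal (ktrace (Suc t) q (arr w)) \<partial>M) < \<infinity>"
      using le' by (simp add: le_less_trans)
  qed
  have "ennreal (expectation (\<lambda>w. ktrace (Suc t) q (arr w))) \<le> ennreal ?R"
    using le' nn_integral_eq_integral[OF i] ktrace_nonneg by simp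
  then show "expectation (\<lambda>w. ktrace (Suc t) q (arr w)) \<le> ?R"
    using R0 by simp
qed

text \<open>Let b = rho + 2^K kvar t and d = 2^K kvar. As rho \<le> b + d, the increment is at most
  m d times the sum of b^(q-1-j) (b + d)^j over j < q, which is m ((b + d)^q - b^q). So the base
  grows linearly with the number of rows; \<open>K\<close> bounds all exponents in play and keeps
  the base independent of q.\<close>

lemma ktrace_mean_le:
  assumes "t \<le> p" "q \<le> K"
  shows "integrable M (\<lambda>w. ktrace t q (arr w)) \<and>
    expectation (\<lambda>w. ktrace t q (arr w)) \<le> real m * (rho + 2 ^ K * kvar * real t) ^ q"
  using assms
proof (induction t arbitrary: q)
  case 0
  \<comment> \<open>Without rows the operator is 0, and its power 0 is the identity, of trace
    m.\<close>
  have tr: "ktrace 0 q u = (if q = 0 then real m else 0)" for u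
    by (cases q) (simp_all add: ktrace_def gram_def op_trace_def unit_fun_def)
  have "integrable M (\<lambda>w. ktrace 0 q (arr w))" unfolding tr by simp
  moreover have "expectation (\<lambda>w. ktrace 0 q (arr w)) = (if q = 0 then real m else 0)"
    by (simp add: tr prob_space)
  ultimately show ?case using rho by (cases q) simp_all
next
  case (Suc t)
  define b where "b = rho + 2 ^ K * kvar * real t"
  define d where "d = 2 ^ K * kvar"
  have b: "rho \<le> b" "0 \<le> b" and d: "0 \<le> d" using rho kvar_nonneg by (auto simp: b_def d_def)
  have IH: "integrable M (\<lambda>w. ktrace t q' (arr w))"
    "expectation (\<lambda>w. ktrace t q' (arr w)) \<le> real m * b ^ q'" if "q' \<le> q" for q'
    using Suc.IH[of q'] Suc.prems that by (auto simp: b_def)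
  have "expectation (\<lambda>w. ktrace (Suc t) q (arr w)) \<le> expectation (\<lambda>w. ktrace t q (arr w))
      + 2 ^ q * (\<Sum>j<q. rho ^ j * (kvar * expectation (\<lambda>w. ktrace t (q - 1 - j) (arr w))))"
    using Suc.prems IH(1) by (intro ktrace_step) auto
  also have "\<dots> \<le> real m * b ^ q + 2 ^ q * (\<Sum>j<q. rho ^ j * (kvar * (real m * b ^ (q - 1 - j))))"
    using rho kvar_nonneg IH(2) by (intro add_mono mult_left_mono sum_mono) auto
  also have "\<dots> \<le> real m * b ^ q + 2 ^ K * (\<Sum>j<q. (b + d) ^ j * (kvar * (real m * b ^ (q - 1 - j))))"
    using rho kvar_nonneg b d Suc.prems
    by (intro add_left_mono mult_mono sum_mono mult_right_mono power_mono power_increasing sum_nonneg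
        mult_nonneg_nonneg) auto
  also have "\<dots> = real m * (b ^ q + d * (\<Sum>j<q. b ^ (q - Suc j) * (b + d) ^ j))"
    by (simp add: d_def sum_distrib_left algebra_simps)
  also have "d * (\<Sum>j<q. b ^ (q - Suc j) * (b + d) ^ j) = (b + d) ^ q - b ^ q"
    using diff_power_eq_sum[of "b + d" _ b] power_diff_sumr2[of "b + d" q b] by simp
  finally have "expectation (\<lambda>w. ktrace (Suc t) q (arr w)) \<le> real m * (b + d) ^ q" by simp
  moreover have "b + d = rho + 2 ^ K * kvar * real (Suc t)"
    by (simp add: b_def d_def algebra_simps)
  moreover have "integrable M (\<lambda>w. ktrace (Suc t) q (arr w))"
    using Suc.prems IH(1) by (intro ktrace_step) auto
  ultimately show ?case by simp
qed

text \<open>Markov's inequality for the trace of the power K + 1. The exceptional event concerns the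
  trace alone, so off it the bound holds for all \<open>x\<close> at once.\<close>

lemma krow_bound_prob:
  fixes K :: nat
  assumes t: "t \<le> p" and L: "0 < L"
  defines "E \<equiv> {w \<in> space M. ktrace t (Suc K) (arr w) \<ge> L ^ Suc K}"
  shows "E \<in> events"
    and "prob E \<le> real m * ((rho + 2 ^ Suc K * kvar * real t) / L) ^ Suc K"
    and "w \<in> space M - E \<Longrightarrow> (\<Sum>s<t. (ip m (krow n m k T rho (arr w) s) x)\<^sup>2) \<le> L * ip m x x"
proof -
  have meas: "(\<lambda>w. ktrace t (Suc K) (arr w)) \<in> borel_measurable M" by (rule ktrace_measurable[OF t])
  then show "E \<in> events" unfolding E_def by measurable
  have m: "integrable M (\<lambda>w. ktrace t (Suc K) (arr w))"
    "expectation (\<lambda>w. ktrace t (Suc K) (arr w)) \<le> real m * (rho + 2 ^ Suc K * kvar * real t) ^ Suc K"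
    using ktrace_mean_le[OF t order_refl, of "Suc K"] by auto
  have "prob E \<le> expectation (\<lambda>w. ktrace t (Suc K) (arr w)) / L ^ Suc K"
    unfolding E_def by (rule integral_Markov_inequality_measure[where A = "{}"])
      (use m(1) L ktrace_nonneg in auto)
  also have "\<dots> \<le> real m * (rho + 2 ^ Suc K * kvar * real t) ^ Suc K / L ^ Suc K"
    using m(2) L by (intro divide_right_mono) auto
  finally show "prob E \<le> real m * ((rho + 2 ^ Suc K * kvar * real t) / L) ^ Suc K"
    by (simp add: power_divide)
  assume "w \<in> space M - E"
  then show "(\<Sum>s<t. (ip m (krow n m k T rho (arr w) s) x)\<^sup>2) \<le> L * ip m x x"
    using L by (intro sum_ip_sq_le[where k = K]) (auto simp: E_def ktrace_def)
qed

end

end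

section \<open>Concentration of quadratic forms\<close>

text \<open>Tilting by exp(s x^2) changes the variance from 1 to 1 / (1 - 2 s); the normalising
  factor is the moment generating function of the square.\<close>

lemma std_normal_density_exp_square:
  fixes s x :: real
  assumes "s < 1 / 2"
  shows "std_normal_density x * exp (s * x\<^sup>2)
    = (1 / sqrt (1 - 2 * s)) * normal_density 0 (1 / sqrt (1 - 2 * s)) x"
proof -
  have p: "0 < 1 - 2 * s" using assms by simp
  have v: "(1 / sqrt (1 - 2 * s))\<^sup>2 = 1 / (1 - 2 * s)" using p by (simp add: power_divide)
  have e: "exp (- x\<^sup>2 / 2) * exp (s * x\<^sup>2) = exp (- x\<^sup>2 / (2 * (1 / (1 - 2 * s))))"
    using p by (simp add: exp_add[symmetric] field_simps)
  have r: "sqrt (2 * pi * (1 / (1 - 2 * s))) = sqrt (2 * pi) / sqrt (1 - 2 * s)"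
    by (simp add: real_sqrt_divide)
  show ?thesis unfolding normal_density_def v r using p e by simp
qed

lemma (in prob_space) std_normal_exp_square:
  assumes X: "distributed M lborel X std_normal_density" and s: "\<bar>s\<bar> \<le> 1 / 4"
  shows "integrable M (\<lambda>w. exp (s * ((X w)\<^sup>2 - 1)))"
    and "expectation (\<lambda>w. exp (s * ((X w)\<^sup>2 - 1))) \<le> exp (4 * s\<^sup>2)"
proof -
  let ?c = "1 / sqrt (1 - 2 * s)"
  have s2: "s < 1 / 2" and p: "0 < 1 - 2 * s" using s by auto
  have c: "0 < ?c" using p by simp
  have e: "std_normal_density x * exp (s * (x\<^sup>2 - 1)) = exp (- s) * (?c * normal_density 0 ?c x)" for x
    unfolding std_normal_density_exp_square[OF s2, symmetric]
    by (simp add: right_diff_distrib exp_diff exp_minus field_simps)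
  show "integrable M (\<lambda>w. exp (s * ((X w)\<^sup>2 - 1)))"
  proof -
    have "integrable lborel (\<lambda>x. std_normal_density x * exp (s * (x\<^sup>2 - 1)))"
      unfolding e using integrable_normal_density[OF c] by simp
    then show ?thesis
      using distributed_integrable[OF X, of "\<lambda>x. exp (s * (x\<^sup>2 - 1))"] by simp
  qed
  have "expectation (\<lambda>w. exp (s * ((X w)\<^sup>2 - 1))) = (\<integral>x. std_normal_density x * exp (s * (x\<^sup>2 - 1)) \<partial>lborel)"
    using distributed_integral[OF X, of "\<lambda>x. exp (s * (x\<^sup>2 - 1))"] by simp
  also have "\<dots> = exp (- s) * ?c"
    unfolding e using integral_normal_density[OF c] by simp
  also have "?c = exp (- ln (1 - 2 * s) / 2)"
    using p by (simp add: exp_minus ln_sqrt[symmetric] inverse_eq_divide)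
  also have "exp (- s) * exp (- ln (1 - 2 * s) / 2) = exp (- s - ln (1 - 2 * s) / 2)"
    by (simp add: exp_add[symmetric])
  also have "\<dots> \<le> exp (4 * s\<^sup>2)"
  proof -
    \<comment> \<open>The quadratic error 8 s^2 of the logarithm is halved by the square root, which
      gives the 4 s^2.\<close>
    have "\<bar>ln (1 + (- 2 * s)) - (- 2 * s)\<bar> \<le> 2 * (- 2 * s)\<^sup>2"
      using s by (intro abs_ln_one_plus_x_minus_x_bound) auto
    then have "- s - ln (1 - 2 * s) / 2 \<le> 4 * s\<^sup>2"
      by (simp add: power_mult_distrib)
    then show ?thesis by simp
  qed
  finally show "expectation (\<lambda>w. exp (s * ((X w)\<^sup>2 - 1))) \<le> exp (4 * s\<^sup>2)" .
qed

text \<open>Chernoff bound with exponent s / sqrt n: the n factors exp(4 / n) multiply to exp 4, and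
  16 \<le> n keeps the exponent within 1 / 4. A tail that is merely exponential in \<open>T\<close>
  suffices, as \<open>T\<close> will be a power of n. The sign \<open>s\<close> selects the upper or
  the lower tail.\<close>

lemma (in prob_space) chi_square_tail:
  assumes n: "16 \<le> n" and ind: "indep_vars (\<lambda>_. borel) X {..<n}"
    and X: "\<And>l. l < n \<Longrightarrow> distributed M lborel (X l) std_normal_density"
    and s: "s = 1 \<or> s = - 1"
  shows "prob {w \<in> space M. s * ((\<Sum>l<n. (X l w)\<^sup>2) - real n) > T * sqrt (real n)} \<le> exp (4 - T)"
proof -
  let ?r = "s / sqrt (real n)"
  have r4: "4 \<le> sqrt (real n)" using n by (intro real_le_rsqrt) simp
  then have rp: "0 < sqrt (real n)" by linarith
  have "\<bar>?r\<bar> = 1 / sqrt (real n)" using s rp by auto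
  also have "\<dots> \<le> 1 / 4" using r4 by (intro frac_le) auto
  finally have r: "\<bar>?r\<bar> \<le> 1 / 4" .
  have rr: "?r\<^sup>2 = 1 / real n" using s n by (auto simp: power_divide)
  have [measurable]: "X l \<in> borel_measurable M" if "l < n" for l
    using X[OF that] by (simp add: distributed_def)
  have ind': "indep_vars (\<lambda>_. borel) (\<lambda>l w. exp (?r * ((X l w)\<^sup>2 - 1))) {..<n}"
    by (rule indep_vars_compose2[OF ind]) simp
  have int: "integrable M (\<lambda>w. exp (?r * ((X l w)\<^sup>2 - 1)))" if "l \<in> {..<n}" for l
    using that by (intro std_normal_exp_square X r) auto
  have "expectation (\<lambda>w. \<Prod>l<n. exp (?r * ((X l w)\<^sup>2 - 1)))
      = (\<Prod>l<n. expectation (\<lambda>w. exp (?r * ((X l w)\<^sup>2 - 1))))"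
    by (rule indep_vars_lebesgue_integral[OF _ ind' int]) auto
  also have "\<dots> \<le> (\<Prod>l<n. exp (4 * ?r\<^sup>2))"
    by (intro prod_mono conjI std_normal_exp_square(2) X r Bochner_Integration.integral_nonneg) auto
  also have "\<dots> = exp 4" unfolding rr using n by (simp add: exp_of_nat_mult[symmetric])
  finally have E: "expectation (\<lambda>w. \<Prod>l<n. exp (?r * ((X l w)\<^sup>2 - 1))) \<le> exp 4" .
  have I: "integrable M (\<lambda>w. \<Prod>l<n. exp (?r * ((X l w)\<^sup>2 - 1)))"
    by (rule indep_vars_integrable[OF _ ind' int]) auto
  have prod: "(\<Prod>l<n. exp (?r * ((X l w)\<^sup>2 - 1))) = exp (?r * ((\<Sum>l<n. (X l w)\<^sup>2) - real n))" for w
    by (simp add: exp_sum[symmetric] sum_distrib_left[symmetric] sum_subtractf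
        sum_divide_distrib[symmetric])
  have "prob {w \<in> space M. s * ((\<Sum>l<n. (X l w)\<^sup>2) - real n) > T * sqrt (real n)}
      \<le> prob {w \<in> space M. (\<Prod>l<n. exp (?r * ((X l w)\<^sup>2 - 1))) \<ge> exp T}"
  proof (rule finite_measure_mono)
    show "{w \<in> space M. (\<Prod>l<n. exp (?r * ((X l w)\<^sup>2 - 1))) \<ge> exp T} \<in> events"
      using I by measurable
    show "{w \<in> space M. s * ((\<Sum>l<n. (X l w)\<^sup>2) - real n) > T * sqrt (real n)}
        \<subseteq> {w \<in> space M. (\<Prod>l<n. exp (?r * ((X l w)\<^sup>2 - 1))) \<ge> exp T}"
    proof
      fix w assume "w \<in> {w \<in> space M. s * ((\<Sum>l<n. (X l w)\<^sup>2) - real n) > T * sqrt (real n)}"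
      then have w: "w \<in> space M" "T * sqrt (real n) < s * ((\<Sum>l<n. (X l w)\<^sup>2) - real n)" by auto
      then have "T \<le> (s * ((\<Sum>l<n. (X l w)\<^sup>2) - real n)) / sqrt (real n)"
        using rp by (simp add: pos_le_divide_eq)
      then have "T \<le> ?r * ((\<Sum>l<n. (X l w)\<^sup>2) - real n)" by simp
      then show "w \<in> {w \<in> space M. (\<Prod>l<n. exp (?r * ((X l w)\<^sup>2 - 1))) \<ge> exp T}"
        using w(1) unfolding prod by simp
    qed
  qed
  also have "\<dots> \<le> expectation (\<lambda>w. \<Prod>l<n. exp (?r * ((X l w)\<^sup>2 - 1))) / exp T"
    by (rule integral_Markov_inequality_measure[where A = "{}"]) (use I in \<open>auto intro!: prod_nonneg\<close>)
  also have "\<dots> \<le> exp 4 / exp T" using E by (intro divide_right_mono) auto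
  finally show ?thesis by (simp add: exp_diff)
qed

section \<open>Quadratic and bilinear forms of the Gaussian matrix\<close>

context gaussian_matrix
begin

definition rowform :: "(nat \<Rightarrow> real) \<Rightarrow> nat \<Rightarrow> 'a \<Rightarrow> real" where
  "rowform c l w = (\<Sum>j<p. c j * z (l, j) w)"

lemma rowform_measurable: "l < n \<Longrightarrow> rowform c l \<in> borel_measurable M"
  unfolding rowform_def[abs_def] by (intro borel_measurable_sum borel_measurable_times) (auto intro: z_measurable)

lemma rowform_add: "rowform (\<lambda>j. a j + r * b j) l w = rowform a l w + r * rowform b l w"
  by (simp add: rowform_def sum.distrib sum_distrib_left algebra_simps)

lemma sum_row: "(\<Sum>x\<in>{l} \<times> {..<p}. f x) = (\<Sum>j<p. f (l, j))" for f :: "nat \<times> nat \<Rightarrow> real"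
proof -
  have "{l} \<times> {..<p} = (\<lambda>j. (l, j)) ` {..<p}" by auto
  then show ?thesis by (simp add: sum.reindex inj_on_def)
qed

lemma rowform_distributed:
  assumes c: "ip p c c = 1" and l: "l < n"
  shows "distributed M lborel (rowform c l) std_normal_density"
proof -
  let ?J = "{l} \<times> {..<p}"
  have v: "(\<Sum>x\<in>?J. (c (snd x))\<^sup>2) = 1"
    using c unfolding sum_row by (simp add: ip_def power2_eq_square)
  have "distributed M lborel (\<lambda>w. \<Sum>x\<in>?J. c (snd x) * z x w) (normal_density 0 (sqrt (\<Sum>x\<in>?J. (c (snd x))\<^sup>2)))"
    by (rule lincomb_normal[OF _ indep_vars_subset[OF indep]]) (use l std v in auto)
  moreover have "(\<lambda>w. \<Sum>x\<in>?J. c (snd x) * z x w) = rowform c l"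
    unfolding sum_row rowform_def[abs_def] by simp
  ultimately show ?thesis unfolding v by simp
qed

lemma rowform_indep: "indep_vars (\<lambda>_. borel) (rowform c) {..<n}"
proof -
  have "indep_vars (\<lambda>l. PiM ({l} \<times> {..<p}) (\<lambda>_. borel)) (\<lambda>l w. restrict (\<lambda>x. z x w) ({l} \<times> {..<p})) {..<n}"
    by (rule indep_vars_restrict[OF indep]) (auto simp: disjoint_family_on_def)
  then have "indep_vars (\<lambda>_. borel) (\<lambda>l w. (\<lambda>u. \<Sum>j<p. c j * u (l, j)) (restrict (\<lambda>x. z x w) ({l} \<times> {..<p}))) {..<n}"
  proof (rule indep_vars_compose2)
    fix l assume "l \<in> {..<n}"
    have "(\<lambda>u. u (l, j)) \<in> borel_measurable (PiM ({l} \<times> {..<p}) (\<lambda>_. borel :: real measure))" if "j < p" for j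
      using that by (intro measurable_component_singleton) auto
    then show "(\<lambda>u. \<Sum>j<p. c j * u (l, j)) \<in> borel_measurable (PiM ({l} \<times> {..<p}) (\<lambda>_. borel))"
      by (intro borel_measurable_sum borel_measurable_times) auto
  qed
  then show ?thesis by (simp add: rowform_def[abs_def])
qed

text \<open>For a unit vector \<open>c\<close> the values \<open>rowform c l\<close> are independent
  standard normals, one for each row; other vectors are rescaled, and for a vector of length 0 the
  strict inequality never holds.\<close>

lemma quadform_concentration:
  assumes n: "16 \<le> n"
  shows "prob {w \<in> space M. \<bar>(\<Sum>l<n. (rowform c l w)\<^sup>2) - ip p c c * real n\<bar> > ip p c c * (T * sqrt (real n))}
    \<le> 2 * exp (4 - T)"
proof (cases "ip p c c = 0")
  case True
  then have "(\<Sum>j<p. c j * c j) = 0" by (simp add: ip_def)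
  then have "\<forall>j<p. c j * c j = 0" by (subst (asm) sum_nonneg_eq_0_iff) auto
  then have "rowform c l w = 0" for l w by (simp add: rowform_def)
  then show ?thesis using True by simp
next
  case False
  define q where "q = ip p c c"
  have q: "0 < q" using False ip_self_nonneg[of p c] by (simp add: q_def)
  define d where "d j = c j / sqrt q" for j
  have dd: "ip p d d = 1"
    using q by (simp add: ip_def d_def sum_divide_distrib[symmetric]) (simp add: q_def ip_def)
  have cd: "rowform c l w = sqrt q * rowform d l w" for l w
    using q by (simp add: rowform_def d_def sum_distrib_left)
  let ?S = "\<lambda>w. (\<Sum>l<n. (rowform d l w)\<^sup>2)"
  let ?E = "\<lambda>s. {w \<in> space M. s * (?S w - real n) > T * sqrt (real n)}"
  have cS: "(\<Sum>l<n. (rowform c l w)\<^sup>2) = q * ?S w" for w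
    unfolding cd using q by (simp add: power_mult_distrib sum_distrib_left)
  have [measurable]: "?S \<in> borel_measurable M"
    by (intro borel_measurable_sum borel_measurable_power rowform_measurable) auto
  have E: "?E s \<in> events" for s by measurable
  have tail: "prob (?E s) \<le> exp (4 - T)" if "s = 1 \<or> s = - 1" for s
    by (rule chi_square_tail[OF n rowform_indep _ that]) (rule rowform_distributed[OF dd])
  have "{w \<in> space M. \<bar>(\<Sum>l<n. (rowform c l w)\<^sup>2) - ip p c c * real n\<bar> > ip p c c * (T * sqrt (real n))}
      \<subseteq> ?E 1 \<union> ?E (- 1)"
  proof safe
    fix w assume "w \<in> space M" and h: "ip p c c * (T * sqrt (real n)) < \<bar>(\<Sum>l<n. (rowform c l w)\<^sup>2) - ip p c c * real n\<bar>"
      and n1: "\<not> T * sqrt (real n) < - 1 * (?S w - real n)"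
    have "(\<Sum>l<n. (rowform c l w)\<^sup>2) - ip p c c * real n = q * (?S w - real n)"
      unfolding cS by (simp add: q_def algebra_simps)
    then have "q * (T * sqrt (real n)) < q * \<bar>?S w - real n\<bar>" using h q by (simp add: q_def abs_mult)
    then have "T * sqrt (real n) < \<bar>?S w - real n\<bar>" using q by simp
    then show "T * sqrt (real n) < 1 * (?S w - real n)" using n1 by (simp add: abs_if split: if_splits)
  qed
  then have "prob {w \<in> space M. \<bar>(\<Sum>l<n. (rowform c l w)\<^sup>2) - ip p c c * real n\<bar> > ip p c c * (T * sqrt (real n))}
      \<le> prob (?E 1 \<union> ?E (- 1))" by (rule finite_measure_mono) (rule sets.Un[OF E E])
  also have "\<dots> \<le> prob (?E 1) + prob (?E (- 1))" by (rule measure_Un_le[OF E E])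
  also have "\<dots> \<le> 2 * exp (4 - T)" using tail[of 1] tail[of "- 1"] by simp
  finally show ?thesis .
qed

definition biform :: "(nat \<Rightarrow> real) \<Rightarrow> (nat \<Rightarrow> real) \<Rightarrow> 'a \<Rightarrow> real" where
  "biform a b w = (\<Sum>l<n. rowform a l w * rowform b l w) / sqrt (real n)"

lemma biform_measurable: "biform a b \<in> borel_measurable M"
  unfolding biform_def[abs_def]
  by (intro borel_measurable_divide borel_measurable_sum borel_measurable_times rowform_measurable) auto

text \<open>Polarisation with a + b and a - b. Their squared lengths add up to 4 whatever the angle
  between a and b, so the two errors add up to 4 T sqrt n.\<close>

lemma biform_concentration:
  assumes n: "16 \<le> n" and a: "ip p a a = 1" and b: "ip p b b = 1"
  shows "prob {w \<in> space M. \<bar>biform a b w - sqrt (real n) * ip p a b\<bar> > T} \<le> 4 * exp (4 - T)"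
proof -
  let ?c = "\<lambda>r j. a j + r * b j"
  let ?Q = "\<lambda>r w. \<Sum>l<n. (rowform (?c r) l w)\<^sup>2"
  let ?E = "\<lambda>r. {w \<in> space M. \<bar>?Q r w - ip p (?c r) (?c r) * real n\<bar> > ip p (?c r) (?c r) * (T * sqrt (real n))}"
  have [measurable]: "?Q r \<in> borel_measurable M" for r
    by (intro borel_measurable_sum borel_measurable_power rowform_measurable) auto
  have E: "?E r \<in> events" for r by measurable
  have q: "ip p (?c r) (?c r) = 1 + r * r + 2 * r * ip p a b" for r
    using a b by (simp add: ip_add_scale_left ip_add_scale_right ip_commute[of p b a] algebra_simps)
  have "{w \<in> space M. \<bar>biform a b w - sqrt (real n) * ip p a b\<bar> > T} \<subseteq> ?E 1 \<union> ?E (- 1)"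
  proof (rule subsetI, rule ccontr)
    fix w assume w: "w \<in> {w \<in> space M. \<bar>biform a b w - sqrt (real n) * ip p a b\<bar> > T}"
      and nE: "w \<notin> ?E 1 \<union> ?E (- 1)"
    define D where "D = (\<Sum>l<n. rowform a l w * rowform b l w) - real n * ip p a b"
    have pol: "?Q 1 w - ?Q (- 1) w = 4 * (\<Sum>l<n. rowform a l w * rowform b l w)"
      unfolding rowform_add sum_subtractf[symmetric] sum_distrib_left
      by (intro sum.cong refl) (simp add: power2_eq_square algebra_simps)
    have "4 * D = (?Q 1 w - ip p (?c 1) (?c 1) * real n) - (?Q (- 1) w - ip p (?c (- 1)) (?c (- 1)) * real n)"
      unfolding D_def q using pol by (simp add: algebra_simps)
    moreover have "\<bar>?Q 1 w - ip p (?c 1) (?c 1) * real n\<bar> \<le> ip p (?c 1) (?c 1) * (T * sqrt (real n))"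
      "\<bar>?Q (- 1) w - ip p (?c (- 1)) (?c (- 1)) * real n\<bar> \<le> ip p (?c (- 1)) (?c (- 1)) * (T * sqrt (real n))"
      using w nE by auto
    ultimately have "4 * \<bar>D\<bar> \<le> ip p (?c 1) (?c 1) * (T * sqrt (real n)) + ip p (?c (- 1)) (?c (- 1)) * (T * sqrt (real n))"
      by linarith
    also have "\<dots> = 4 * (T * sqrt (real n))" unfolding q by (simp add: algebra_simps)
    finally have D: "\<bar>D\<bar> \<le> T * sqrt (real n)" by simp
    have "real n * ip p a b / sqrt (real n) = real n / sqrt (real n) * ip p a b" by simp
    then have "biform a b w - sqrt (real n) * ip p a b = D / sqrt (real n)"
      unfolding biform_def D_def diff_divide_distrib by (simp add: real_div_sqrt)
    then have "\<bar>biform a b w - sqrt (real n) * ip p a b\<bar> = \<bar>D\<bar> / sqrt (real n)" by simp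
    also have "\<dots> \<le> T" using D n_pos by (simp add: pos_divide_le_eq)
    finally show False using w by simp
  qed
  then have "prob {w \<in> space M. \<bar>biform a b w - sqrt (real n) * ip p a b\<bar> > T} \<le> prob (?E 1 \<union> ?E (- 1))"
    by (rule finite_measure_mono) (rule sets.Un[OF E E])
  also have "\<dots> \<le> prob (?E 1) + prob (?E (- 1))" by (rule measure_Un_le[OF E E])
  also have "\<dots> \<le> 4 * exp (4 - T)"
    using quadform_concentration[OF n, of "?c 1" T] quadform_concentration[OF n, of "?c (- 1)" T] by linarith
  finally show ?thesis .
qed

lemma biform_unit: "i < p \<Longrightarrow> j < p \<Longrightarrow> biform (unit_fun i) (unit_fun j) w = gcov n (arr w) i j"
proof -
  have r: "rowform (unit_fun i) l w = z (l, i) w" if "i < p" for i l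
    using ip_unit_fun[OF that, of "\<lambda>j. z (l, j) w"] by (simp add: rowform_def ip_def mult.commute)
  assume "i < p" "j < p"
  then show ?thesis by (simp add: biform_def gcov_def r)
qed

text \<open>\<open>rho\<close> is chosen so that under \<open>near_iso\<close>, where off-diagonal
  entries are at most T, the length test in \<open>krow\<close> always passes; there truncated and
  true rows agree. \<open>L\<close> is T times the base from the trace recursion, so Markov's
  inequality leaves m / T^(K+1). The values R = m and R = p serve the two blocks.\<close>

lemma kernel_block_bound:
  fixes K k :: nat
  assumes R: "R \<le> p" and T: "1 \<le> T" "T \<le> sqrt (real n)" and m: "0 < m" "m \<le> p"
  defines "L \<equiv> T * (real m * ((1 + gmom k) * T ^ k)\<^sup>2
      + 2 ^ Suc K * (kernel_const k * (1 + real m * (T / sqrt (real n)))) * real R)"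
  shows "\<exists>E\<in>events. prob E \<le> real m * (1 / T) ^ Suc K \<and> (\<forall>w\<in>space M - E. near_iso n T p (arr w) \<longrightarrow>
    (\<forall>x. (\<Sum>s<R. (\<Sum>j<min s m. (gcov n (arr w) s j ^ k - gmom k) * x j)\<^sup>2) \<le> L * ip m x x))"
proof -
  define rho where "rho = real m * ((1 + gmom k) * T ^ k)\<^sup>2"
  have g: "0 \<le> gmom k" by (rule gmom_nonneg)
  have rho: "0 < rho" using m T g by (auto simp: rho_def intro!: mult_pos_pos)
  have T0: "0 \<le> T" using T by simp
  note kb = krow_bound_prob[OF T0 T(2) less_imp_le[OF rho] R, where m = m and k = k and K = K]
  note kv = kvar_def[OF T0 T(2) less_imp_le[OF rho], of m k]
  have L: "L = T * (rho + 2 ^ Suc K * kvar m k T * real R)"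
    by (simp add: L_def rho_def kv)
  have b: "0 < rho + 2 ^ Suc K * kvar m k T * real R"
    using rho kvar_nonneg[OF T0 T(2) less_imp_le[OF rho], of m k] by (intro add_pos_nonneg) auto
  have L0: "0 < L" using b T unfolding L by (intro mult_pos_pos) auto
  define E where "E = {w \<in> space M. ktrace m k T rho R (Suc K) (arr w) \<ge> L ^ Suc K}"
  have "(rho + 2 ^ Suc K * kvar m k T * real R) / L = 1 / T" using b unfolding L by simp
  then have "prob E \<le> real m * (1 / T) ^ Suc K" using kb(2)[OF L0] by (simp add: E_def)
  moreover have "E \<in> events" using kb(1)[OF L0] by (simp add: E_def)
  moreover have "(\<Sum>s<R. (\<Sum>j<min s m. (gcov n (arr w) s j ^ k - gmom k) * x j)\<^sup>2) \<le> L * ip m x x"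
    if w: "w \<in> space M - E" and iso: "near_iso n T p (arr w)" for w x
  proof -
    have "(\<Sum>s<R. (ip m (krow n m k T rho (arr w) s) x)\<^sup>2) \<le> L * ip m x x"
      using kb(3)[OF L0] w by (simp add: E_def)
    moreover have "ip m (krow n m k T rho (arr w) s) x = (\<Sum>j<min s m. (gcov n (arr w) s j ^ k - gmom k) * x j)"
      if s: "s < R" for s
    proof -
      have iso': "near_iso n T (min s m) (arr w)" using iso R s m unfolding near_iso_def by auto
      have "(gcov n (arr w) s j ^ k - gmom k)\<^sup>2 \<le> ((1 + gmom k) * T ^ k)\<^sup>2" if "j < min s m" for j
      proof -
        have "\<bar>gcov n (arr w) s j\<bar> \<le> T" using iso that s R m by (auto simp: near_iso_def)
        then have "\<bar>gcov n (arr w) s j\<bar> ^ k \<le> T ^ k" by (intro power_mono) auto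
        moreover have "gmom k * 1 \<le> gmom k * T ^ k" using g T by (intro mult_left_mono one_le_power) auto
        ultimately have "\<bar>gcov n (arr w) s j ^ k - gmom k\<bar> \<le> (1 + gmom k) * T ^ k"
          using g abs_triangle_ineq4[of "gcov n (arr w) s j ^ k" "gmom k"]
          by (simp add: power_abs algebra_simps)
        then have "\<bar>gcov n (arr w) s j ^ k - gmom k\<bar>\<^sup>2 \<le> ((1 + gmom k) * T ^ k)\<^sup>2"
          by (intro power_mono) auto
        then show ?thesis by simp
      qed
      then have "(\<Sum>j<min s m. (gcov n (arr w) s j ^ k - gmom k)\<^sup>2) \<le> (\<Sum>j<min s m. ((1 + gmom k) * T ^ k)\<^sup>2)"
        by (intro sum_mono) auto
      also have "\<dots> = real (min s m) * ((1 + gmom k) * T ^ k)\<^sup>2" by simp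
      also have "\<dots> \<le> rho" unfolding rho_def by (intro mult_right_mono) auto
      finally have len: "(\<Sum>j<min s m. (gcov n (arr w) s j ^ k - gmom k)\<^sup>2) \<le> rho" .
      show ?thesis unfolding ip_def
        by (rule sum.mono_neutral_cong_right) (use len iso' in \<open>auto simp: krow_def\<close>)
    qed
    ultimately show ?thesis by simp
  qed
  ultimately show ?thesis by (intro bexI[of _ E]) auto
qed

end

section \<open>Bilinear form bounds and polynomials under Gaussian shifts\<close>

text \<open>An operator norm bound for the p x p array \<open>D\<close>, phrased with bilinear forms
  of functions so that addition, transposition and diagonal scaling act directly on the bound and no
  matrix carriers occur.\<close>

definition bil_bound :: "nat \<Rightarrow> (nat \<Rightarrow> nat \<Rightarrow> real) \<Rightarrow> real \<Rightarrow> bool" where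
  "bil_bound p D b \<longleftrightarrow> (\<forall>w u. \<bar>\<Sum>i<p. \<Sum>j<p. w i * D i j * u j\<bar> \<le> b * (sqrt (ip p w w) * sqrt (ip p u u)))"

lemma bil_boundD: "bil_bound p D b \<Longrightarrow> \<bar>\<Sum>i<p. \<Sum>j<p. w i * D i j * u j\<bar> \<le> b * (sqrt (ip p w w) * sqrt (ip p u u))"
  by (simp add: bil_bound_def)

lemma bil_bound_mono: "bil_bound p D b \<Longrightarrow> b \<le> c \<Longrightarrow> bil_bound p D c"
  unfolding bil_bound_def
  by (meson ip_self_nonneg mult_nonneg_nonneg mult_right_mono order_trans real_sqrt_ge_zero)

lemma bil_bound_cong: "bil_bound p D b \<Longrightarrow> (\<And>i j. i < p \<Longrightarrow> j < p \<Longrightarrow> D i j = D' i j) \<Longrightarrow> bil_bound p D' b"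
proof -
  assume D: "bil_bound p D b" and e: "\<And>i j. i < p \<Longrightarrow> j < p \<Longrightarrow> D i j = D' i j"
  have "(\<Sum>i<p. \<Sum>j<p. w i * D i j * u j) = (\<Sum>i<p. \<Sum>j<p. w i * D' i j * u j)" for w u
    by (intro sum.cong refl) (simp add: e)
  then show ?thesis using D by (simp add: bil_bound_def)
qed

lemma bil_bound_add:
  assumes "bil_bound p D b" "bil_bound p D' b'"
  shows "bil_bound p (\<lambda>i j. D i j + D' i j) (b + b')"
  unfolding bil_bound_def
proof (intro allI)
  fix w u
  have "(\<Sum>i<p. \<Sum>j<p. w i * (D i j + D' i j) * u j)
      = (\<Sum>i<p. \<Sum>j<p. w i * D i j * u j) + (\<Sum>i<p. \<Sum>j<p. w i * D' i j * u j)"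
    by (simp add: sum.distrib algebra_simps)
  then show "\<bar>\<Sum>i<p. \<Sum>j<p. w i * (D i j + D' i j) * u j\<bar> \<le> (b + b') * (sqrt (ip p w w) * sqrt (ip p u u))"
    using bil_boundD[OF assms(1), of w u] bil_boundD[OF assms(2), of w u] by (simp add: distrib_right)
qed

text \<open>Left and right multiplication by diagonal matrices. In this way the weights v_i^l v_j^l,
  and ex_i with v_j, are attached to the centered blocks.\<close>

lemma bil_bound_scale:
  assumes D: "bil_bound p D b" and b: "0 \<le> b" and a: "\<And>i. i < p \<Longrightarrow> \<bar>al i\<bar> \<le> a" "0 \<le> a"
    and c: "\<And>j. j < p \<Longrightarrow> \<bar>be j\<bar> \<le> c" "0 \<le> c"
  shows "bil_bound p (\<lambda>i j. al i * D i j * be j) (a * b * c)"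
  unfolding bil_bound_def
proof (intro allI)
  fix w u :: "nat \<Rightarrow> real"
  have sc: "sqrt (ip p (\<lambda>i. f i * g i) (\<lambda>i. f i * g i)) \<le> r * sqrt (ip p f f)"
    if "\<And>i. i < p \<Longrightarrow> \<bar>g i\<bar> \<le> r" "0 \<le> r" for f g :: "nat \<Rightarrow> real" and r
  proof (rule real_le_lsqrt)
    have "ip p (\<lambda>i. f i * g i) (\<lambda>i. f i * g i) = (\<Sum>i<p. (f i * f i) * (g i)\<^sup>2)"
      by (simp add: ip_def power2_eq_square ac_simps)
    also have "\<dots> \<le> (\<Sum>i<p. (f i * f i) * r\<^sup>2)"
      using that by (intro sum_mono mult_left_mono) (auto simp: abs_le_square_iff[symmetric])
    also have "\<dots> = ip p f f * r\<^sup>2" by (simp add: ip_def sum_distrib_right)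
    also have "\<dots> = (r * sqrt (ip p f f))\<^sup>2" by (simp add: power_mult_distrib ip_self_nonneg)
    finally show "ip p (\<lambda>i. f i * g i) (\<lambda>i. f i * g i) \<le> (r * sqrt (ip p f f))\<^sup>2" .
  qed (use that ip_self_nonneg in auto)
  have "(\<Sum>i<p. \<Sum>j<p. w i * (al i * D i j * be j) * u j) = (\<Sum>i<p. \<Sum>j<p. (w i * al i) * D i j * (u j * be j))"
    by (simp add: ac_simps)
  then have "\<bar>\<Sum>i<p. \<Sum>j<p. w i * (al i * D i j * be j) * u j\<bar>
      \<le> b * (sqrt (ip p (\<lambda>i. w i * al i) (\<lambda>i. w i * al i)) * sqrt (ip p (\<lambda>j. u j * be j) (\<lambda>j. u j * be j)))"
    using bil_boundD[OF D, of "\<lambda>i. w i * al i" "\<lambda>j. u j * be j"] by simp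
  also have "\<dots> \<le> b * ((a * sqrt (ip p w w)) * (c * sqrt (ip p u u)))"
    using b a c ip_self_nonneg by (intro mult_left_mono mult_mono sc) auto
  finally show "\<bar>\<Sum>i<p. \<Sum>j<p. w i * (al i * D i j * be j) * u j\<bar> \<le> a * b * c * (sqrt (ip p w w) * sqrt (ip p u u))"
    by (simp add: ac_simps)
qed

lemma bil_bound_cmult:
  assumes "bil_bound p D b" "0 \<le> b"
  shows "bil_bound p (\<lambda>i j. c * D i j) (\<bar>c\<bar> * b)"
  using bil_bound_scale[OF assms, of "\<lambda>_. c" "\<bar>c\<bar>" "\<lambda>_. 1" 1] by simp

lemma bil_bound_sum:
  assumes "\<And>k. k \<in> I \<Longrightarrow> bil_bound p (D k) (b k)"
  shows "bil_bound p (\<lambda>i j. \<Sum>k\<in>I. D k i j) (\<Sum>k\<in>I. b k)"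
  using assms
proof (induction I rule: infinite_finite_induct)
  case (insert k I)
  then show ?case using bil_bound_add[of p "D k" "b k" "\<lambda>i j. \<Sum>k\<in>I. D k i j" "\<Sum>k\<in>I. b k"] by simp
qed (simp_all add: bil_bound_def)

lemma bil_bound_transpose: "bil_bound p D b \<Longrightarrow> bil_bound p (\<lambda>i j. D j i) b"
  unfolding bil_bound_def
proof (intro allI)
  fix w u assume D: "\<forall>w u. \<bar>\<Sum>i<p. \<Sum>j<p. w i * D i j * u j\<bar> \<le> b * (sqrt (ip p w w) * sqrt (ip p u u))"
  have "(\<Sum>i<p. \<Sum>j<p. w i * D j i * u j) = (\<Sum>i<p. \<Sum>j<p. u i * D i j * w j)"
    by (subst sum.swap) (simp add: ac_simps)
  then show "\<bar>\<Sum>i<p. \<Sum>j<p. w i * D j i * u j\<bar> \<le> b * (sqrt (ip p w w) * sqrt (ip p u u))"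
    using D[rule_format, of u w] by (simp add: mult.commute)
qed

lemma abs_ip_le: "\<bar>ip p x y\<bar> \<le> sqrt (ip p x x) * sqrt (ip p y y)"
proof -
  have "(ip p x y)\<^sup>2 \<le> ip p x x * ip p y y"
    using Cauchy_Schwarz_ineq_sum[of x y "{..<p}"] by (simp add: ip_def power2_eq_square)
  then have "sqrt ((ip p x y)\<^sup>2) \<le> sqrt (ip p x x * ip p y y)" by (rule real_sqrt_le_mono)
  then show ?thesis by (simp add: real_sqrt_mult)
qed

lemma bil_bound_rank_one:
  assumes "\<And>i j. i < p \<Longrightarrow> j < p \<Longrightarrow> \<bar>D i j\<bar> \<le> a i * c j"
  shows "bil_bound p D (sqrt (ip p a a) * sqrt (ip p c c))"
  unfolding bil_bound_def
proof (intro allI)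
  fix w u
  have "\<bar>\<Sum>i<p. \<Sum>j<p. w i * D i j * u j\<bar> \<le> (\<Sum>i<p. \<bar>\<Sum>j<p. w i * D i j * u j\<bar>)" by (rule sum_abs)
  also have "\<dots> \<le> (\<Sum>i<p. \<Sum>j<p. \<bar>w i * D i j * u j\<bar>)" by (intro sum_mono sum_abs)
  also have "\<dots> \<le> (\<Sum>i<p. \<Sum>j<p. (\<bar>w i\<bar> * a i) * (\<bar>u j\<bar> * c j))"
  proof (intro sum_mono)
    fix i j assume "i \<in> {..<p}" "j \<in> {..<p}"
    then have "(\<bar>w i\<bar> * \<bar>u j\<bar>) * \<bar>D i j\<bar> \<le> (\<bar>w i\<bar> * \<bar>u j\<bar>) * (a i * c j)"
      using assms by (intro mult_left_mono) auto
    then show "\<bar>w i * D i j * u j\<bar> \<le> (\<bar>w i\<bar> * a i) * (\<bar>u j\<bar> * c j)" by (simp add: abs_mult ac_simps)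
  qed
  also have "\<dots> = ip p (\<lambda>i. \<bar>w i\<bar>) a * ip p (\<lambda>j. \<bar>u j\<bar>) c"
    by (simp add: ip_def sum_product)
  also have "\<dots> \<le> \<bar>ip p (\<lambda>i. \<bar>w i\<bar>) a\<bar> * \<bar>ip p (\<lambda>j. \<bar>u j\<bar>) c\<bar>"
    by (simp add: abs_mult[symmetric])
  also have "\<dots> \<le> (sqrt (ip p w w) * sqrt (ip p a a)) * (sqrt (ip p u u) * sqrt (ip p c c))"
    using abs_ip_le[of p "\<lambda>i. \<bar>w i\<bar>" a] abs_ip_le[of p "\<lambda>i. \<bar>u i\<bar>" c]
    by (intro mult_mono) (simp_all add: ip_def sum_nonneg)
  finally show "\<bar>\<Sum>i<p. \<Sum>j<p. w i * D i j * u j\<bar>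
      \<le> sqrt (ip p a a) * sqrt (ip p c c) * (sqrt (ip p w w) * sqrt (ip p u u))" by (simp add: ac_simps)
qed

lemma ip_initial_segment: "q \<le> p \<Longrightarrow> ip p (\<lambda>i. if i < q then c else 0) (\<lambda>i. if i < q then c else 0) = real q * c\<^sup>2"
proof -
  assume "q \<le> p"
  then have "ip p (\<lambda>i. if i < q then c else 0) (\<lambda>i. if i < q then c else 0) = (\<Sum>i<q. c\<^sup>2)"
    unfolding ip_def by (intro sum.mono_neutral_cong_right) (auto simp: power2_eq_square)
  then show ?thesis by simp
qed

text \<open>Domination by a rank-one array supported on the corner. This serves the errors that are
  small enough without cancellation.\<close>

lemma bil_bound_entries:
  assumes e: "\<And>i j. i < p \<Longrightarrow> j < p \<Longrightarrow> \<bar>D i j\<bar> \<le> (if i < q \<and> j < r then e else 0)"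
    and qr: "q \<le> p" "r \<le> p" and e0: "0 \<le> e"
  shows "bil_bound p D (e * sqrt (real q * real r))"
proof -
  have "bil_bound p D (sqrt (ip p (\<lambda>i. if i < q then e else 0) (\<lambda>i. if i < q then e else 0))
      * sqrt (ip p (\<lambda>i. if i < r then 1 else 0) (\<lambda>i. if i < r then 1 else 0)))"
  proof (rule bil_bound_rank_one)
    fix i j assume "i < p" "j < p"
    then show "\<bar>D i j\<bar> \<le> (if i < q then e else 0) * (if j < r then 1 else 0)"
      using e[of i j] by auto
  qed
  then show ?thesis using e0 qr by (simp add: ip_initial_segment real_sqrt_mult ac_simps)
qed

lemma bil_bound_diag:
  assumes "\<And>i. i < p \<Longrightarrow> \<bar>d i\<bar> \<le> e" "0 \<le> e"
  shows "bil_bound p (\<lambda>i j. if i = j then d i else 0) e"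
proof -
  have "bil_bound p (\<lambda>i j. if i = j then 1 else 0) 1"
    unfolding bil_bound_def
  proof (intro allI)
    fix w u :: "nat \<Rightarrow> real"
    have "(\<Sum>i<p. \<Sum>j<p. w i * (if i = j then 1 else 0) * u j) = ip p w u"
      unfolding ip_def by (intro sum.cong refl) (simp add: if_distrib[of "\<lambda>c. _ * c * _"] sum.delta cong: if_cong)
    then show "\<bar>\<Sum>i<p. \<Sum>j<p. w i * (if i = j then 1 else 0) * u j\<bar> \<le> 1 * (sqrt (ip p w w) * sqrt (ip p u u))"
      using abs_ip_le[of p w u] by simp
  qed
  from bil_bound_scale[OF this, of d e "\<lambda>_. 1" 1] assms
  have "bil_bound p (\<lambda>i j. d i * (if i = j then 1 else 0) * 1) (e * 1 * 1)" by simp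
  then have "bil_bound p (\<lambda>i j. d i * (if i = j then 1 else 0) * 1) e" by simp
  then show ?thesis by (rule bil_bound_cong) auto
qed

lemma bil_bound_rows:
  assumes "\<And>x. (\<Sum>i<p. (\<Sum>j<p. D i j * x j)\<^sup>2) \<le> L * ip p x x" "0 \<le> L"
  shows "bil_bound p D (sqrt L)"
  unfolding bil_bound_def
proof (intro allI)
  fix w u
  define y where "y i = (\<Sum>j<p. D i j * u j)" for i
  have "(\<Sum>i<p. \<Sum>j<p. w i * D i j * u j) = ip p w y"
    by (simp add: ip_def y_def sum_distrib_left mult.assoc)
  then have "\<bar>\<Sum>i<p. \<Sum>j<p. w i * D i j * u j\<bar> \<le> sqrt (ip p w w) * sqrt (ip p y y)"
    using abs_ip_le[of p w y] by simp
  also have "ip p y y \<le> L * ip p u u"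
    using assms(1)[of u] by (simp add: ip_def y_def power2_eq_square)
  then have "sqrt (ip p w w) * sqrt (ip p y y) \<le> sqrt (ip p w w) * sqrt (L * ip p u u)"
    using ip_self_nonneg by (intro mult_left_mono real_sqrt_le_mono) auto
  finally show "\<bar>\<Sum>i<p. \<Sum>j<p. w i * D i j * u j\<bar> \<le> sqrt L * (sqrt (ip p w w) * sqrt (ip p u u))"
    by (simp add: real_sqrt_mult ac_simps)
qed

section \<open>Growth and Taylor bounds for polynomials on [-T, T]\<close>

lemma power_weaken: "1 \<le> T \<Longrightarrow> 0 \<le> C \<Longrightarrow> d \<le> e \<Longrightarrow> C * T ^ d \<le> C * (T::real) ^ e"
  by (intro mult_left_mono power_increasing) auto

lemma poly_growth:
  fixes q :: "real poly"
  shows "\<exists>C\<ge>0. \<exists>d. \<forall>T\<ge>1. \<forall>x. \<bar>x\<bar> \<le> T \<longrightarrow> \<bar>poly q x\<bar> \<le> C * T ^ d"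
proof (induction q)
  case 0
  show ?case by (intro exI[of _ 0]) auto
next
  case (pCons a q)
  then obtain C d where C: "0 \<le> C" "\<And>T x. 1 \<le> T \<Longrightarrow> \<bar>x\<bar> \<le> T \<Longrightarrow> \<bar>poly q x\<bar> \<le> C * T ^ d" by blast
  have "\<bar>poly (pCons a q) x\<bar> \<le> (\<bar>a\<bar> + C) * T ^ Suc d" if T: "1 \<le> T" "\<bar>x\<bar> \<le> T" for T x
  proof -
    have "\<bar>poly (pCons a q) x\<bar> \<le> \<bar>a\<bar> + \<bar>x\<bar> * \<bar>poly q x\<bar>"
      using abs_triangle_ineq[of a "x * poly q x"] by (simp add: abs_mult)
    also have "\<bar>x\<bar> * \<bar>poly q x\<bar> \<le> T * (C * T ^ d)" using C T by (intro mult_mono) auto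
    also have "\<bar>a\<bar> \<le> \<bar>a\<bar> * T ^ Suc d" using power_weaken[OF T(1), of "\<bar>a\<bar>" 0 "Suc d"] by simp
    finally show ?thesis by (simp add: algebra_simps)
  qed
  then show ?case using C(1)
    by (intro exI[of _ "\<bar>a\<bar> + C"] exI[of _ "Suc d"] conjI allI impI) (simp, fast)
qed

text \<open>Induction through a + x q with the product rule for differences. The dependence on the
  radius is kept as an explicit power of T, because T will grow with n.\<close>

lemma poly_lipschitz:
  fixes q :: "real poly"
  shows "\<exists>C\<ge>0. \<exists>d. \<forall>T\<ge>1. \<forall>x y. \<bar>x\<bar> \<le> T \<longrightarrow> \<bar>y\<bar> \<le> T \<longrightarrow> \<bar>poly q x - poly q y\<bar> \<le> C * T ^ d * \<bar>x - y\<bar>"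
proof (induction q)
  case 0
  show ?case by (intro exI[of _ 0]) auto
next
  case (pCons a q)
  then obtain C d where C: "0 \<le> C"
    "\<And>T x y. 1 \<le> T \<Longrightarrow> \<bar>x\<bar> \<le> T \<Longrightarrow> \<bar>y\<bar> \<le> T \<Longrightarrow> \<bar>poly q x - poly q y\<bar> \<le> C * T ^ d * \<bar>x - y\<bar>" by blast
  obtain B e where B: "0 \<le> B" "\<And>T x. 1 \<le> T \<Longrightarrow> \<bar>x\<bar> \<le> T \<Longrightarrow> \<bar>poly q x\<bar> \<le> B * T ^ e"
    using poly_growth[of q] by blast
  have "\<bar>poly (pCons a q) x - poly (pCons a q) y\<bar> \<le> (C + B) * T ^ (Suc d + e) * \<bar>x - y\<bar>"
    if T: "1 \<le> T" "\<bar>x\<bar> \<le> T" "\<bar>y\<bar> \<le> T" for T x y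
  proof -
    have "poly (pCons a q) x - poly (pCons a q) y = x * (poly q x - poly q y) + (x - y) * poly q y"
      by (simp add: algebra_simps)
    then have "\<bar>poly (pCons a q) x - poly (pCons a q) y\<bar> \<le> \<bar>x\<bar> * \<bar>poly q x - poly q y\<bar> + \<bar>x - y\<bar> * \<bar>poly q y\<bar>"
      using abs_triangle_ineq[of "x * (poly q x - poly q y)" "(x - y) * poly q y"] by (simp add: abs_mult)
    also have "\<bar>x\<bar> * \<bar>poly q x - poly q y\<bar> \<le> T * (C * T ^ d * \<bar>x - y\<bar>)"
      using C T by (intro mult_mono) auto
    also have "\<bar>x - y\<bar> * \<bar>poly q y\<bar> \<le> \<bar>x - y\<bar> * (B * T ^ e)"
      using B T by (intro mult_left_mono) auto
    also have "T * (C * T ^ d * \<bar>x - y\<bar>) \<le> C * T ^ (Suc d + e) * \<bar>x - y\<bar>"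
      using mult_right_mono[OF power_weaken[OF T(1) C(1), of "Suc d" "Suc d + e"], of "\<bar>x - y\<bar>"]
      by (simp add: ac_simps)
    also have "\<bar>x - y\<bar> * (B * T ^ e) \<le> B * T ^ (Suc d + e) * \<bar>x - y\<bar>"
      using mult_right_mono[OF power_weaken[OF T(1) B(1), of e "Suc d + e"], of "\<bar>x - y\<bar>"]
      by (simp add: ac_simps)
    finally show ?thesis by (simp add: algebra_simps)
  qed
  then show ?case using C(1) B(1)
    by (intro exI[of _ "C + B"] exI[of _ "Suc d + e"] conjI allI impI) (simp, fast)
qed

text \<open>For a + x q the Taylor remainder is x times that of q plus h (q (x + h) - q x), and the
  last term is of order h^2 by the Lipschitz bound.\<close>

lemma poly_second_order:
  fixes q :: "real poly"
  shows "\<exists>C\<ge>0. \<exists>d. \<forall>T\<ge>1. \<forall>x h. \<bar>x\<bar> \<le> T \<longrightarrow> \<bar>x + h\<bar> \<le> T \<longrightarrow>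
    \<bar>poly q (x + h) - poly q x - poly (pderiv q) x * h\<bar> \<le> C * T ^ d * h\<^sup>2"
proof (induction q)
  case 0
  show ?case by (intro exI[of _ 0]) auto
next
  case (pCons a q)
  then obtain C d where C: "0 \<le> C"
    "\<And>T x h. 1 \<le> T \<Longrightarrow> \<bar>x\<bar> \<le> T \<Longrightarrow> \<bar>x + h\<bar> \<le> T \<Longrightarrow>
      \<bar>poly q (x + h) - poly q x - poly (pderiv q) x * h\<bar> \<le> C * T ^ d * h\<^sup>2" by blast
  obtain B e where B: "0 \<le> B"
    "\<And>T x y. 1 \<le> T \<Longrightarrow> \<bar>x\<bar> \<le> T \<Longrightarrow> \<bar>y\<bar> \<le> T \<Longrightarrow> \<bar>poly q x - poly q y\<bar> \<le> B * T ^ e * \<bar>x - y\<bar>"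
    using poly_lipschitz[of q] by blast
  have "\<bar>poly (pCons a q) (x + h) - poly (pCons a q) x - poly (pderiv (pCons a q)) x * h\<bar>
      \<le> (C + B) * T ^ (Suc d + e) * h\<^sup>2"
    if T: "1 \<le> T" "\<bar>x\<bar> \<le> T" "\<bar>x + h\<bar> \<le> T" for T x h
  proof -
    let ?r = "poly q (x + h) - poly q x - poly (pderiv q) x * h" and ?l = "poly q (x + h) - poly q x"
    have "poly (pCons a q) (x + h) - poly (pCons a q) x - poly (pderiv (pCons a q)) x * h = x * ?r + h * ?l"
      by (simp add: pderiv_pCons algebra_simps)
    then have "\<bar>poly (pCons a q) (x + h) - poly (pCons a q) x - poly (pderiv (pCons a q)) x * h\<bar>
        \<le> \<bar>x\<bar> * \<bar>?r\<bar> + \<bar>h\<bar> * \<bar>?l\<bar>"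
      using abs_triangle_ineq[of "x * ?r" "h * ?l"] by (simp add: abs_mult)
    also have "\<bar>x\<bar> * \<bar>?r\<bar> \<le> T * (C * T ^ d * h\<^sup>2)" using C T by (intro mult_mono) auto
    also have "\<bar>h\<bar> * \<bar>?l\<bar> \<le> \<bar>h\<bar> * (B * T ^ e * \<bar>h\<bar>)"
      using B(2)[OF T(1) T(3) T(2)] by (intro mult_left_mono) auto
    also have "T * (C * T ^ d * h\<^sup>2) \<le> C * T ^ (Suc d + e) * h\<^sup>2"
      using mult_right_mono[OF power_weaken[OF T(1) C(1), of "Suc d" "Suc d + e"], of "h\<^sup>2"]
      by (simp add: ac_simps)
    also have "\<bar>h\<bar> * (B * T ^ e * \<bar>h\<bar>) \<le> B * T ^ (Suc d + e) * h\<^sup>2"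
    proof -
      have "\<bar>h\<bar> * (B * T ^ e * \<bar>h\<bar>) = B * T ^ e * (\<bar>h\<bar> * \<bar>h\<bar>)" by (simp only: ac_simps)
      also have "\<bar>h\<bar> * \<bar>h\<bar> = h\<^sup>2" by (simp add: power2_eq_square)
      finally have "\<bar>h\<bar> * (B * T ^ e * \<bar>h\<bar>) = B * T ^ e * h\<^sup>2" .
      then show ?thesis
        using mult_right_mono[OF power_weaken[OF T(1) B(1), of e "Suc d + e"], of "h\<^sup>2"]
        by (simp only: le_add2 zero_le_power2 simp_thms)
    qed
    finally show ?thesis by (simp add: algebra_simps)
  qed
  then show ?case using C(1) B(1)
    by (intro exI[of _ "C + B"] exI[of _ "Suc d + e"] conjI allI impI) (simp, fast)
qed

section \<open>Hermite coefficients and Gaussian means of shifted polynomials\<close>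

lemma poly_sum_upto: "degree q \<le> N \<Longrightarrow> poly q x = (\<Sum>i\<le>N. coeff q i * x ^ i)" for x :: real
  unfolding poly_altdef by (rule sum.mono_neutral_left) (auto simp: coeff_eq_0)

lemma poly_as_sum_upto: "degree q \<le> N \<Longrightarrow> q = (\<Sum>i\<le>N. Polynomial.smult (coeff q i) (monom 1 i))" for q :: "real poly"
  by (rule poly_eq_poly_eq_iff[THEN iffD1], rule ext) (simp add: poly_sum poly_monom poly_sum_upto)

lemma gauss_mean_coeff: "degree q \<le> N \<Longrightarrow> gauss_mean q = (\<Sum>i\<le>N. coeff q i * gmom i)"
  by (subst poly_as_sum_upto[of q N]) (simp_all only: gauss_mean_sum gauss_mean_smult gmom_def)

text \<open>Integration by parts moves all l derivatives onto the monomial: the mean of \<xi>^i He_l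
  is that of the l-th derivative of \<xi>^i.\<close>

lemma gauss_mean_monom_He:
  "gauss_mean (monom 1 i * He l) = (if l \<le> i then fact i / fact (i - l) * gmom (i - l) else 0)"
proof (induction l arbitrary: i)
  case 0
  show ?case by (simp add: gmom_def)
next
  case (Suc l)
  have "gauss_mean (monom 1 i * He (Suc l))
      = gauss_mean ([:0, 1:] * (monom 1 i * He l)) - gauss_mean (monom 1 i * pderiv (He l))"
    using He_Suc[of l] by (simp add: right_diff_distrib gauss_mean_diff mult.left_commute del: mult_pCons_left mult_pCons_right)
  also have "\<dots> = gauss_mean (pderiv (monom 1 i) * He l)"
    unfolding gauss_mean_by_parts pderiv_mult gauss_mean_add by (simp add: mult.commute)
  also have "\<dots> = (if Suc l \<le> i then fact i / fact (i - Suc l) * gmom (i - Suc l) else 0)"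
  proof (cases i)
    case 0
    then show ?thesis by (simp add: monom_0 one_pCons[symmetric] gauss_mean_def)
  next
    case (Suc j)
    have "pderiv (monom 1 i) = Polynomial.smult (real (Suc j)) (monom 1 j :: real poly)"
      by (simp add: Suc pderiv_monom smult_monom)
    then show ?thesis using Suc.IH[of j] by (simp add: Suc gauss_mean_smult del: of_nat_Suc)
  qed
  finally show ?case .
qed

lemma hermite_coeff_poly:
  assumes "degree q \<le> N"
  shows "hermite_coeff (poly q) l
    = (\<Sum>i\<le>N. coeff q i * (if l \<le> i then fact i / fact (i - l) * gmom (i - l) else 0)) / sqrt (fact l)"
proof -
  have "hermite_coeff (poly q) l = gauss_mean (Polynomial.smult (1 / sqrt (fact l)) (q * He l))"
    by (simp add: hermite_coeff_def gauss_inner_def gauss_mean_def hermite_def field_simps)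
  also have "\<dots> = gauss_mean (q * He l) / sqrt (fact l)" by (simp add: gauss_mean_smult)
  also have "q * He l = (\<Sum>i\<le>N. Polynomial.smult (coeff q i) (monom 1 i * He l))"
    by (subst poly_as_sum_upto[OF assms]) (simp add: sum_distrib_right)
  finally show ?thesis by (simp add: gauss_mean_sum gauss_mean_smult gauss_mean_monom_He)
qed

text \<open>The auxiliary \<open>r\<close> is q (- x), with coefficients (-1)^i times those of q;
  oddness identifies it with - q.\<close>

lemma odd_poly_coeff:
  fixes q :: "real poly"
  assumes odd: "\<And>x. poly q (- x) = - poly q x" and i: "even i"
  shows "coeff q i = 0"
proof -
  define r where "r = (\<Sum>i\<le>degree q. monom ((- 1) ^ i * coeff q i) i)"
  have "poly r x = poly (- q) x" for x
  proof -
    have "poly r x = (\<Sum>i\<le>degree q. coeff q i * (- x) ^ i)"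
      unfolding r_def poly_sum poly_monom
      by (intro sum.cong refl) (subst power_minus[of x], simp)
    also have "\<dots> = poly q (- x)" by (simp add: poly_altdef)
    finally show ?thesis using odd by simp
  qed
  then have "r = - q" using poly_eq_poly_eq_iff[of r "- q"] by auto
  then have c: "coeff r i = - coeff q i" by simp
  have "coeff r i = coeff q i"
  proof (cases "i \<le> degree q")
    case True
    then show ?thesis using i by (simp add: r_def coeff_sum)
  next
    case False
    then show ?thesis by (simp add: r_def coeff_sum coeff_eq_0)
  qed
  then show ?thesis using c by simp
qed

lemma hermite_coeff_even:
  assumes odd: "\<And>x. poly q (- x) = - poly q x" and l: "even l"
  shows "hermite_coeff (poly q) l = 0"
proof -
  have "coeff q i * (if l \<le> i then fact i / fact (i - l) * gmom (i - l) else 0) = 0" for i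
    using odd_poly_coeff[OF odd, of i] gmom_odd[of "i - l"] l by (cases "even i") auto
  then show ?thesis by (simp only: hermite_coeff_poly[OF order_refl]) simp
qed

text \<open>For \<open>degree g \<le> N\<close> and \<open>\<xi>\<close> standard Gaussian this is \<open>E (g (\<xi> + \<theta>) - g \<xi>)\<close>.\<close>
definition shift_mean :: "nat \<Rightarrow> real poly \<Rightarrow> real \<Rightarrow> real" where
  "shift_mean N g th = (\<Sum>i\<le>N. coeff g i * (\<Sum>k<i. real (i choose k) * th ^ (i - k) * gmom k))"

text \<open>Subtracting the Gaussian mean turns each x^k of the binomial expansion into x^k - gmom
  k. The top term k = i cancels against g x, hence the sums over k < i.\<close>

lemma poly_shift_centered:
  assumes "degree g \<le> N"
  shows "poly g (x + th) - poly g x - shift_mean N g th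
    = (\<Sum>i\<le>N. coeff g i * (\<Sum>k<i. real (i choose k) * th ^ (i - k) * (x ^ k - gmom k)))"
proof -
  have e: "(x + th) ^ i - x ^ i = (\<Sum>k<i. real (i choose k) * th ^ (i - k) * x ^ k)" for i
  proof -
    have "(x + th) ^ i = (\<Sum>k\<le>i. real (i choose k) * x ^ k * th ^ (i - k))" by (rule binomial_ring)
    also have "{..i} = insert i {..<i}" by auto
    finally show ?thesis by (simp add: ac_simps)
  qed
  have "poly g (x + th) - poly g x = (\<Sum>i\<le>N. coeff g i * ((x + th) ^ i - x ^ i))"
    by (simp add: poly_sum_upto[OF assms] right_diff_distrib sum_subtractf)
  then show ?thesis unfolding e shift_mean_def
    by (simp add: sum_subtractf right_diff_distrib)
qed

text \<open>The translation identity: E q(\<xi> + \<theta>) is the sum of a_l \<theta>^l / sqrt(l!).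
  It follows from l = i - k in the binomial expansion; the term l = 0 is the subtracted E
  q(\<xi>).\<close>

lemma shift_mean_hermite:
  assumes "degree q \<le> N"
  shows "shift_mean N q th = (\<Sum>l=1..N. hermite_coeff (poly q) l * th ^ l / sqrt (fact l))"
proof -
  let ?H = "\<lambda>i l. if l \<le> i then fact i / fact (i - l) * gmom (i - l) else 0"
  have inner: "(\<Sum>k<i. real (i choose k) * th ^ (i - k) * gmom k) = (\<Sum>l=1..N. ?H i l * th ^ l / fact l)"
    if i: "i \<le> N" for i
  proof -
    have "(\<Sum>l=1..N. ?H i l * th ^ l / fact l) = (\<Sum>l=1..i. ?H i l * th ^ l / fact l)"
      using i by (intro sum.mono_neutral_right) auto
    also have "\<dots> = (\<Sum>k<i. real (i choose k) * th ^ (i - k) * gmom k)"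
    proof (rule sum.reindex_bij_witness[of _ "\<lambda>k. i - k" "\<lambda>l. i - l"])
      fix l assume l: "l \<in> {1..i}"
      have "real (i choose (i - l)) = fact i / (fact (i - l) * fact (i - (i - l)))"
        by (rule binomial_fact) simp
      then show "real (i choose (i - l)) * th ^ (i - (i - l)) * gmom (i - l) = ?H i l * th ^ l / fact l"
        using l by simp
    qed auto
    finally show ?thesis by simp
  qed
  have "shift_mean N q th = (\<Sum>i\<le>N. \<Sum>l=1..N. coeff q i * (?H i l * th ^ l / fact l))"
    unfolding shift_mean_def by (intro sum.cong refl) (simp only: inner atMost_iff sum_distrib_left)
  also have "\<dots> = (\<Sum>l=1..N. \<Sum>i\<le>N. coeff q i * (?H i l * th ^ l / fact l))"
    by (rule sum.swap)
  also have "\<dots> = (\<Sum>l=1..N. hermite_coeff (poly q) l * th ^ l / sqrt (fact l))"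
  proof (intro sum.cong refl)
    fix l
    have "sqrt (fact l) * sqrt (fact l) = (fact l :: real)" by simp
    then have f: "x / sqrt (fact l) * y / sqrt (fact l) = x * (y / fact l)" for x y :: real
      by (simp add: divide_divide_eq_left)
    show "(\<Sum>i\<le>N. coeff q i * (?H i l * th ^ l / fact l)) = hermite_coeff (poly q) l * th ^ l / sqrt (fact l)"
      unfolding hermite_coeff_poly[OF assms] f sum_distrib_right by (simp add: mult.assoc)
  qed
  finally show ?thesis .
qed

lemma shift_mean_linear_part:
  "1 \<le> N \<Longrightarrow> shift_mean N (q - [:0, a:]) th = shift_mean N q th - a * th"
proof -
  assume N: "1 \<le> N"
  let ?s = "\<lambda>i. (\<Sum>k<i. real (i choose k) * th ^ (i - k) * gmom k)"
  have "coeff [:0, a:] i = (if i = 1 then a else 0)" for i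
    by (auto simp: coeff_pCons split: nat.split)
  then have "shift_mean N (q - [:0, a:]) th = shift_mean N q th - (\<Sum>i\<le>N. (if i = 1 then a else 0) * ?s i)"
    by (simp only: shift_mean_def coeff_diff left_diff_distrib sum_subtractf)
  also have "(\<Sum>i\<le>N. (if i = 1 then a else 0) * ?s i) = (\<Sum>i\<le>N. if i = 1 then a * th else 0)"
    by (intro sum.cong refl) (auto simp: gmom_0)
  finally show ?thesis using N by simp
qed

text \<open>Parity does the work: only odd l survive, so s^l = s and the sign factors out of the
  whole sum. The linear term is removed by the centering and l = 2 by parity, so the series begins
  at l = 3. With b = m / sqrt n and v_i v_j = s / m the shift is \<theta>, and the identity is exact
  for every n.\<close>

lemma tau_eq_shift_mean:
  assumes odd: "\<And>x. poly q (- x) = - poly q x" and b: "0 < b" and s: "s = 1 \<or> s = - 1"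
  shows "shift_mean (degree q + 3) (q - [:0, hermite_coeff (poly q) 1:]) ((lam - 1) * s / b) = s / b * tau (poly q) b lam"
proof -
  \<comment> \<open>Matches the index k + 3 in \<open>tau\<close>: k up to the degree covers l from
    3 to N, and the coefficients beyond the degree vanish.\<close>
  define N where "N = degree q + 3"
  define a where "a = hermite_coeff (poly q)"
  define th where "th = (lam - 1) * s / b"
  let ?t = "\<lambda>l. a l * th ^ l / sqrt (fact l)"
  have dN: "degree q \<le> N" by (simp add: N_def)
  have a2: "a l = 0" if "even l" for l unfolding a_def by (rule hermite_coeff_even[OF odd that])
  have abig: "a l = 0" if "degree q < l" for l
    unfolding a_def hermite_coeff_poly[OF order_refl] using that by (simp add: sum.neutral)
  have "{1..N} = insert 1 (insert 2 {3..N})" by (auto simp: N_def)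
  then have "(\<Sum>l=1..N. ?t l) = ?t 1 + (?t 2 + (\<Sum>l=3..N. ?t l))" by simp
  also have "?t 2 = 0" by (simp add: a2)
  finally have sm: "shift_mean N (q - [:0, a 1:]) th = (\<Sum>l=3..N. ?t l)"
    using shift_mean_hermite[OF dN, of th] by (subst shift_mean_linear_part) (auto simp: N_def a_def)
  have "tau (poly q) b lam = (\<Sum>k\<le>degree q. a (k + 3) * (lam - 1) ^ (k + 3) / (sqrt (fact (k + 3)) * b ^ (k + 3 - 1)))"
    unfolding tau_def Let_def a_def[symmetric] by (rule suminf_finite) (auto simp: abig)
  also have "\<dots> = (\<Sum>l=3..N. a l * (lam - 1) ^ l / (sqrt (fact l) * b ^ (l - 1)))"
    using sum.shift_bounds_cl_nat_ivl[of "\<lambda>l. a l * (lam - 1) ^ l / (sqrt (fact l) * b ^ (l - 1))" 0 3 "degree q"]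
    by (simp add: N_def atMost_atLeast0)
  finally have tau: "tau (poly q) b lam = (\<Sum>l=3..N. a l * (lam - 1) ^ l / (sqrt (fact l) * b ^ (l - 1)))" .
  have "?t l = s / b * (a l * (lam - 1) ^ l / (sqrt (fact l) * b ^ (l - 1)))" if "l \<in> {3..N}" for l
  proof (cases "even l")
    case True
    then show ?thesis by (simp add: a2)
  next
    case False
    then have sl: "s ^ l = s" using s by auto
    have bl: "b ^ l = b * b ^ (l - 1)" using that by (cases l) auto
    show ?thesis unfolding th_def power_divide power_mult_distrib sl bl by (simp add: ac_simps)
  qed
  then show ?thesis using sm tau unfolding N_def a_def th_def
    by (simp add: sum_distrib_left)
qed

text \<open>By parts E q' = E \<xi> q = a_1, which is also the derivative of the subtracted linear
  part. It allows the first order term to be written with centered monomials.\<close>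

lemma gauss_mean_pderiv_centered: "gauss_mean (pderiv (q - [:0, hermite_coeff (poly q) 1:])) = 0"
proof -
  define a where "a = hermite_coeff (poly q) 1"
  have "a = gauss_mean ([:0, 1:] * q)"
    unfolding a_def hermite_coeff_def gauss_inner_def gauss_mean_def hermite_1
    by (intro Bochner_Integration.integral_cong) auto
  then have 1: "gauss_mean (pderiv q) = a" by (simp only: gauss_mean_by_parts)
  have "pderiv [:0, a:] = Polynomial.smult a (monom 1 0)" by (simp add: pderiv_pCons monom_0)
  then have "gauss_mean (pderiv [:0, a:]) = a" using gmom_0 by (simp only: gauss_mean_smult gmom_def mult_1_right)
  then show ?thesis using 1 unfolding a_def[symmetric] by (simp only: pderiv_diff gauss_mean_diff)
qed

section \<open>The spiked covariance\<close>

lemma scalar_prod_ip: "x \<in> carrier_vec p \<Longrightarrow> y \<in> carrier_vec p \<Longrightarrow> x \<bullet> y = ip p (\<lambda>i. x $ i) (\<lambda>i. y $ i)"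
  by (auto simp: scalar_prod_def ip_def atLeast0LessThan)

lemma mult_mat_entry: "A \<in> carrier_mat a b \<Longrightarrow> B \<in> carrier_mat b c \<Longrightarrow> i < a \<Longrightarrow> j < c \<Longrightarrow>
    (A * B) $$ (i, j) = (\<Sum>k<b. A $$ (i, k) * B $$ (k, j))"
  by (auto simp: scalar_prod_def atLeast0LessThan intro!: sum.cong)

lemma mult_mat_vec_entry: "A \<in> carrier_mat a b \<Longrightarrow> x \<in> carrier_vec b \<Longrightarrow> i < a \<Longrightarrow>
    (A *\<^sub>v x) $ i = (\<Sum>k<b. A $$ (i, k) * x $ k)"
  by (auto simp: scalar_prod_def atLeast0LessThan intro!: sum.cong)

text \<open>Testing the form with y = A x gives |y|^2 \<le> b |y| |x|. Positivity of
  \<open>p\<close> supplies a unit vector, so the supremum is over a nonempty set.\<close>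

lemma op_norm_le:
  assumes A: "A \<in> carrier_mat p p" and p: "0 < p" and b: "bil_bound p (\<lambda>i j. A $$ (i, j)) b"
  shows "op_norm A \<le> b"
  unfolding op_norm_def
proof (rule cSUP_least)
  have "unit_vec p 0 \<in> {x \<in> carrier_vec (dim_col A). l2_norm_vec x = 1}"
    using A p by (auto simp: l2_norm_vec_def)
  then show "{x \<in> carrier_vec (dim_col A). l2_norm_vec x = 1} \<noteq> {}" by blast
  fix x assume "x \<in> {x \<in> carrier_vec (dim_col A). l2_norm_vec x = 1}"
  then have x: "x \<in> carrier_vec p" "sqrt (ip p (\<lambda>i. x $ i) (\<lambda>i. x $ i)) = 1"
    using A by (auto simp: l2_norm_vec_def scalar_prod_ip[of _ p])
  define y where "y = A *\<^sub>v x"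
  have y: "y \<in> carrier_vec p" using A x by (auto simp: y_def)
  let ?yy = "ip p (\<lambda>i. y $ i) (\<lambda>i. y $ i)"
  have "?yy = (\<Sum>i<p. \<Sum>j<p. y $ i * A $$ (i, j) * x $ j)"
    unfolding ip_def
  proof (intro sum.cong refl)
    fix i assume "i \<in> {..<p}"
    then have "y $ i = (\<Sum>k<p. A $$ (i, k) * x $ k)"
      unfolding y_def using A x by (intro mult_mat_vec_entry) auto
    then show "y $ i * y $ i = (\<Sum>j<p. y $ i * A $$ (i, j) * x $ j)"
      by (simp add: sum_distrib_left mult.assoc)
  qed
  then have "?yy \<le> b * (sqrt ?yy * sqrt (ip p (\<lambda>i. x $ i) (\<lambda>i. x $ i)))"
    using bil_boundD[OF b, of "\<lambda>i. y $ i" "\<lambda>i. x $ i"] by linarith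
  then have le: "sqrt ?yy * sqrt ?yy \<le> b * sqrt ?yy"
    using x ip_self_nonneg[of p "\<lambda>i. y $ i"] by simp
  have b0: "0 \<le> b"
    using bil_boundD[OF b, of "\<lambda>i. x $ i" "\<lambda>i. x $ i"] x by simp
  have "sqrt ?yy \<le> b"
  proof (cases "sqrt ?yy = 0")
    case True
    then show ?thesis using b0 by simp
  next
    case False
    then have "0 < sqrt ?yy" using ip_self_nonneg[of p "\<lambda>i. y $ i"] by simp
    then show ?thesis using le mult_right_le_imp_le by blast
  qed
  then show "l2_norm_vec (A *\<^sub>v x) \<le> b"
    unfolding y_def[symmetric] l2_norm_vec_def scalar_prod_ip[OF y y] .
qed

definition spike_root :: "real \<Rightarrow> real vec \<Rightarrow> real mat" where
  "spike_root c v = mat (dim_vec v) (dim_vec v) (\<lambda>(i, j). (if i = j then 1 else 0) + c * (v $ i * v $ j))"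

lemma spike_root_mult_left:
  assumes v: "v \<in> carrier_vec p" and B: "B \<in> carrier_mat p r" and i: "i < p" "j < r"
  shows "(spike_root c v * B) $$ (i, j) = B $$ (i, j) + c * v $ i * (\<Sum>k<p. v $ k * B $$ (k, j))"
proof -
  have "(spike_root c v * B) $$ (i, j) = (\<Sum>k<p. spike_root c v $$ (i, k) * B $$ (k, j))"
    using v B i by (intro mult_mat_entry) (auto simp: spike_root_def)
  also have "\<dots> = (\<Sum>k<p. (if k = i then B $$ (k, j) else 0) + c * v $ i * (v $ k * B $$ (k, j)))"
    using v i by (intro sum.cong refl) (auto simp: spike_root_def algebra_simps)
  also have "\<dots> = B $$ (i, j) + c * v $ i * (\<Sum>k<p. v $ k * B $$ (k, j))"
    using i by (simp add: sum.distrib sum_distrib_left)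
  finally show ?thesis .
qed

lemma spike_root_mult_right:
  assumes v: "v \<in> carrier_vec p" and B: "B \<in> carrier_mat r p" and i: "i < r" "j < p"
  shows "(B * spike_root c v) $$ (i, j) = B $$ (i, j) + c * v $ j * (\<Sum>k<p. B $$ (i, k) * v $ k)"
proof -
  have "(B * spike_root c v) $$ (i, j) = (\<Sum>k<p. B $$ (i, k) * spike_root c v $$ (k, j))"
    using v B i by (intro mult_mat_entry) (auto simp: spike_root_def)
  also have "\<dots> = (\<Sum>k<p. (if k = j then B $$ (i, k) else 0) + c * v $ j * (B $$ (i, k) * v $ k))"
    using v i by (intro sum.cong refl) (auto simp: spike_root_def algebra_simps)
  also have "\<dots> = B $$ (i, j) + c * v $ j * (\<Sum>k<p. B $$ (i, k) * v $ k)"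
    using i by (simp add: sum.distrib sum_distrib_left)
  finally show ?thesis .
qed

text \<open>A positive semidefinite root R of \<open>\<Sigma>\<close> commutes with \<open>Q = I + c v v\<^sup>T\<close>, a polynomial in \<open>\<Sigma>\<close>;
  hence \<open>(R + Q) (R - Q) = 0\<close>, and \<open>R + Q \<ge> I\<close> is injective.\<close>
lemma psd_sqrt_spiked_cov:
  assumes v: "v \<in> carrier_vec p" and unit: "ip p (\<lambda>i. v $ i) (\<lambda>i. v $ i) = 1" and lam: "1 \<le> lam"
  shows "psd_sqrt (spiked_cov lam v) = spike_root (sqrt lam - 1) v"
proof -
  define c where "c = sqrt lam - 1"
  define Q where "Q = spike_root c v"
  define Sg where "Sg = spiked_cov lam v"
  have c0: "0 \<le> c" using lam by (simp add: c_def)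
  have lamc: "lam - 1 = 2 * c + c * c" using lam by (simp add: c_def algebra_simps)
  have Q: "Q \<in> carrier_mat p p" using v by (auto simp: Q_def spike_root_def)
  have Sg: "Sg \<in> carrier_mat p p" using v by (auto simp: Sg_def spiked_cov_def outer_prod_def)
  have Sgij: "Sg $$ (i, j) = (if i = j then 1 else 0) + (lam - 1) * (v $ i * v $ j)" if "i < p" "j < p" for i j
    using v that by (auto simp: Sg_def spiked_cov_def outer_prod_def)
  have Qij: "Q $$ (i, j) = (if i = j then 1 else 0) + c * (v $ i * v $ j)" if "i < p" "j < p" for i j
    using v that by (auto simp: Q_def spike_root_def)
  have unit': "(\<Sum>k<p. v $ k * v $ k) = 1" using unit by (simp add: ip_def)
  have vQ: "(\<Sum>k<p. v $ k * Q $$ (k, j)) = v $ j + c * v $ j" if j: "j < p" for j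
  proof -
    have "(\<Sum>k<p. v $ k * Q $$ (k, j)) = (\<Sum>k<p. (if k = j then v $ k else 0) + c * v $ j * (v $ k * v $ k))"
      using j by (intro sum.cong refl) (auto simp: Qij algebra_simps)
    then show ?thesis using j by (simp add: sum.distrib sum_distrib_left[symmetric] unit')
  qed
  have QQ: "Q * Q = Sg"
  proof (rule eq_matI)
    fix i j assume "i < dim_row Sg" "j < dim_col Sg"
    then have ij: "i < p" "j < p" using Sg by auto
    have "(Q * Q) $$ (i, j) = Q $$ (i, j) + c * v $ i * (v $ j + c * v $ j)"
      using spike_root_mult_left[OF v Q ij, of c] vQ[OF ij(2)] by (simp add: Q_def)
    then show "(Q * Q) $$ (i, j) = Sg $$ (i, j)"
      unfolding Qij[OF ij] Sgij[OF ij] lamc by (simp add: algebra_simps)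
  qed (use Q Sg in auto)
  have Qquad: "x \<bullet> x \<le> x \<bullet> (Q *\<^sub>v x)" if x: "x \<in> carrier_vec p" for x
  proof -
    have Qx: "(Q *\<^sub>v x) $ i = x $ i + c * v $ i * (\<Sum>k<p. v $ k * x $ k)" if i: "i < p" for i
    proof -
      have "(Q *\<^sub>v x) $ i = (\<Sum>k<p. (if k = i then x $ k else 0) + c * v $ i * (v $ k * x $ k))"
        unfolding mult_mat_vec_entry[OF Q x i]
        using i by (intro sum.cong refl) (auto simp: Qij algebra_simps)
      then show ?thesis using i by (simp add: sum.distrib sum_distrib_left[symmetric])
    qed
    have "x \<bullet> (Q *\<^sub>v x) = (\<Sum>i<p. x $ i * (x $ i + c * v $ i * (\<Sum>k<p. v $ k * x $ k)))"
    proof -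
      have "x \<bullet> (Q *\<^sub>v x) = ip p (\<lambda>i. x $ i) (\<lambda>i. (Q *\<^sub>v x) $ i)"
        using x Q by (intro scalar_prod_ip) auto
      also have "\<dots> = (\<Sum>i<p. x $ i * (x $ i + c * v $ i * (\<Sum>k<p. v $ k * x $ k)))"
        unfolding ip_def by (intro sum.cong refl) (simp only: Qx lessThan_iff)
      finally show ?thesis .
    qed
    also have "\<dots> = (\<Sum>i<p. x $ i * x $ i) + c * ((\<Sum>k<p. v $ k * x $ k) * (\<Sum>k<p. v $ k * x $ k))"
      by (simp add: distrib_left sum.distrib sum_distrib_left sum_distrib_right ac_simps)
    also have "(\<Sum>i<p. x $ i * x $ i) = x \<bullet> x" using x by (simp add: scalar_prod_ip[of _ p] ip_def)
    finally show ?thesis using c0 by simp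
  qed
  have xx: "0 \<le> x \<bullet> x" if "x \<in> carrier_vec p" for x :: "real vec"
    using that by (simp add: scalar_prod_ip[of _ p] ip_self_nonneg)
  have Qsym: "Q\<^sup>T = Q"
    using Q by (intro eq_matI) (auto simp: Qij ac_simps)
  have psdQ: "pos_semidef Q"
    unfolding pos_semidef_def
  proof (intro conjI ballI)
    show "Q\<^sup>T = Q" by (rule Qsym)
    fix x :: "real vec" assume "x \<in> carrier_vec (dim_col Q)"
    then have "x \<in> carrier_vec p" using Q by auto
    then show "0 \<le> x \<bullet> (Q *\<^sub>v x)" using Qquad[of x] xx[of x] by linarith
  qed
  have uniq: "R = Q" if R: "pos_semidef R" "R * R = Sg" for R
  proof -
    have "dim_row (R * R) = p" "dim_col (R * R) = p" using R Sg by auto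
    then have Rc: "R \<in> carrier_mat p p" by auto
    \<comment> \<open>The coefficient in Q = d \<Sigma> + (1 - d) I. For lam = 1 also c = 0, and
      both matrices are the identity.\<close>
    define d where "d = (if lam = 1 then 0 else c / (lam - 1))"
    have dc: "d * (lam - 1) = c" by (auto simp: d_def c_def)
    have Qd: "Q = d \<cdot>\<^sub>m Sg + (1 - d) \<cdot>\<^sub>m 1\<^sub>m p"
    proof (rule eq_matI)
      fix i j assume "i < dim_row (d \<cdot>\<^sub>m Sg + (1 - d) \<cdot>\<^sub>m 1\<^sub>m p)" "j < dim_col (d \<cdot>\<^sub>m Sg + (1 - d) \<cdot>\<^sub>m 1\<^sub>m p)"
      then have ij: "i < p" "j < p" using Sg by auto
      show "Q $$ (i, j) = (d \<cdot>\<^sub>m Sg + (1 - d) \<cdot>\<^sub>m 1\<^sub>m p) $$ (i, j)"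
        using ij Sg unfolding Qij[OF ij] by (simp add: Sgij[OF ij] dc[symmetric] algebra_simps)
    qed (use Q Sg in auto)
    have comm: "R * Sg = Sg * R"
      unfolding R(2)[symmetric] using Rc by (simp add: assoc_mult_mat[of _ p p _ p _ p])
    have "R * Q = d \<cdot>\<^sub>m (R * Sg) + (1 - d) \<cdot>\<^sub>m R"
      unfolding Qd using Rc Sg
      by (simp add: mult_add_distrib_mat[of _ p p _ p] mult_smult_distrib[of _ p p _ p])
    moreover have "Q * R = d \<cdot>\<^sub>m (Sg * R) + (1 - d) \<cdot>\<^sub>m R"
      unfolding Qd using Rc Sg
      by (simp add: add_mult_distrib_mat[of _ p p _ _ p] mult_smult_assoc_mat[of _ p p _ p])
    ultimately have RQ: "R * Q = Q * R" using comm by simp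
    have zero: "(R + Q) * (R - Q) = 0\<^sub>m p p"
    proof -
      have "(R + Q) * (R - Q) = R * (R - Q) + Q * (R - Q)"
        by (rule add_mult_distrib_mat[of _ p p _ _ p]) (use Rc Q in auto)
      also have "R * (R - Q) = R * R - R * Q"
        by (rule mult_minus_distrib_mat[OF Rc Rc Q])
      also have "Q * (R - Q) = Q * R - Q * Q"
        by (rule mult_minus_distrib_mat[OF Q Rc Q])
      also have "R * R - R * Q + (Q * R - Q * Q) = Sg - Q * R + (Q * R - Sg)"
        by (simp only: RQ QQ R(2))
      also have "\<dots> = 0\<^sub>m p p"
        using Rc Q Sg mult_carrier_mat[OF Q Rc] by (intro eq_matI) (auto simp del: index_mult_mat(1))
      finally show ?thesis .
    qed
    have fixed: "(R - Q) *\<^sub>v x = 0\<^sub>v p" if x: "x \<in> carrier_vec p" for x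
    proof -
      define y where "y = (R - Q) *\<^sub>v x"
      have y: "y \<in> carrier_vec p"
        unfolding y_def by (rule mult_mat_vec_carrier[of _ p p]) (use Rc Q x in auto)
      have "(R + Q) *\<^sub>v y = ((R + Q) * (R - Q)) *\<^sub>v x"
        unfolding y_def by (rule assoc_mult_mat_vec[symmetric, of _ p p _ p]) (use Rc Q x in auto)
      also have "\<dots> = 0\<^sub>v p" unfolding zero using x by auto
      finally have "y \<bullet> ((R + Q) *\<^sub>v y) = 0" using y by simp
      then have "y \<bullet> (R *\<^sub>v y) + y \<bullet> (Q *\<^sub>v y) = 0"
        using Rc Q y by (simp add: add_mult_distrib_mat_vec[of _ p p] scalar_prod_add_distrib[of _ p])
      moreover have "0 \<le> y \<bullet> (R *\<^sub>v y)" using R(1) Rc y by (auto simp: pos_semidef_def)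
      ultimately have "y \<bullet> y = 0" using Qquad[OF y] xx[OF y] by linarith
      then have "(\<Sum>i<p. y $ i * y $ i) = 0" using y by (simp add: scalar_prod_ip[of _ p] ip_def)
      then have "\<forall>i<p. y $ i * y $ i = 0" by (subst (asm) sum_nonneg_eq_0_iff) auto
      then show ?thesis unfolding y_def[symmetric] using y by (intro eq_vecI) auto
    qed
    show ?thesis
    proof (rule eq_matI)
      fix i j assume "i < dim_row Q" "j < dim_col Q"
      then have ij: "i < p" "j < p" using Q by auto
      have "((R - Q) *\<^sub>v unit_vec p j) $ i = (R - Q) $$ (i, j)"
        using Rc Q ij by simp
      then have "(R - Q) $$ (i, j) = 0" using fixed[of "unit_vec p j"] ij by simp
      then show "R $$ (i, j) = Q $$ (i, j)" using Rc Q ij by simp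
    qed (use Rc Q in auto)
  qed
  have "psd_sqrt Sg = Q"
    unfolding psd_sqrt_def by (rule the_equality) (use psdQ QQ uniq in blast)+
  then show ?thesis by (simp add: Sg_def Q_def c_def)
qed

lemma white_cov_entry:
  assumes Z: "Z \<in> carrier_mat n p" and n: "0 < n" and ij: "i < p" "j < p"
  shows "sqrt (real n) * white_cov n Z $$ (i, j) = gcov n (\<lambda>x. Z $$ x) i j"
proof -
  have "(Z\<^sup>T * Z) $$ (i, j) = (\<Sum>l<n. Z $$ (l, i) * Z $$ (l, j))"
    using Z ij by (subst mult_mat_entry[of _ p n _ p]) auto
  then have "white_cov n Z $$ (i, j) = (\<Sum>l<n. Z $$ (l, i) * Z $$ (l, j)) / real n"
    using Z ij by (simp add: white_cov_def)
  moreover have "sqrt (real n) * (x / real n) = x / sqrt (real n)" for x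
    using n by (simp add: field_simps)
  ultimately show ?thesis by (simp add: gcov_def)
qed

lemma gcov_commute: "gcov n u i j = gcov n u j i"
  by (simp add: gcov_def mult.commute)

text \<open>Expands Q S Q for Q = I + c v v^T. Here \<open>s\<close> is the vector sqrt n S v, which
  by symmetry of S serves on both sides.\<close>

lemma sample_cov_entry:
  assumes Z: "Z \<in> carrier_mat n p" and n: "0 < n" and ij: "i < p" "j < p"
    and v: "v \<in> carrier_vec p" and unit: "ip p (\<lambda>i. v $ i) (\<lambda>i. v $ i) = 1" and lam: "1 \<le> lam"
  defines "X \<equiv> gcov n (\<lambda>x. Z $$ x)" and "c \<equiv> sqrt lam - 1"
  defines "s \<equiv> \<lambda>j. \<Sum>k<p. v $ k * X k j"
  shows "sqrt (real n) * sample_cov n lam v Z $$ (i, j)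
    = X i j + c * v $ i * s j + c * v $ j * s i + c * c * v $ i * v $ j * (\<Sum>k<p. v $ k * s k)"
proof -
  define S where "S = white_cov n Z"
  define Q where "Q = spike_root c v"
  have S: "S \<in> carrier_mat p p" using Z by (auto simp: S_def white_cov_def)
  have Q: "Q \<in> carrier_mat p p" using v by (auto simp: Q_def spike_root_def)
  have QS: "Q * S \<in> carrier_mat p p" using Q S by simp
  have SX: "sqrt (real n) * S $$ (a, b) = X a b" if "a < p" "b < p" for a b
    unfolding S_def X_def by (rule white_cov_entry[OF Z n that])
  have QSX: "sqrt (real n) * (Q * S) $$ (i, k) = X i k + c * v $ i * s k" if k: "k < p" for k
  proof -
    have "sqrt (real n) * (Q * S) $$ (i, k)
        = sqrt (real n) * S $$ (i, k) + c * v $ i * (\<Sum>a<p. v $ a * (sqrt (real n) * S $$ (a, k)))"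
      unfolding Q_def spike_root_mult_left[OF v S ij(1) k] by (simp add: sum_distrib_left algebra_simps)
    then show ?thesis using ij k by (simp add: SX s_def)
  qed
  have "sqrt (real n) * sample_cov n lam v Z $$ (i, j) = sqrt (real n) * (Q * S * Q) $$ (i, j)"
    by (simp add: sample_cov_def psd_sqrt_spiked_cov[OF v unit lam] Q_def S_def c_def)
  also have "\<dots> = sqrt (real n) * (Q * S) $$ (i, j)
      + c * v $ j * (\<Sum>k<p. (sqrt (real n) * (Q * S) $$ (i, k)) * v $ k)"
    unfolding Q_def spike_root_mult_right[OF v QS[unfolded Q_def] ij] by (simp add: sum_distrib_left algebra_simps)
  also have "\<dots> = X i j + c * v $ i * s j + c * v $ j * (\<Sum>k<p. (X i k + c * v $ i * s k) * v $ k)"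
    using ij by (simp add: QSX)
  also have "(\<Sum>k<p. (X i k + c * v $ i * s k) * v $ k) = s i + c * v $ i * (\<Sum>k<p. v $ k * s k)"
  proof -
    have "s i = (\<Sum>k<p. X i k * v $ k)"
      unfolding s_def X_def by (intro sum.cong refl) (simp add: gcov_commute[of n _ i] mult.commute)
    then show ?thesis
      by (simp add: sum.distrib sum_distrib_left algebra_simps)
  qed
  finally show ?thesis by (simp add: algebra_simps)
qed

section \<open>The deterministic error bound\<close>

definition centered_poly :: "real poly \<Rightarrow> real poly" where
  "centered_poly q = q - [:0, hermite_coeff (poly q) 1:]"

text \<open>Later T is a small power of n and \<open>Kap\<close> the loss in the norm bounds for the two centered kernel
  blocks. The constants \<open>CL\<close>, \<open>dL\<close>, \<open>CS\<close>, \<open>dS\<close> are parameters so that the final constant \<open>Ctot\<close>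
  visibly does not depend on n.\<close>
locale spiked_setup =
  fixes q :: "real poly" and lam b0 b1 G CL CS :: real and dL dS :: nat
    and n p m :: nat and v :: "nat \<Rightarrow> real" and u :: "nat \<times> nat \<Rightarrow> real" and T Kap r :: real
  assumes odd: "\<And>x. poly q (- x) = - poly q x" and lam: "1 \<le> lam"
    and b0: "0 < b0" and b1: "0 \<le> b1" and G: "0 \<le> G" and CL: "0 \<le> CL" and CS: "0 \<le> CS"
    and lip: "\<And>S x y. 1 \<le> S \<Longrightarrow> \<bar>x\<bar> \<le> S \<Longrightarrow> \<bar>y\<bar> \<le> S \<Longrightarrow>
      \<bar>poly (centered_poly q) x - poly (centered_poly q) y\<bar> \<le> CL * S ^ dL * \<bar>x - y\<bar>"
    and second: "\<And>S x h. 1 \<le> S \<Longrightarrow> \<bar>x\<bar> \<le> S \<Longrightarrow> \<bar>x + h\<bar> \<le> S \<Longrightarrow>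
      \<bar>poly (centered_poly q) (x + h) - poly (centered_poly q) x - poly (pderiv (centered_poly q)) x * h\<bar>
        \<le> CS * S ^ dS * h\<^sup>2"
    and r: "1 \<le> r" "r\<^sup>2 = sqrt (real n)"
    and m: "1 \<le> m" "m \<le> p" "b0 * r\<^sup>2 \<le> real m" "real m \<le> b1 * r\<^sup>2" and p: "real p \<le> G * r ^ 4"
    and v: "\<And>i. i < m \<Longrightarrow> \<bar>v i\<bar> = 1 / sqrt (real m)" "\<And>i. m \<le> i \<Longrightarrow> i < p \<Longrightarrow> v i = 0"
    and T: "1 \<le> T" and Kap: "1 \<le> Kap"
    and iso: "near_iso n T p u"
    and e: "\<And>i. i < p \<Longrightarrow> \<bar>(\<Sum>k<p. v k * gcov n u k i) - r\<^sup>2 * v i\<bar> \<le> T"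
    and e0: "\<bar>(\<Sum>k<p. v k * (\<Sum>l<p. v l * gcov n u l k)) - r\<^sup>2\<bar> \<le> T"
    and low: "\<And>k. k \<le> degree q + 3 \<Longrightarrow>
      bil_bound p (\<lambda>i j. if j < i \<and> i < m then gcov n u i j ^ k - gmom k else 0) (r * Kap)"
    and tall: "\<And>k. k \<le> degree q + 3 \<Longrightarrow>
      bil_bound p (\<lambda>i j. if m \<le> i \<and> j < m then gcov n u i j ^ k - gmom k else 0) (r\<^sup>2 * Kap)"
begin

abbreviation g :: "real poly" where "g \<equiv> centered_poly q"
abbreviation N :: nat where "N \<equiv> degree q + 3"
abbreviation X :: "nat \<Rightarrow> nat \<Rightarrow> real" where "X \<equiv> gcov n u"

text \<open>The fluctuations of sqrt n S v around sqrt n v and of sqrt n v^T S v around sqrt n. With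
  c = sqrt lam - 1 the centers contribute (2 c + c^2) r^2 v_i v_j to the sample covariance, which is
  \<open>th\<close> because 2 c + c^2 = lam - 1; the fluctuations form \<open>de\<close>.\<close>

definition ex :: "nat \<Rightarrow> real" where "ex i = (\<Sum>k<p. v k * X k i) - r\<^sup>2 * v i"
definition ex0 :: real where "ex0 = (\<Sum>k<p. v k * (\<Sum>l<p. v l * X l k)) - r\<^sup>2"
definition th :: "nat \<Rightarrow> nat \<Rightarrow> real" where "th i j = (lam - 1) * r\<^sup>2 * (v i * v j)"
definition de :: "nat \<Rightarrow> nat \<Rightarrow> real" where
  "de i j = (sqrt lam - 1) * (v i * ex j + v j * ex i) + (sqrt lam - 1)\<^sup>2 * (v i * v j * ex0)"

text \<open>Constants in the scale r = n^(1/4): |v_i| \<le> cv / r, |th| \<le> th0, |de| \<le> cd T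
  / r, and off the diagonal all arguments of \<open>g\<close> lie within CT T.\<close>

definition cv :: real where "cv = 1 / sqrt b0"
definition th0 :: real where "th0 = (lam - 1) / b0"
definition cd :: real where "cd = 2 * (sqrt lam - 1) * cv + (sqrt lam - 1)\<^sup>2 * cv\<^sup>2"
definition CT :: real where "CT = 1 + th0 + cd"

lemma kap_nonneg: "0 \<le> sqrt lam - 1"
  using lam by simp

lemma const_bounds: "0 \<le> cv" "0 \<le> th0" "0 \<le> cd" "1 \<le> CT"
proof -
  show "0 \<le> cv" using b0 by (simp add: cv_def)
  show "0 \<le> th0" using b0 lam by (simp add: th0_def)
  show "0 \<le> cd" using kap_nonneg \<open>0 \<le> cv\<close> by (simp add: cd_def)
  then show "1 \<le> CT" using \<open>0 \<le> th0\<close> by (simp add: CT_def)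
qed

lemma r_pos: "0 < r" using r by linarith

lemma v_le_sqrt: "i < p \<Longrightarrow> \<bar>v i\<bar> \<le> 1 / sqrt (real m)"
  using v[of i] by (cases "i < m") auto

lemma v_le: "i < p \<Longrightarrow> \<bar>v i\<bar> \<le> cv / r"
proof -
  assume i: "i < p"
  have "1 / sqrt (real m) \<le> 1 / sqrt (b0 * r\<^sup>2)"
    using m b0 r_pos by (intro divide_left_mono real_sqrt_le_mono mult_pos_pos) auto
  also have "\<dots> = cv / r" using r_pos by (simp add: cv_def real_sqrt_mult)
  finally show ?thesis using v_le_sqrt[OF i] by linarith
qed

lemma rm_le: "(lam - 1) * r\<^sup>2 * (1 / real m) \<le> th0" "0 \<le> (lam - 1) * r\<^sup>2 * (1 / real m)"
proof -
  have "r\<^sup>2 / real m \<le> 1 / b0" using m b0 by (simp add: field_simps)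
  then have "(lam - 1) * (r\<^sup>2 / real m) \<le> (lam - 1) * (1 / b0)" using lam by (intro mult_left_mono) auto
  then show "(lam - 1) * r\<^sup>2 * (1 / real m) \<le> th0" by (simp add: th0_def)
  show "0 \<le> (lam - 1) * r\<^sup>2 * (1 / real m)" using lam by simp
qed

lemma th_le: "i < p \<Longrightarrow> j < p \<Longrightarrow> \<bar>th i j\<bar> \<le> th0"
proof -
  assume i: "i < p" and j: "j < p"
  have "\<bar>v i\<bar> * \<bar>v j\<bar> \<le> (1 / sqrt (real m)) * (1 / sqrt (real m))"
    by (intro mult_mono v_le_sqrt i j) auto
  also have "\<dots> = 1 / real m" by simp
  finally have "(lam - 1) * r\<^sup>2 * (\<bar>v i\<bar> * \<bar>v j\<bar>) \<le> (lam - 1) * r\<^sup>2 * (1 / real m)"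
    using lam by (intro mult_left_mono) auto
  also have "(lam - 1) * r\<^sup>2 * (\<bar>v i\<bar> * \<bar>v j\<bar>) = \<bar>th i j\<bar>"
    using lam by (simp add: th_def abs_mult)
  finally show ?thesis using rm_le(1) by linarith
qed

lemma ex_le: "i < p \<Longrightarrow> \<bar>ex i\<bar> \<le> T" "\<bar>ex0\<bar> \<le> T"
  using e e0 by (auto simp: ex_def ex0_def)

lemma de_le: "i < p \<Longrightarrow> j < p \<Longrightarrow> \<bar>de i j\<bar> \<le> cd * T / r"
proof -
  assume i: "i < p" and j: "j < p"
  have a: "\<bar>v k * ex l\<bar> \<le> cv / r * T" if "k < p" "l < p" for k l
    unfolding abs_mult using that v_le ex_le const_bounds r_pos by (intro mult_mono) auto
  have b: "\<bar>v i * v j * ex0\<bar> \<le> cv\<^sup>2 / r * T"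
  proof -
    have "\<bar>v i * v j * ex0\<bar> \<le> (cv / r) * (cv / r) * T"
      unfolding abs_mult using v_le i j ex_le const_bounds r_pos by (intro mult_mono) auto
    also have "\<dots> = cv\<^sup>2 * T / (r * r)" by (simp add: power2_eq_square)
    also have "\<dots> \<le> cv\<^sup>2 * T / (r * 1)"
      using r r_pos T by (intro divide_left_mono mult_left_mono mult_pos_pos mult_nonneg_nonneg) auto
    finally show ?thesis by simp
  qed
  have "\<bar>de i j\<bar> \<le> (sqrt lam - 1) * (\<bar>v i * ex j\<bar> + \<bar>v j * ex i\<bar>) + (sqrt lam - 1)\<^sup>2 * \<bar>v i * v j * ex0\<bar>"
    unfolding de_def using kap_nonneg
    by (intro order_trans[OF abs_triangle_ineq] add_mono) (auto simp: abs_mult intro!: mult_left_mono order_trans[OF abs_triangle_ineq])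
  also have "\<dots> \<le> (sqrt lam - 1) * (cv / r * T + cv / r * T) + (sqrt lam - 1)\<^sup>2 * (cv\<^sup>2 / r * T)"
    using a[OF i j] a[OF j i] b kap_nonneg by (intro add_mono mult_left_mono) auto
  also have "\<dots> = cd * T / r" by (simp add: cd_def add_divide_distrib diff_divide_distrib algebra_simps)
  finally show ?thesis .
qed

lemma de_le_T: "i < p \<Longrightarrow> j < p \<Longrightarrow> \<bar>de i j\<bar> \<le> cd * T"
proof -
  assume "i < p" "j < p"
  then have "\<bar>de i j\<bar> \<le> cd * T / r" by (rule de_le)
  also have "\<dots> \<le> cd * T / 1" using r const_bounds T by (intro divide_left_mono) auto
  finally show ?thesis by simp
qed

lemma X_le: "i < p \<Longrightarrow> j < p \<Longrightarrow> i \<noteq> j \<Longrightarrow> \<bar>X i j\<bar> \<le> T"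
  using iso by (auto simp: near_iso_def)

lemma th0_le: "th0 \<le> th0 * T"
  using mult_left_mono[OF T const_bounds(2)] by simp

lemma args_le:
  assumes "i < p" "j < p" "i \<noteq> j"
  shows "1 \<le> CT * T" "\<bar>X i j\<bar> \<le> CT * T" "\<bar>X i j + th i j\<bar> \<le> CT * T" "\<bar>X i j + de i j\<bar> \<le> CT * T"
    "\<bar>X i j + th i j + de i j\<bar> \<le> CT * T"
proof -
  have CT: "CT * T = T + th0 * T + cd * T" by (simp add: CT_def algebra_simps)
  have "0 \<le> th0 * T" "0 \<le> cd * T" using const_bounds T by auto
  then show "1 \<le> CT * T" "\<bar>X i j\<bar> \<le> CT * T" "\<bar>X i j + th i j\<bar> \<le> CT * T" "\<bar>X i j + de i j\<bar> \<le> CT * T"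
    "\<bar>X i j + th i j + de i j\<bar> \<le> CT * T"
    unfolding CT using T X_le[OF assms] th_le[OF assms(1,2)] de_le_T[OF assms(1,2)] th0_le by linarith+
qed

lemma sym: "X i j = X j i" "th i j = th j i" "de i j = de j i"
  by (simp_all add: gcov_commute[of n u i j] th_def de_def ac_simps)

lemma outside: "m \<le> i \<Longrightarrow> i < p \<Longrightarrow> th i j = 0" "m \<le> i \<Longrightarrow> i < p \<Longrightarrow> de i j = (sqrt lam - 1) * (v j * ex i)"
  using v(2)[of i] by (simp_all add: th_def de_def)

lemma degree_g: "degree g \<le> N"
  unfolding centered_poly_def by (rule degree_diff_le) auto

text \<open>On the block sqrt m v_i and sqrt m v_j are signs, and m / r^2 is \<beta>_n. So the
  rank-one term cancels the Gaussian mean of the shift without remainder.\<close>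

lemma tau_vv: "i < m \<Longrightarrow> j < m \<Longrightarrow> tau (poly q) (real m / r\<^sup>2) lam * (v i * v j) = shift_mean N g (th i j) / r\<^sup>2"
proof -
  assume i: "i < m" and j: "j < m"
  define s where "s = (sqrt (real m) * v i) * (sqrt (real m) * v j)"
  have unit: "sqrt (real m) * v k = 1 \<or> sqrt (real m) * v k = - 1" if "k < m" for k
  proof -
    have "\<bar>sqrt (real m) * v k\<bar> = 1" using v(1)[OF that] m by (simp add: abs_mult)
    then show ?thesis by linarith
  qed
  have s: "s = 1 \<or> s = - 1" using unit[OF i] unit[OF j] by (auto simp: s_def)
  have "s = (sqrt (real m) * sqrt (real m)) * (v i * v j)" by (simp only: s_def ac_simps)
  then have sv: "v i * v j = s / real m" using m by simp
  have b: "0 < real m / r\<^sup>2" using m r_pos by simp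
  have "th i j = (lam - 1) * s / (real m / r\<^sup>2)" by (simp add: th_def sv)
  then have "shift_mean N g (th i j) = s / (real m / r\<^sup>2) * tau (poly q) (real m / r\<^sup>2) lam"
    using tau_eq_shift_mean[OF odd b s] by (simp add: centered_poly_def)
  then show ?thesis using r_pos by (simp add: sv)
qed

section \<open>The five pieces of the error and their norms\<close>

definition lip_err :: "nat \<Rightarrow> nat \<Rightarrow> real" where
  "lip_err i j = (if i < m \<and> j < m \<and> i \<noteq> j then (poly g (X i j + th i j + de i j) - poly g (X i j + th i j)) / r\<^sup>2 else 0)"

text \<open>Counting suffices: up to powers of T the entries are of order r^(-3) on an m x m block
  with m of order r^2.\<close>

lemma lipschitz_part:
  "bil_bound p lip_err (CL * CT ^ dL * cd * b1 * T ^ Suc dL / r)"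
proof -
  define E where "E = CL * (CT * T) ^ dL * (cd * T / r) / r\<^sup>2"
  have E0: "0 \<le> E" using CL const_bounds T r_pos by (simp add: E_def)
  have "bil_bound p lip_err (E * sqrt (real m * real m))"
  proof (rule bil_bound_entries)
    fix i j assume ij: "i < p" "j < p"
    have "\<bar>(poly g (X i j + th i j + de i j) - poly g (X i j + th i j)) / r\<^sup>2\<bar> \<le> E" if "i \<noteq> j"
    proof -
      note a = args_le[OF ij that]
      have "\<bar>poly g (X i j + th i j + de i j) - poly g (X i j + th i j)\<bar> \<le> CL * (CT * T) ^ dL * \<bar>de i j\<bar>"
        using lip[OF a(1) a(5) a(3)] by simp
      also have "\<dots> \<le> CL * (CT * T) ^ dL * (cd * T / r)"
        using CL const_bounds T de_le[OF ij] by (intro mult_left_mono) auto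
      finally show ?thesis unfolding E_def by (simp only: abs_divide abs_power2 divide_right_mono zero_le_power2)
    qed
    then show "\<bar>lip_err i j\<bar> \<le> (if i < m \<and> j < m then E else 0)" using E0 by (auto simp: lip_err_def)
  qed (use m E0 in auto)
  then show ?thesis
  proof (rule bil_bound_mono)
    have "E * sqrt (real m * real m) = E * real m" by simp
    also have "\<dots> \<le> E * (b1 * r\<^sup>2)" using m E0 by (intro mult_left_mono) auto
    also have "\<dots> = CL * CT ^ dL * cd * b1 * T ^ Suc dL / r"
      using r_pos by (simp add: E_def power_mult_distrib field_simps)
    finally show "E * sqrt (real m * real m) \<le> CL * CT ^ dL * cd * b1 * T ^ Suc dL / r" .
  qed
qed

definition CA :: real where
  "CA = (\<Sum>i\<le>N. \<Sum>k<i. \<bar>coeff g i\<bar> * real (i choose k) * th0 ^ (i - k) * 2)"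

definition centered_err :: "nat \<Rightarrow> nat \<Rightarrow> real" where
  "centered_err i j = (if i < m \<and> j < m \<and> i \<noteq> j then (poly g (X i j + th i j) - poly g (X i j) - shift_mean N g (th i j)) / r\<^sup>2 else 0)"

text \<open>Powers of the shift factor over i and j, so each term of
  \<open>poly_shift_centered\<close> is a diagonal scaling of a centered block. The scaling costs
  th0^l, the block has norm of order r Kap, and the kernel divides by r^2.\<close>

lemma centered_part:
  "bil_bound p centered_err (CA * Kap / r)"
proof -
  define off where "off k i j = (if i < m \<and> j < m \<and> i \<noteq> j then X i j ^ k - gmom k else 0)" for k i j
  have rK: "0 \<le> r * Kap" using r_pos Kap by simp
  have off: "bil_bound p (off k) (2 * (r * Kap))" if "k \<le> N" for k
  proof -
    have "bil_bound p (\<lambda>i j. (if j < i \<and> i < m then X i j ^ k - gmom k else 0)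
        + (if i < j \<and> j < m then X j i ^ k - gmom k else 0)) (r * Kap + r * Kap)"
      by (rule bil_bound_add[OF low[OF that] bil_bound_transpose[OF low[OF that]]])
    then show ?thesis unfolding mult_2
      by (rule bil_bound_cong) (auto simp: off_def gcov_commute[of n u])
  qed
  define w where "w = 1 / sqrt (real m)"
  have w0: "0 \<le> w" by (simp add: w_def)
  have ww: "w * w = 1 / real m" by (simp add: w_def)
  have trm: "bil_bound p (\<lambda>i j. (coeff g a * real (a choose k) / r\<^sup>2) * (((lam - 1) * r\<^sup>2) ^ l * (v i ^ l * off k i j * v j ^ l)))
      (\<bar>coeff g a\<bar> * real (a choose k) * th0 ^ l * 2 * (Kap / r))" if k: "k \<le> N" for a k l
  proof -
    have vl: "\<bar>v i ^ l\<bar> \<le> w ^ l" if "i < p" for i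
      unfolding power_abs w_def using v_le_sqrt[OF that] by (intro power_mono) auto
    have 1: "bil_bound p (\<lambda>i j. v i ^ l * off k i j * v j ^ l) (w ^ l * (2 * (r * Kap)) * w ^ l)"
      using rK w0 vl by (intro bil_bound_scale off k) auto
    have "0 \<le> w ^ l * (2 * (r * Kap)) * w ^ l" using rK w0 by simp
    from bil_bound_cmult[OF 1 this, of "((lam - 1) * r\<^sup>2) ^ l"]
    have 2: "bil_bound p (\<lambda>i j. ((lam - 1) * r\<^sup>2) ^ l * (v i ^ l * off k i j * v j ^ l)) (th0 ^ l * (2 * (r * Kap)))"
    proof (rule bil_bound_mono)
      have "\<bar>((lam - 1) * r\<^sup>2) ^ l\<bar> * (w ^ l * (2 * (r * Kap)) * w ^ l)
          = ((lam - 1) * r\<^sup>2 * (w * w)) ^ l * (2 * (r * Kap))"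
        using lam by (simp add: power_mult_distrib abs_mult ac_simps)
      also have "\<dots> \<le> th0 ^ l * (2 * (r * Kap))"
        unfolding ww using rm_le rK by (intro mult_right_mono power_mono) auto
      finally show "\<bar>((lam - 1) * r\<^sup>2) ^ l\<bar> * (w ^ l * (2 * (r * Kap)) * w ^ l) \<le> th0 ^ l * (2 * (r * Kap))" .
    qed
    have "0 \<le> th0 ^ l * (2 * (r * Kap))" using rK const_bounds by simp
    from bil_bound_cmult[OF 2 this, of "coeff g a * real (a choose k) / r\<^sup>2"] show ?thesis
    proof (rule bil_bound_mono)
      have "\<bar>coeff g a * real (a choose k) / r\<^sup>2\<bar> * (th0 ^ l * (2 * (r * Kap)))
          = \<bar>coeff g a\<bar> * real (a choose k) * th0 ^ l * 2 * (Kap * (r / r\<^sup>2))"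
        by (simp add: abs_mult)
      also have "r / r\<^sup>2 = 1 / r" using r_pos by (simp add: power2_eq_square)
      finally show "\<bar>coeff g a * real (a choose k) / r\<^sup>2\<bar> * (th0 ^ l * (2 * (r * Kap)))
          \<le> \<bar>coeff g a\<bar> * real (a choose k) * th0 ^ l * 2 * (Kap / r)" by simp
    qed
  qed
  have "bil_bound p (\<lambda>i j. \<Sum>a\<le>N. \<Sum>k<a. (coeff g a * real (a choose k) / r\<^sup>2)
        * (((lam - 1) * r\<^sup>2) ^ (a - k) * (v i ^ (a - k) * off k i j * v j ^ (a - k))))
      (\<Sum>a\<le>N. \<Sum>k<a. \<bar>coeff g a\<bar> * real (a choose k) * th0 ^ (a - k) * 2 * (Kap / r))"
    by (intro bil_bound_sum trm) auto
  moreover have "(\<Sum>a\<le>N. \<Sum>k<a. \<bar>coeff g a\<bar> * real (a choose k) * th0 ^ (a - k) * 2 * (Kap / r)) = CA * Kap / r"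
    by (simp add: CA_def sum_distrib_right sum_divide_distrib)
  ultimately have "bil_bound p (\<lambda>i j. \<Sum>a\<le>N. \<Sum>k<a. (coeff g a * real (a choose k) / r\<^sup>2)
        * (((lam - 1) * r\<^sup>2) ^ (a - k) * (v i ^ (a - k) * off k i j * v j ^ (a - k)))) (CA * Kap / r)" by simp
  then show ?thesis
  proof (rule bil_bound_cong)
    fix i j
    show "(\<Sum>a\<le>N. \<Sum>k<a. (coeff g a * real (a choose k) / r\<^sup>2)
        * (((lam - 1) * r\<^sup>2) ^ (a - k) * (v i ^ (a - k) * off k i j * v j ^ (a - k))))
      = centered_err i j"
    proof (cases "i < m \<and> j < m \<and> i \<noteq> j")
      case True
      have t: "((lam - 1) * r\<^sup>2) ^ l * (v i ^ l * y * v j ^ l) = th i j ^ l * y" for l y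
        by (simp add: th_def power_mult_distrib ac_simps)
      show ?thesis
        unfolding centered_err_def poly_shift_centered[OF degree_g] t sum_divide_distrib sum_distrib_left
        using True by (simp add: off_def ac_simps)
    next
      case False
      then have "off k i j = 0" for k by (auto simp: off_def)
      then show ?thesis using False by (auto simp: centered_err_def)
    qed
  qed
qed

definition CB :: real where
  "CB = (\<Sum>k\<le>N. \<bar>coeff (pderiv g) k\<bar> * (sqrt lam - 1) * cv)"

definition linear_err :: "nat \<Rightarrow> nat \<Rightarrow> real" where
  "linear_err i j = (if m \<le> i \<and> j < m then poly (pderiv g) (X i j) * de i j / r\<^sup>2 else 0)"

text \<open>Here counting entries fails: size r^(-3) on a p x m block gives order 1. But
  \<open>de\<close> is the diagonal scaling by ex_i and v_j, of size T / r, and since E g' = 0 the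
  factor g' is a combination of centered monomials with block norm r^2 Kap.\<close>

lemma first_order_part:
  "bil_bound p linear_err (CB * T * Kap / r)"
proof -
  define tl where "tl k i j = (if m \<le> i \<and> j < m then X i j ^ k - gmom k else 0)" for k i j
  have dg: "degree (pderiv g) \<le> N" using degree_g by (simp add: degree_pderiv)
  have zero: "(\<Sum>k\<le>N. coeff (pderiv g) k * gmom k) = 0"
    using gauss_mean_coeff[OF dg] gauss_mean_pderiv_centered[of q] by (simp add: centered_poly_def)
  have pd: "poly (pderiv g) x = (\<Sum>k\<le>N. coeff (pderiv g) k * (x ^ k - gmom k))" for x
    using zero by (simp add: poly_sum_upto[OF dg] right_diff_distrib sum_subtractf)
  have rK: "0 \<le> r\<^sup>2 * Kap" using Kap by simp
  have trm: "bil_bound p (\<lambda>i j. (coeff (pderiv g) k * (sqrt lam - 1) / r\<^sup>2) * (ex i * tl k i j * v j))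
      (\<bar>coeff (pderiv g) k\<bar> * (sqrt lam - 1) * cv * (T * Kap / r))" if k: "k \<le> N" for k
  proof -
    have 1: "bil_bound p (\<lambda>i j. ex i * tl k i j * v j) (T * (r\<^sup>2 * Kap) * (cv / r))"
      using rK T ex_le v_le const_bounds r_pos unfolding tl_def by (intro bil_bound_scale tall k) auto
    have "0 \<le> T * (r\<^sup>2 * Kap) * (cv / r)" using rK T const_bounds r_pos by simp
    from bil_bound_cmult[OF 1 this, of "coeff (pderiv g) k * (sqrt lam - 1) / r\<^sup>2"] show ?thesis
    proof (rule bil_bound_mono)
      have "\<bar>coeff (pderiv g) k * (sqrt lam - 1) / r\<^sup>2\<bar> * (T * (r\<^sup>2 * Kap) * (cv / r))
          = \<bar>coeff (pderiv g) k\<bar> * (sqrt lam - 1) * cv * (T * Kap / r)"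
        unfolding abs_divide abs_mult abs_power2 abs_of_nonneg[OF kap_nonneg] using r_pos by simp
      then show "\<bar>coeff (pderiv g) k * (sqrt lam - 1) / r\<^sup>2\<bar> * (T * (r\<^sup>2 * Kap) * (cv / r))
          \<le> \<bar>coeff (pderiv g) k\<bar> * (sqrt lam - 1) * cv * (T * Kap / r)" by (rule eq_refl)
    qed
  qed
  have "bil_bound p (\<lambda>i j. \<Sum>k\<le>N. (coeff (pderiv g) k * (sqrt lam - 1) / r\<^sup>2) * (ex i * tl k i j * v j))
      (\<Sum>k\<le>N. \<bar>coeff (pderiv g) k\<bar> * (sqrt lam - 1) * cv * (T * Kap / r))"
    by (intro bil_bound_sum trm) auto
  moreover have "(\<Sum>k\<le>N. \<bar>coeff (pderiv g) k\<bar> * (sqrt lam - 1) * cv * (T * Kap / r)) = CB * T * Kap / r"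
    by (simp add: CB_def sum_distrib_right sum_divide_distrib mult.assoc)
  ultimately have "bil_bound p (\<lambda>i j. \<Sum>k\<le>N. (coeff (pderiv g) k * (sqrt lam - 1) / r\<^sup>2) * (ex i * tl k i j * v j))
      (CB * T * Kap / r)" by simp
  then show ?thesis
  proof (rule bil_bound_cong)
    fix i j assume i: "i < p"
    show "(\<Sum>k\<le>N. (coeff (pderiv g) k * (sqrt lam - 1) / r\<^sup>2) * (ex i * tl k i j * v j))
      = linear_err i j"
    proof (cases "m \<le> i \<and> j < m")
      case True
      show ?thesis unfolding linear_err_def pd outside(2)[OF conjunct1[OF True] i] sum_distrib_right sum_divide_distrib
        using True by (simp add: tl_def ac_simps)
    next
      case False
      then have "tl k i j = 0" for k by (auto simp: tl_def)
      then show ?thesis using False by (auto simp: linear_err_def)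
    qed
  qed
qed

definition quadratic_err :: "nat \<Rightarrow> nat \<Rightarrow> real" where
  "quadratic_err i j = (if m \<le> i \<and> j < m then (poly g (X i j + de i j) - poly g (X i j) - poly (pderiv g) (X i j) * de i j) / r\<^sup>2 else 0)"

text \<open>Squaring \<open>de\<close> gains the missing factor: entries of order r^(-4) against
  sqrt (p m) of order r^3.\<close>

lemma second_order_part:
  "bil_bound p quadratic_err (CS * CT ^ dS * cd\<^sup>2 * sqrt (G * b1) * T ^ (dS + 2) / r)"
proof -
  define E where "E = CS * (CT * T) ^ dS * (cd * T / r)\<^sup>2 / r\<^sup>2"
  have E0: "0 \<le> E" using CS const_bounds T r_pos by (simp add: E_def)
  have "bil_bound p quadratic_err (E * sqrt (real p * real m))"
  proof (rule bil_bound_entries)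
    fix i j assume ij: "i < p" "j < p"
    have "\<bar>(poly g (X i j + de i j) - poly g (X i j) - poly (pderiv g) (X i j) * de i j) / r\<^sup>2\<bar> \<le> E" if "i \<noteq> j"
    proof -
      note a = args_le[OF ij that]
      have "\<bar>poly g (X i j + de i j) - poly g (X i j) - poly (pderiv g) (X i j) * de i j\<bar> \<le> CS * (CT * T) ^ dS * (de i j)\<^sup>2"
        by (rule second[OF a(1) a(2) a(4)])
      also have "(de i j)\<^sup>2 \<le> (cd * T / r)\<^sup>2"
        using de_le[OF ij] power_mono[of "\<bar>de i j\<bar>" "cd * T / r" 2] by simp
      then have "CS * (CT * T) ^ dS * (de i j)\<^sup>2 \<le> CS * (CT * T) ^ dS * (cd * T / r)\<^sup>2"
        using CS const_bounds T by (intro mult_left_mono) auto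
      finally show ?thesis unfolding E_def by (simp only: abs_divide abs_power2 divide_right_mono zero_le_power2)
    qed
    then show "\<bar>quadratic_err i j\<bar> \<le> (if i < p \<and> j < m then E else 0)"
      using E0 ij by (auto simp: quadratic_err_def)
  qed (use m E0 in auto)
  then show ?thesis
  proof (rule bil_bound_mono)
    have "real p * real m \<le> (G * r ^ 4) * (b1 * r\<^sup>2)"
      using p m G r_pos by (intro mult_mono) auto
    also have "\<dots> = (G * b1) * (r ^ 3)\<^sup>2" by (simp add: power_mult[symmetric] power_add[symmetric] mult.assoc mult.left_commute)
    finally have "sqrt (real p * real m) \<le> sqrt ((G * b1) * (r ^ 3)\<^sup>2)" by (rule real_sqrt_le_mono)
    also have "\<dots> = sqrt (G * b1) * r ^ 3"
      unfolding real_sqrt_mult[of "G * b1"] real_sqrt_abs using r_pos by simp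
    finally have "E * sqrt (real p * real m) \<le> E * (sqrt (G * b1) * r ^ 3)" using E0 by (rule mult_left_mono)
    also have "\<dots> = CS * CT ^ dS * cd\<^sup>2 * sqrt (G * b1) * T ^ (dS + 2) / r"
      using r_pos by (simp add: E_def power_mult_distrib power_divide power_add power2_eq_square power3_eq_cube)
    finally show "E * sqrt (real p * real m) \<le> CS * CT ^ dS * cd\<^sup>2 * sqrt (G * b1) * T ^ (dS + 2) / r" .
  qed
qed

definition CM :: real where
  "CM = (\<Sum>i\<le>N. \<bar>coeff g i\<bar> * (\<Sum>k<i. real (i choose k) * th0 ^ (i - k) * gmom k))"

lemma shift_mean_le: "\<bar>x\<bar> \<le> th0 \<Longrightarrow> \<bar>shift_mean N g x\<bar> \<le> CM"
proof -
  assume x: "\<bar>x\<bar> \<le> th0"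
  have "\<bar>\<Sum>k<i. real (i choose k) * x ^ (i - k) * gmom k\<bar> \<le> (\<Sum>k<i. real (i choose k) * th0 ^ (i - k) * gmom k)" for i
    using x gmom_nonneg
    by (intro order_trans[OF sum_abs] sum_mono) (auto simp: abs_mult power_abs intro!: mult_right_mono mult_left_mono power_mono)
  then show ?thesis unfolding shift_mean_def CM_def
    by (intro order_trans[OF sum_abs] sum_mono) (auto simp: abs_mult intro!: mult_left_mono)
qed

definition diag_err :: "nat \<Rightarrow> nat \<Rightarrow> real" where
  "diag_err i j = (if i = j then - hermite_coeff (poly q) 1 * ((X i i + th i i + de i i) / r\<^sup>2 - 1)
      - tau (poly q) (real m / r\<^sup>2) lam * (v i * v i) else 0)"

text \<open>Kernel matrices have zero diagonal, so a_1 (Y_ii - 1) and the \<tau> term stand alone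
  there. Both are of order at most T / r^2, which is weakened to T / r.\<close>

lemma diag_part:
  "bil_bound p diag_err ((\<bar>hermite_coeff (poly q) 1\<bar> * CT + CM) * T / r)"
  unfolding diag_err_def[abs_def]
proof (rule bil_bound_diag)
  have CM0: "0 \<le> CM" using shift_mean_le[of 0] const_bounds by simp
  show "0 \<le> (\<bar>hermite_coeff (poly q) 1\<bar> * CT + CM) * T / r" using const_bounds T r_pos CM0 by simp
  fix i assume i: "i < p"
  let ?a = "hermite_coeff (poly q) 1" and ?Y = "(X i i + th i i + de i i) / r\<^sup>2 - 1"
    and ?t = "tau (poly q) (real m / r\<^sup>2) lam * (v i * v i)"
  have "r \<le> r\<^sup>2" using mult_left_mono[OF r(1), of r] r_pos by (simp add: power2_eq_square)
  then have rr: "1 / r\<^sup>2 \<le> 1 / r" using r_pos by (intro divide_left_mono) auto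
  have Y: "\<bar>?Y\<bar> \<le> CT * T * (1 / r)"
  proof -
    have "\<bar>X i i - r\<^sup>2\<bar> \<le> T" using iso i by (simp add: near_iso_def r)
    then have "\<bar>X i i + th i i + de i i - r\<^sup>2\<bar> \<le> T + th0 * T + cd * T"
      using th_le[OF i i] de_le_T[OF i i] th0_le by linarith
    also have "\<dots> = CT * T" by (simp add: CT_def algebra_simps)
    finally have "\<bar>X i i + th i i + de i i - r\<^sup>2\<bar> * (1 / r\<^sup>2) \<le> CT * T * (1 / r)"
      using rr const_bounds T r_pos by (intro mult_mono) auto
    moreover have "?Y = (X i i + th i i + de i i - r\<^sup>2) * (1 / r\<^sup>2)"
      using r_pos by (simp add: diff_divide_distrib)
    ultimately show ?thesis by (simp add: abs_mult)
  qed
  have t: "\<bar>?t\<bar> \<le> CM * T * (1 / r)"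
  proof (cases "i < m")
    case True
    have "\<bar>?t\<bar> = \<bar>shift_mean N g (th i i)\<bar> * (1 / r\<^sup>2)" unfolding tau_vv[OF True True] by simp
    also have "\<dots> \<le> CM * (1 / r)"
      using shift_mean_le[OF th_le[OF i i]] rr r_pos by (intro mult_mono) auto
    also have "\<dots> \<le> CM * T * (1 / r)"
      using mult_left_mono[OF T CM0] r_pos by (intro mult_right_mono) auto
    finally show ?thesis .
  next
    case False
    then show ?thesis using v(2)[of i] i CM0 T r_pos by simp
  qed
  have "\<bar>- ?a * ?Y - ?t\<bar> \<le> \<bar>?a\<bar> * \<bar>?Y\<bar> + \<bar>?t\<bar>"
    using abs_triangle_ineq4[of "- ?a * ?Y" ?t] by (simp add: abs_mult)
  also have "\<dots> \<le> \<bar>?a\<bar> * (CT * T * (1 / r)) + CM * T * (1 / r)"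
    using Y t by (intro add_mono mult_left_mono) auto
  also have "\<dots> = (\<bar>?a\<bar> * CT + CM) * T / r" by (simp add: add_divide_distrib algebra_simps)
  finally show "\<bar>- ?a * ?Y - ?t\<bar> \<le> (\<bar>?a\<bar> * CT + CM) * T / r" .
qed

text \<open>The entries of K(f) - A(f) expressed by \<open>X\<close>, \<open>th\<close> and
  \<open>de\<close>. Off the diagonal the linear part of f contributes a_1 Y_ij to both matrices and
  cancels, so only \<open>g\<close> remains.\<close>

definition err :: "nat \<Rightarrow> nat \<Rightarrow> real" where
  "err i j = (if i = j then - hermite_coeff (poly q) 1 * ((X i i + th i i + de i i) / r\<^sup>2 - 1)
      - tau (poly q) (real m / r\<^sup>2) lam * (v i * v i)
    else (poly g (X i j + th i j + de i j) - poly g (X i j)) / r\<^sup>2 - tau (poly q) (real m / r\<^sup>2) lam * (v i * v j))"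

definition Ctot :: real where
  "Ctot = (\<bar>hermite_coeff (poly q) 1\<bar> * CT + CM) + CL * CT ^ dL * cd * b1 + CA + 2 * CB
    + 2 * (CS * CT ^ dS * cd\<^sup>2 * sqrt (G * b1))"

lemma err_bound: "bil_bound p err (Ctot * T ^ (dL + dS + 2) * Kap / r)"
proof -
  let ?D = "dL + dS + 2"
  have up: "C * T ^ d / r \<le> C * T ^ ?D * Kap / r" if "0 \<le> C" "d \<le> ?D" for C d
  proof -
    have "C * T ^ d \<le> C * T ^ ?D" by (rule power_weaken[OF T that])
    also have "\<dots> \<le> C * T ^ ?D * Kap" using mult_left_mono[OF Kap, of "C * T ^ ?D"] that T by simp
    finally show ?thesis using r_pos by (intro divide_right_mono) auto
  qed
  have upK: "C * T ^ d * Kap / r \<le> C * T ^ ?D * Kap / r" if "0 \<le> C" "d \<le> ?D" for C d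
    using power_weaken[OF T that] Kap r_pos by (intro divide_right_mono mult_right_mono) auto
  have nn: "0 \<le> \<bar>hermite_coeff (poly q) 1\<bar> * CT + CM" "0 \<le> CL * CT ^ dL * cd * b1" "0 \<le> CA" "0 \<le> CB"
    "0 \<le> CS * CT ^ dS * cd\<^sup>2 * sqrt (G * b1)"
  proof -
    have "0 \<le> CM" using shift_mean_le[of 0] const_bounds by simp
    then show "0 \<le> \<bar>hermite_coeff (poly q) 1\<bar> * CT + CM" using const_bounds by simp
    show "0 \<le> CL * CT ^ dL * cd * b1" using CL const_bounds b1 by simp
    show "0 \<le> CA" using const_bounds by (auto simp: CA_def intro!: sum_nonneg)
    show "0 \<le> CB" using const_bounds kap_nonneg by (auto simp: CB_def intro!: sum_nonneg)
    show "0 \<le> CS * CT ^ dS * cd\<^sup>2 * sqrt (G * b1)" using CS const_bounds b1 G by simp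
  qed
  let ?B = "\<lambda>C. C * T ^ ?D * Kap / r"
  have 0: "bil_bound p diag_err (?B (\<bar>hermite_coeff (poly q) 1\<bar> * CT + CM))"
    by (rule bil_bound_mono[OF diag_part]) (use up[OF nn(1), of 1] in simp)
  have 1: "bil_bound p lip_err (?B (CL * CT ^ dL * cd * b1))"
    by (rule bil_bound_mono[OF lipschitz_part]) (use up[OF nn(2), of "Suc dL"] in simp)
  have 2: "bil_bound p centered_err (?B CA)"
    by (rule bil_bound_mono[OF centered_part]) (use upK[OF nn(3), of 0] in simp)
  have 3: "bil_bound p linear_err (?B CB)"
    by (rule bil_bound_mono[OF first_order_part]) (use upK[OF nn(4), of 1] in simp)
  have 4: "bil_bound p quadratic_err (?B (CS * CT ^ dS * cd\<^sup>2 * sqrt (G * b1)))"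
    by (rule bil_bound_mono[OF second_order_part]) (use up[OF nn(5), of "dS + 2"] in simp)
  note 34 = bil_bound_add[OF 3 4]
  note all = bil_bound_add[OF bil_bound_add[OF 0 bil_bound_add[OF 1 2]] bil_bound_add[OF 34 bil_bound_transpose[OF 34]]]
  have "bil_bound p err (?B (\<bar>hermite_coeff (poly q) 1\<bar> * CT + CM) + (?B (CL * CT ^ dL * cd * b1) + ?B CA)
      + ((?B CB + ?B (CS * CT ^ dS * cd\<^sup>2 * sqrt (G * b1))) + (?B CB + ?B (CS * CT ^ dS * cd\<^sup>2 * sqrt (G * b1)))))"
  proof (rule bil_bound_cong[OF all])
    fix i j assume ij: "i < p" "j < p"
    note parts = diag_err_def lip_err_def centered_err_def linear_err_def quadratic_err_def
    \<comment> \<open>The tall pieces also serve the block with i < m \<le> j, by transposition. In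
      the corner with i and j both at least m, \<open>th\<close> and \<open>de\<close> vanish and
      the error is 0.\<close>
    consider "i = j" | "i \<noteq> j" "i < m" "j < m" | "m \<le> i" "j < m" | "i < m" "m \<le> j" | "i \<noteq> j" "m \<le> i" "m \<le> j"
      by linarith
    then show "diag_err i j + (lip_err i j + centered_err i j)
        + ((linear_err i j + quadratic_err i j) + (linear_err j i + quadratic_err j i)) = err i j"
    proof cases
      case 1
      then show ?thesis by (simp add: err_def parts)
    next
      case 2
      then show ?thesis unfolding err_def parts tau_vv[OF 2(2,3)] by (simp add: diff_divide_distrib)
    next
      case 3
      then have "v i = 0" "th i j = 0" using v(2) outside ij by auto
      then show ?thesis using 3 by (simp add: err_def parts diff_divide_distrib)
    next
      case 4
      then have "v j = 0" "th i j = 0" using v(2) outside(1)[of j i] ij by (auto simp: sym(2)[of i j])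
      then show ?thesis using 4 by (simp add: err_def parts diff_divide_distrib sym(1)[of j i] sym(3)[of j i])
    next
      case 5
      then have "v i = 0" "v j = 0" using v(2) ij by auto
      then show ?thesis using 5 by (simp add: err_def parts th_def de_def)
    qed
  qed
  then show ?thesis
    by (rule bil_bound_mono) (simp add: Ctot_def add_divide_distrib algebra_simps)
qed

end

section \<open>The probability of the good event\<close>

lemma ip_signs:
  assumes m: "1 \<le> m" "m \<le> p" and v: "\<And>i. i < m \<Longrightarrow> \<bar>v i\<bar> = 1 / sqrt (real m)" "\<And>i. m \<le> i \<Longrightarrow> i < p \<Longrightarrow> v i = 0"
  shows "ip p v v = 1"
proof -
  have "ip p v v = (\<Sum>i<m. 1 / real m)"
    unfolding ip_def
  proof (rule sum.mono_neutral_cong_right)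
    show "v i * v i = 1 / real m" if "i \<in> {..<m}" for i
    proof -
      have "v i * v i = \<bar>v i\<bar> * \<bar>v i\<bar>" by simp
      also have "\<dots> = 1 / real m" using v(1)[of i] that by simp
      finally show ?thesis .
    qed
  qed (use m v(2) in auto)
  then show ?thesis using m by simp
qed

lemma (in spiked_setup) op_norm_error:
  assumes Z: "Zm \<in> carrier_mat n p" "u = (\<lambda>x. Zm $$ x)" and vv: "vv \<in> carrier_vec p" "v = (\<lambda>i. vv $ i)"
    and n: "0 < n"
  shows "op_norm (kernel_mat n (poly q) (sample_cov n lam vv Zm)
      - approx_mat n lam vv (real m / sqrt (real n)) (poly q) Zm) \<le> Ctot * T ^ (dL + dS + 2) * Kap / r"
proof (rule op_norm_le)
  define Y where "Y = sample_cov n lam vv Zm"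
  have unit: "ip p (\<lambda>i. vv $ i) (\<lambda>i. vv $ i) = 1" using ip_signs[OF m(1,2) v] vv by simp
  have Yc: "Y \<in> carrier_mat p p"
    unfolding Y_def sample_cov_def psd_sqrt_spiked_cov[OF vv(1) unit lam]
    using Z vv by (auto simp: spike_root_def white_cov_def)
  have Sc: "white_cov n Zm \<in> carrier_mat p p" using Z by (auto simp: white_cov_def)
  let ?D = "kernel_mat n (poly q) Y - approx_mat n lam vv (real m / sqrt (real n)) (poly q) Zm"
  show "kernel_mat n (poly q) (sample_cov n lam vv Zm)
      - approx_mat n lam vv (real m / sqrt (real n)) (poly q) Zm \<in> carrier_mat p p"
    unfolding approx_mat_def kernel_mat_def Y_def[symmetric] using Yc Sc vv by (auto simp: outer_prod_def)
  show "0 < p" using m by simp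
  have rn: "0 < sqrt (real n)" using n by simp
  have entry: "?D $$ (i, j) = err i j" if ij: "i < p" "j < p" for i j
  proof -
    have Yx: "sqrt (real n) * Y $$ (i, j) = X i j + th i j + de i j"
    proof -
      define s where "s j = (\<Sum>k<p. v k * X k j)" for j
      define c where "c = sqrt lam - 1"
      have s: "s j = ex j + r\<^sup>2 * v j" for j by (simp add: s_def ex_def)
      have s0: "(\<Sum>k<p. v k * s k) = ex0 + r\<^sup>2" by (simp add: s_def ex0_def)
      have lamc: "lam - 1 = 2 * c + c * c" using lam by (simp add: c_def algebra_simps)
      have "sqrt (real n) * Y $$ (i, j) = X i j + c * v i * s j + c * v j * s i + c * c * v i * v j * (\<Sum>k<p. v k * s k)"
        using sample_cov_entry[OF Z(1) n ij vv(1) unit lam] by (simp add: Y_def Z(2) vv(2) s_def c_def)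
      then have "sqrt (real n) * Y $$ (i, j) = X i j + c * v i * s j + c * v j * s i + c * c * v i * v j * (ex0 + r\<^sup>2)"
        by (simp only: s0)
      then show ?thesis unfolding th_def de_def lamc c_def[symmetric] s
        by (simp add: power2_eq_square algebra_simps)
    qed
    then have Y: "Y $$ (i, j) = (X i j + th i j + de i j) / r\<^sup>2"
      using rn unfolding r by (simp add: eq_divide_eq mult.commute)
    have Sx: "sqrt (real n) * white_cov n Zm $$ (i, j) = X i j"
      using white_cov_entry[OF Z(1) n ij] by (simp add: Z(2))
    have app: "approx_mat n lam vv (real m / sqrt (real n)) (poly q) Zm $$ (i, j)
        = hermite_coeff (poly q) 1 * (Y $$ (i, j) - (if i = j then 1 else 0))
          + tau (poly q) (real m / r\<^sup>2) lam * (v i * v j)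
          + (if i = j then 0 else (poly q (X i j) - hermite_coeff (poly q) 1 * X i j) / r\<^sup>2)"
      using ij Yc Sc vv Sx unfolding approx_mat_def kernel_mat_def Y_def[symmetric] r(2)
      by (auto simp: outer_prod_def hermite_1[unfolded One_nat_def])
    have ker: "kernel_mat n (poly q) Y $$ (i, j) = (if i = j then 0 else poly q (X i j + th i j + de i j) / r\<^sup>2)"
      using ij Yc Yx unfolding kernel_mat_def r(2) by auto
    have pg: "poly g x = poly q x - hermite_coeff (poly q) 1 * x" for x
      by (simp add: centered_poly_def mult.commute)
    have "?D $$ (i, j) = kernel_mat n (poly q) Y $$ (i, j)
        - approx_mat n lam vv (real m / sqrt (real n)) (poly q) Zm $$ (i, j)"
      using ij Yc Sc vv by (intro index_minus_mat(1)) (auto simp: approx_mat_def kernel_mat_def outer_prod_def)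
    also have "\<dots> = err i j"
    proof (cases "i = j")
      case True
      then show ?thesis unfolding ker app Y by (simp add: err_def)
    next
      case False
      then show ?thesis unfolding ker app Y pg err_def
        by (simp add: diff_divide_distrib add_divide_distrib distrib_left)
    qed
    finally show ?thesis .
  qed
  show "bil_bound p (\<lambda>i j. (kernel_mat n (poly q) (sample_cov n lam vv Zm)
      - approx_mat n lam vv (real m / sqrt (real n)) (poly q) Zm) $$ (i, j)) (Ctot * T ^ (dL + dS + 2) * Kap / r)"
    by (rule bil_bound_cong[OF err_bound]) (simp add: entry Y_def[symmetric])
qed

section \<open>Explicit size of the block bounds\<close>

definition block_const :: "nat \<Rightarrow> nat \<Rightarrow> real \<Rightarrow> real \<Rightarrow> real" where
  "block_const K k b1 G = (b1 + G) * ((1 + gmom k)\<^sup>2 + 2 ^ Suc K * kernel_const k * (1 + b1))"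

lemma block_const_nonneg: "0 \<le> b1 \<Longrightarrow> 0 \<le> G \<Longrightarrow> 0 \<le> block_const K k b1 G"
  using gmom_nonneg[of k] kernel_const_nonneg[of k] by (simp add: block_const_def)

text \<open>\<open>B\<close> will be (b1 + G) r^2 for the m x m block and (b1 + G) r^4 for the tall
  one; it dominates both m and the number of rows. That m is of order sqrt n = r^2 enters through m
  T / r^2 \<le> b1 T.\<close>

lemma block_bound_le:
  fixes T r :: real
  assumes T: "1 \<le> T" and m: "real m \<le> b1 * r\<^sup>2" and R: "real R \<le> B" and B: "b1 * r\<^sup>2 \<le> B" "0 \<le> B"
    and r: "0 < r" and b1: "0 \<le> b1"
  shows "T * (real m * ((1 + gmom k) * T ^ k)\<^sup>2
      + 2 ^ Suc K * (kernel_const k * (1 + real m * (T / r\<^sup>2))) * real R)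
    \<le> B * ((1 + gmom k)\<^sup>2 + 2 ^ Suc K * kernel_const k * (1 + b1)) * T ^ (2 * k + 2)"
proof -
  have g: "0 \<le> gmom k" "0 \<le> kernel_const k" by (rule gmom_nonneg kernel_const_nonneg)+
  have T2: "T ^ (2 * k) \<le> T ^ (2 * k + 1)" "T \<le> T ^ (2 * k + 1)"
    using T power_increasing[of 1 "2 * k + 1" T] by (auto intro: power_increasing)
  have "real m * ((1 + gmom k) * T ^ k)\<^sup>2 = real m * ((1 + gmom k)\<^sup>2 * T ^ (2 * k))"
    by (simp add: power_mult_distrib power_mult[symmetric] mult.commute)
  also have "\<dots> \<le> B * ((1 + gmom k)\<^sup>2 * T ^ (2 * k + 1))"
    using m B T2 T g by (intro mult_mono) auto
  finally have 1: "real m * ((1 + gmom k) * T ^ k)\<^sup>2 \<le> B * ((1 + gmom k)\<^sup>2 * T ^ (2 * k + 1))" .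
  have "real m * (T / r\<^sup>2) \<le> b1 * r\<^sup>2 * (T / r\<^sup>2)" using m T by (intro mult_right_mono) auto
  also have "\<dots> = b1 * T" using r by simp
  finally have "1 + real m * (T / r\<^sup>2) \<le> (1 + b1) * T" using T by (simp add: algebra_simps)
  also have "\<dots> \<le> (1 + b1) * T ^ (2 * k + 1)" using T2 b1 by (intro mult_left_mono) auto
  finally have 2: "1 + real m * (T / r\<^sup>2) \<le> (1 + b1) * T ^ (2 * k + 1)" .
  have "2 ^ Suc K * (kernel_const k * (1 + real m * (T / r\<^sup>2))) * real R
      \<le> 2 ^ Suc K * (kernel_const k * ((1 + b1) * T ^ (2 * k + 1))) * B"
    using 2 R B g b1 T by (intro mult_mono mult_left_mono) auto
  then have "real m * ((1 + gmom k) * T ^ k)\<^sup>2 + 2 ^ Suc K * (kernel_const k * (1 + real m * (T / r\<^sup>2))) * real R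
      \<le> B * ((1 + gmom k)\<^sup>2 + 2 ^ Suc K * kernel_const k * (1 + b1)) * T ^ (2 * k + 1)"
    using 1 by (simp add: algebra_simps)
  then have "T * (real m * ((1 + gmom k) * T ^ k)\<^sup>2 + 2 ^ Suc K * (kernel_const k * (1 + real m * (T / r\<^sup>2))) * real R)
      \<le> T * (B * ((1 + gmom k)\<^sup>2 + 2 ^ Suc K * kernel_const k * (1 + b1)) * T ^ (2 * k + 1))"
    using T by (intro mult_left_mono) auto
  then show ?thesis by (simp add: ac_simps)
qed

lemma bil_bound_low:
  fixes D :: "nat \<Rightarrow> nat \<Rightarrow> real"
  assumes m: "m \<le> p" and L: "0 \<le> L"
    and le: "\<And>x. (\<Sum>s<m. (\<Sum>j<min s m. D s j * x j)\<^sup>2) \<le> L * ip m x x"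
  shows "bil_bound p (\<lambda>i j. if j < i \<and> i < m then D i j else 0) (sqrt L)"
proof (rule bil_bound_rows[OF _ L])
  fix x :: "nat \<Rightarrow> real"
  have "(\<Sum>i<p. (\<Sum>j<p. (if j < i \<and> i < m then D i j else 0) * x j)\<^sup>2) = (\<Sum>s<m. (\<Sum>j<min s m. D s j * x j)\<^sup>2)"
  proof (rule sum.mono_neutral_cong_right)
    fix s assume s: "s \<in> {..<m}"
    have "(\<Sum>j<p. (if j < s \<and> s < m then D s j else 0) * x j) = (\<Sum>j<min s m. D s j * x j)"
      by (rule sum.mono_neutral_cong_right) (use s m in auto)
    then show "(\<Sum>j<p. (if j < s \<and> s < m then D s j else 0) * x j)\<^sup>2 = (\<Sum>j<min s m. D s j * x j)\<^sup>2" by simp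
  qed (use m in auto)
  also have "\<dots> \<le> L * ip m x x" by (rule le)
  also have "\<dots> \<le> L * ip p x x"
    using L m unfolding ip_def by (intro mult_left_mono sum_mono2) auto
  finally show "(\<Sum>i<p. (\<Sum>j<p. (if j < i \<and> i < m then D i j else 0) * x j)\<^sup>2) \<le> L * ip p x x" .
qed

text \<open>For s \<ge> m the row of the recursion is a full row of the tall block, as min s m = m;
  the rows s < m only add nonnegative terms to the right side.\<close>

lemma bil_bound_tall:
  fixes D :: "nat \<Rightarrow> nat \<Rightarrow> real"
  assumes m: "m \<le> p" and L: "0 \<le> L"
    and le: "\<And>x. (\<Sum>s<p. (\<Sum>j<min s m. D s j * x j)\<^sup>2) \<le> L * ip m x x"
  shows "bil_bound p (\<lambda>i j. if m \<le> i \<and> j < m then D i j else 0) (sqrt L)"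
proof (rule bil_bound_rows[OF _ L])
  fix x :: "nat \<Rightarrow> real"
  have "(\<Sum>i<p. (\<Sum>j<p. (if m \<le> i \<and> j < m then D i j else 0) * x j)\<^sup>2) \<le> (\<Sum>s<p. (\<Sum>j<min s m. D s j * x j)\<^sup>2)"
  proof (rule sum_mono)
    fix s assume s: "s \<in> {..<p}"
    show "(\<Sum>j<p. (if m \<le> s \<and> j < m then D s j else 0) * x j)\<^sup>2 \<le> (\<Sum>j<min s m. D s j * x j)\<^sup>2"
    proof (cases "m \<le> s")
      case True
      have "(\<Sum>j<p. (if m \<le> s \<and> j < m then D s j else 0) * x j) = (\<Sum>j<min s m. D s j * x j)"
        by (rule sum.mono_neutral_cong_right) (use s m True in auto)
      then show ?thesis by simp
    qed simp
  qed
  also have "\<dots> \<le> L * ip m x x" by (rule le)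
  also have "\<dots> \<le> L * ip p x x"
    using L m unfolding ip_def by (intro mult_left_mono sum_mono2) auto
  finally show "(\<Sum>i<p. (\<Sum>j<p. (if m \<le> i \<and> j < m then D i j else 0) * x j)\<^sup>2) \<le> L * ip p x x" .
qed

context gaussian_matrix
begin

lemma biform_unit_right: "i < p \<Longrightarrow> biform a (unit_fun i) w = (\<Sum>k<p. a k * gcov n (arr w) k i)"
proof -
  assume i: "i < p"
  have r: "rowform (unit_fun i) l w = z (l, i) w" for l
    using ip_unit_fun[OF i, of "\<lambda>j. z (l, j) w"] by (simp add: rowform_def ip_def mult.commute)
  have "(\<Sum>l<n. rowform a l w * z (l, i) w) = (\<Sum>k<p. \<Sum>l<n. a k * z (l, k) w * z (l, i) w)"
    unfolding rowform_def sum_distrib_right by (rule sum.swap)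
  then show ?thesis
    by (simp add: biform_def r gcov_def sum_distrib_left sum_divide_distrib mult.assoc)
qed

lemma biform_expand: "biform a b w = (\<Sum>i<p. b i * (\<Sum>k<p. a k * gcov n (arr w) k i))"
proof -
  have "biform a b w = (\<Sum>l<n. \<Sum>i<p. b i * (rowform a l w * z (l, i) w)) / sqrt (real n)"
    unfolding biform_def rowform_def[of b]
    by (simp add: sum_distrib_left mult.left_commute)
  also have "\<dots> = (\<Sum>i<p. b i * ((\<Sum>l<n. rowform a l w * z (l, i) w) / sqrt (real n)))"
    by (subst sum.swap) (simp add: sum_distrib_left sum_divide_distrib)
  also have "\<dots> = (\<Sum>i<p. b i * biform a (unit_fun i) w)"
  proof (intro sum.cong refl)
    fix i assume "i \<in> {..<p}"
    then have "rowform (unit_fun i) l w = z (l, i) w" for l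
      using ip_unit_fun[of i p "\<lambda>j. z (l, j) w"] by (simp add: rowform_def ip_def mult.commute)
    then show "b i * ((\<Sum>l<n. rowform a l w * z (l, i) w) / sqrt (real n)) = b i * biform a (unit_fun i) w"
      by (simp add: biform_def)
  qed
  finally show ?thesis by (simp add: biform_unit_right)
qed

text \<open>A union bound over the p^2 + p + 1 bilinear forms at (e_i, e_j), (v, e_i) and (v, v),
  and over N + 1 exponents for each of R = m and R = p. The block bounds hold only under
  \<open>near_iso\<close>, which the pairs (e_i, e_j) provide.\<close>

lemma good_event:
  assumes n: "16 \<le> n" and T: "1 \<le> T" "T \<le> sqrt (real n)" and m: "0 < m" "m \<le> p" and v: "ip p v v = 1"
  defines "LL \<equiv> \<lambda>K k R. T * (real m * ((1 + gmom k) * T ^ k)\<^sup>2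
      + 2 ^ Suc K * (kernel_const k * (1 + real m * (T / sqrt (real n)))) * real R)"
  shows "\<exists>E\<in>events. prob E \<le> (real p * real p + real p + 1) * (4 * exp (4 - T))
      + 2 * (real N + 1) * (real m * (1 / T) ^ Suc K) \<and>
    (\<forall>w\<in>space M - E. near_iso n T p (arr w)
      \<and> (\<forall>i<p. \<bar>(\<Sum>k<p. v k * gcov n (arr w) k i) - sqrt (real n) * v i\<bar> \<le> T)
      \<and> \<bar>(\<Sum>k<p. v k * (\<Sum>l<p. v l * gcov n (arr w) l k)) - sqrt (real n)\<bar> \<le> T
      \<and> (\<forall>k\<le>N. bil_bound p (\<lambda>i j. if j < i \<and> i < m then gcov n (arr w) i j ^ k - gmom k else 0) (sqrt (LL K k m)))
      \<and> (\<forall>k\<le>N. bil_bound p (\<lambda>i j. if m \<le> i \<and> j < m then gcov n (arr w) i j ^ k - gmom k else 0) (sqrt (LL K k p))))"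
proof -
  let ?bad = "\<lambda>a b. {w \<in> space M. \<bar>biform a b w - sqrt (real n) * ip p a b\<bar> > T}"
  have bad: "?bad a b \<in> events" for a b using biform_measurable[of a b] by measurable
  have uu: "ip p (unit_fun i) (unit_fun j) = (if i = j then 1 else 0)" if "i < p" "j < p" for i j
    using that by (simp add: ip_unit_fun) (auto simp: unit_fun_def)
  define E1 where "E1 = (\<Union>i<p. \<Union>j<p. ?bad (unit_fun i) (unit_fun j))"
  define E2 where "E2 = (\<Union>i<p. ?bad v (unit_fun i))"
  define E3 where "E3 = ?bad v v"
  have ev: "E1 \<in> events" "E2 \<in> events" "E3 \<in> events"
    unfolding E1_def E2_def E3_def by (intro sets.finite_UN bad finite_lessThan)+
  have p1: "prob E1 \<le> real p * real p * (4 * exp (4 - T))"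
  proof -
    have "prob E1 \<le> (\<Sum>i<p. prob (\<Union>j<p. ?bad (unit_fun i) (unit_fun j)))"
      unfolding E1_def by (intro measure_UNION_le sets.finite_UN bad finite_lessThan)
    also have "\<dots> \<le> (\<Sum>i<p. \<Sum>j<p. prob (?bad (unit_fun i) (unit_fun j)))"
      by (intro sum_mono measure_UNION_le bad finite_lessThan)
    also have "\<dots> \<le> (\<Sum>i<p. \<Sum>j<p. 4 * exp (4 - T))"
      by (intro sum_mono biform_concentration n) (auto simp: uu)
    finally show ?thesis by simp
  qed
  have p2: "prob E2 \<le> real p * (4 * exp (4 - T))"
  proof -
    have "prob E2 \<le> (\<Sum>i<p. prob (?bad v (unit_fun i)))"
      unfolding E2_def by (intro measure_UNION_le bad finite_lessThan)
    also have "\<dots> \<le> (\<Sum>i<p. 4 * exp (4 - T))"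
      by (intro sum_mono biform_concentration n v) (auto simp: uu)
    finally show ?thesis by simp
  qed
  have p3: "prob E3 \<le> 4 * exp (4 - T)"
    unfolding E3_def by (rule biform_concentration[OF n v v])
  have "\<forall>k. \<exists>E. E \<in> events \<and> prob E \<le> real m * (1 / T) ^ Suc K \<and> (\<forall>w\<in>space M - E. near_iso n T p (arr w) \<longrightarrow>
      (\<forall>x. (\<Sum>s<R. (\<Sum>j<min s m. (gcov n (arr w) s j ^ k - gmom k) * x j)\<^sup>2) \<le> LL K k R * ip m x x))"
    if "R \<le> p" for R
    using kernel_block_bound[OF that T m, of K] unfolding LL_def Bex_def by blast
  note block = choice[OF this]
  obtain F where F: "\<forall>k. F k \<in> events \<and> prob (F k) \<le> real m * (1 / T) ^ Suc K \<and> (\<forall>w\<in>space M - F k. near_iso n T p (arr w) \<longrightarrow>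
      (\<forall>x. (\<Sum>s<m. (\<Sum>j<min s m. (gcov n (arr w) s j ^ k - gmom k) * x j)\<^sup>2) \<le> LL K k m * ip m x x))"
    using block[OF m(2)] by blast
  obtain H where H: "\<forall>k. H k \<in> events \<and> prob (H k) \<le> real m * (1 / T) ^ Suc K \<and> (\<forall>w\<in>space M - H k. near_iso n T p (arr w) \<longrightarrow>
      (\<forall>x. (\<Sum>s<p. (\<Sum>j<min s m. (gcov n (arr w) s j ^ k - gmom k) * x j)\<^sup>2) \<le> LL K k p * ip m x x))"
    using block[OF order_refl] by blast
  define E4 where "E4 = (\<Union>k\<le>N. F k)"
  define E5 where "E5 = (\<Union>k\<le>N. H k)"
  have ev': "E4 \<in> events" "E5 \<in> events"
    unfolding E4_def E5_def using F H by (intro sets.finite_UN; blast)+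
  have p4: "prob E4 \<le> (real N + 1) * (real m * (1 / T) ^ Suc K)"
  proof -
    have "prob E4 \<le> (\<Sum>k\<le>N. prob (F k))"
      unfolding E4_def using F by (intro measure_UNION_le) auto
    also have "\<dots> \<le> (\<Sum>k\<le>N. real m * (1 / T) ^ Suc K)" using F by (intro sum_mono) blast
    finally show ?thesis by (simp add: add.commute)
  qed
  have p5: "prob E5 \<le> (real N + 1) * (real m * (1 / T) ^ Suc K)"
  proof -
    have "prob E5 \<le> (\<Sum>k\<le>N. prob (H k))"
      unfolding E5_def using H by (intro measure_UNION_le) auto
    also have "\<dots> \<le> (\<Sum>k\<le>N. real m * (1 / T) ^ Suc K)" using H by (intro sum_mono) blast
    finally show ?thesis by (simp add: add.commute)
  qed
  define E where "E = E1 \<union> (E2 \<union> (E3 \<union> (E4 \<union> E5)))"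
  have E: "E \<in> events" unfolding E_def using ev ev' by auto
  have "prob E \<le> prob E1 + (prob E2 + (prob E3 + (prob E4 + prob E5)))"
    unfolding E_def using ev ev'
    by (intro order_trans[OF measure_Un_le] add_left_mono sets.Un order_refl)
  also have "\<dots> \<le> real p * real p * (4 * exp (4 - T)) + (real p * (4 * exp (4 - T)) + (4 * exp (4 - T)
      + ((real N + 1) * (real m * (1 / T) ^ Suc K) + (real N + 1) * (real m * (1 / T) ^ Suc K))))"
    by (intro add_mono p1 p2 p3 p4 p5)
  also have "\<dots> = (real p * real p + real p + 1) * (4 * exp (4 - T)) + 2 * (real N + 1) * (real m * (1 / T) ^ Suc K)"
  proof -
    have "P * P * a + (P * a + (a + (N' * b + N' * b))) = (P * P + P + 1) * a + 2 * N' * b" for P a b N' :: real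
      by (simp add: algebra_simps)
    then show ?thesis .
  qed
  finally have PE: "prob E \<le> (real p * real p + real p + 1) * (4 * exp (4 - T)) + 2 * (real N + 1) * (real m * (1 / T) ^ Suc K)" .
  have LL0: "0 \<le> LL K k R" for k R
    unfolding LL_def using T gmom_nonneg[of k] kernel_const_nonneg[of k]
    by (intro mult_nonneg_nonneg add_nonneg_nonneg) auto
  show ?thesis
  proof (intro bexI[OF _ E] conjI ballI PE allI impI)
    fix w assume w: "w \<in> space M - E"
    have n1: "\<bar>biform (unit_fun i) (unit_fun j) w - sqrt (real n) * ip p (unit_fun i) (unit_fun j)\<bar> \<le> T" if "i < p" "j < p" for i j
      using w that by (force simp: E_def E1_def)
    have n2: "\<bar>biform v (unit_fun i) w - sqrt (real n) * ip p v (unit_fun i)\<bar> \<le> T" if "i < p" for i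
      using w that by (force simp: E_def E2_def)
    have n3: "\<bar>biform v v w - sqrt (real n) * ip p v v\<bar> \<le> T"
      using w by (force simp: E_def E3_def)
    show iso: "near_iso n T p (arr w)"
      unfolding near_iso_def
    proof (intro allI impI conjI)
      fix i assume i: "i < p"
      show "\<bar>gcov n (arr w) i i - sqrt (real n)\<bar> \<le> T"
        using n1[OF i i] uu[OF i i] biform_unit[OF i i] by simp
      fix j assume "j < p" "j \<noteq> i"
      then show "\<bar>gcov n (arr w) i j\<bar> \<le> T"
        using n1[OF i, of j] uu[OF i, of j] biform_unit[OF i, of j] by simp
    qed
    show "\<bar>(\<Sum>k<p. v k * gcov n (arr w) k i) - sqrt (real n) * v i\<bar> \<le> T" if "i < p" for i
      using n2[OF that] by (simp add: biform_unit_right[OF that] ip_unit_fun[OF that])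
    show "\<bar>(\<Sum>k<p. v k * (\<Sum>l<p. v l * gcov n (arr w) l k)) - sqrt (real n)\<bar> \<le> T"
      using n3 v by (simp add: biform_expand)
    fix k assume k: "k \<le> N"
    have wF: "w \<in> space M - F k" "w \<in> space M - H k" using w k by (auto simp: E_def E4_def E5_def)
    show "bil_bound p (\<lambda>i j. if j < i \<and> i < m then gcov n (arr w) i j ^ k - gmom k else 0) (sqrt (LL K k m))"
      by (rule bil_bound_low[OF m(2) LL0]) (use F wF iso in blast)
    show "bil_bound p (\<lambda>i j. if m \<le> i \<and> j < m then gcov n (arr w) i j ^ k - gmom k else 0) (sqrt (LL K k p))"
      by (rule bil_bound_tall[OF m(2) LL0]) (use H wF iso in blast)
  qed
qed

end

section \<open>Asymptotics in n and the choice of parameters\<close>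

lemma exp_powr_eventually_small:
  fixes C D delta :: real
  assumes "0 < delta" and C: "0 \<le> C"
  shows "eventually (\<lambda>n::nat. C * (real n)\<^sup>2 * exp (4 - real n powr delta) \<le> real n powr (- D) / 2) at_top"
proof -
  have "((\<lambda>n::nat. real n powr (D + 2) * exp (4 - real n powr delta)) \<longlongrightarrow> 0) at_top"
    using assms(1) by real_asymp
  moreover have "0 < 1 / (2 * (C + 1))" using C by simp
  ultimately have "eventually (\<lambda>n. real n powr (D + 2) * exp (4 - real n powr delta) < 1 / (2 * (C + 1))) at_top"
    by (rule order_tendstoD(2))
  then show ?thesis using eventually_gt_at_top[of 0]
  proof eventually_elim
    case (elim n)
    define e where "e = exp (4 - real n powr delta)"
    have n: "0 < real n" using elim by simp
    have sq: "real n powr (D + 2) = real n powr D * (real n)\<^sup>2"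
      using n by (simp add: powr_add powr_numeral)
    have "real n powr D * (C * (real n)\<^sup>2 * e) = C * (real n powr (D + 2) * e)"
      unfolding sq by simp
    also have "\<dots> \<le> (C + 1) * (1 / (2 * (C + 1)))"
      using elim C unfolding e_def by (intro mult_mono) auto
    also have "\<dots> = 1 / 2" using C by simp
    finally have "real n powr (- D) * (real n powr D * (C * (real n)\<^sup>2 * e)) \<le> real n powr (- D) * (1 / 2)"
      by (intro mult_left_mono) auto
    then have "(real n powr (- D) * real n powr D) * (C * (real n)\<^sup>2 * e) \<le> real n powr (- D) / 2"
      by (simp only: mult.assoc times_divide_eq_right mult_1_right)
    moreover have "real n powr (- D) * real n powr D = 1" using n by (simp add: powr_add[symmetric])
    ultimately show ?case unfolding e_def by simp
  qed
qed

lemma powr_eventually_ge: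
  fixes C e :: real
  assumes "0 < e"
  shows "eventually (\<lambda>n::nat. C \<le> real n powr e) at_top"
  using assms by real_asymp

lemma gaussian_matrix_iid:
  assumes "prob_space M" "iid_std_normal_mat M n p Z" "0 < n"
  shows "gaussian_matrix M n p (\<lambda>x w. Z w $$ x)"
  using assms by (intro gaussian_matrix.intro gaussian_matrix_axioms.intro) (auto simp: iid_std_normal_mat_def)

text \<open>The estimate at a fixed n, with \<open>T\<close> still free and \<open>bd\<close> any
  threshold above the deterministic bound. The set in question is only shown to lie in the
  measurable event \<open>E\<close>, which is all that monotonicity of the measure asks for.\<close>

lemma kernel_error_tail:
  fixes q :: "real poly" and K :: nat
  assumes M: "prob_space M" and Z: "iid_std_normal_mat M n p Z" and odd: "\<And>x. poly q (- x) = - poly q x"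
    and lam: "1 \<le> lam" and b0: "0 < b0" and b1: "0 \<le> b1" and G: "1 \<le> G" and CL: "0 \<le> CL" and CS: "0 \<le> CS"
    and lip: "\<And>S x y. 1 \<le> S \<Longrightarrow> \<bar>x\<bar> \<le> S \<Longrightarrow> \<bar>y\<bar> \<le> S \<Longrightarrow>
      \<bar>poly (centered_poly q) x - poly (centered_poly q) y\<bar> \<le> CL * S ^ dL * \<bar>x - y\<bar>"
    and second: "\<And>S x h. 1 \<le> S \<Longrightarrow> \<bar>x\<bar> \<le> S \<Longrightarrow> \<bar>x + h\<bar> \<le> S \<Longrightarrow>
      \<bar>poly (centered_poly q) (x + h) - poly (centered_poly q) x - poly (pderiv (centered_poly q)) x * h\<bar>
        \<le> CS * S ^ dS * h\<^sup>2"
    and n: "16 \<le> n" and m: "1 \<le> m" "m \<le> p" "b0 * sqrt (real n) \<le> real m" "real m \<le> b1 * sqrt (real n)"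
    and p: "real p \<le> G * real n"
    and v: "v \<in> carrier_vec p" "\<And>i. i < m \<Longrightarrow> \<bar>v $ i\<bar> = 1 / sqrt (real m)" "\<And>i. m \<le> i \<Longrightarrow> i < p \<Longrightarrow> v $ i = 0"
    and T: "1 \<le> T" "T \<le> sqrt (real n)"
  defines "N \<equiv> degree q + 3"
  defines "Cc \<equiv> 1 + (\<Sum>k\<le>N. block_const K k b1 G)"
  defines "B \<equiv> spiked_setup.Ctot q lam b0 b1 G CL CS dL dS * T ^ (dL + dS + 2) * (Cc * T ^ (N + 1)) / sqrt (sqrt (real n))"
  defines "e \<equiv> \<lambda>w. op_norm (kernel_mat n (poly q) (sample_cov n lam v (Z w))
      - approx_mat n lam v (real m / sqrt (real n)) (poly q) (Z w))"
  assumes bd: "B \<le> bd"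
  shows "measure M {w \<in> space M. e w > bd}
    \<le> 12 * G\<^sup>2 * (real n)\<^sup>2 * exp (4 - T) + 2 * (real N + 1) * (b1 * sqrt (real n) * (1 / T) ^ Suc K)"
proof -
  have n0: "0 < n" using n by simp
  interpret gaussian_matrix M n p "\<lambda>x w. Z w $$ x" by (rule gaussian_matrix_iid[OF M Z n0])
  define r where "r = sqrt (sqrt (real n))"
  have r2: "r\<^sup>2 = sqrt (real n)" by (simp add: r_def)
  have r4: "r ^ 4 = real n"
  proof -
    have "r ^ 4 = (r\<^sup>2)\<^sup>2" by (simp add: power_mult[symmetric])
    then show ?thesis by (simp add: r2)
  qed
  have r1: "1 \<le> r" using n by (simp add: r_def)
  have r24: "r\<^sup>2 \<le> r ^ 4" using r1 by (intro power_increasing) auto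
  have bn: "0 \<le> block_const K k b1 G" for k using b1 G by (intro block_const_nonneg) auto
  have Cc1: "1 \<le> Cc" unfolding Cc_def using bn by (simp add: sum_nonneg)
  \<comment> \<open>T^(N+1) is the root of the largest power T^(2 k + 2) in the block bounds, and Cc
    \<ge> 1 gives block_const \<le> Cc \<le> Cc^2.\<close>
  define Kap where "Kap = Cc * T ^ (N + 1)"
  have Kap1: "1 \<le> Kap"
    unfolding Kap_def using mult_mono[OF Cc1 one_le_power[OF T(1)], of "N + 1"] Cc1 by simp
  have bK: "block_const K k b1 G * T ^ (2 * k + 2) \<le> Kap\<^sup>2" if k: "k \<le> N" for k
  proof -
    have "block_const K k b1 G \<le> (\<Sum>k\<le>N. block_const K k b1 G)"
      using k bn by (intro member_le_sum) auto
    then have "block_const K k b1 G \<le> Cc * 1" by (simp add: Cc_def)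
    also have "\<dots> \<le> Cc * Cc" using Cc1 by (intro mult_left_mono) auto
    finally have c: "block_const K k b1 G \<le> Cc\<^sup>2" by (simp add: power2_eq_square)
    have "T ^ (2 * k + 2) \<le> T ^ (2 * (N + 1))" using T k by (intro power_increasing) auto
    then have "block_const K k b1 G * T ^ (2 * k + 2) \<le> Cc\<^sup>2 * T ^ (2 * (N + 1))"
      using c bn T by (intro mult_mono) auto
    also have "\<dots> = Kap\<^sup>2" unfolding Kap_def power_mult_distrib by (simp only: power_mult[symmetric] mult.commute)
    finally show ?thesis .
  qed
  define LL where "LL k R = T * (real m * ((1 + gmom k) * T ^ k)\<^sup>2
      + 2 ^ Suc K * (kernel_const k * (1 + real m * (T / sqrt (real n)))) * real R)" for k R
  have LLm: "sqrt (LL k m) \<le> r * Kap" if k: "k \<le> N" for k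
  proof (rule real_le_lsqrt)
    have "b1 * r\<^sup>2 \<le> (b1 + G) * r\<^sup>2" using G by (intro mult_right_mono) auto
    then have "LL k m \<le> (b1 + G) * r\<^sup>2 * ((1 + gmom k)\<^sup>2 + 2 ^ Suc K * kernel_const k * (1 + b1)) * T ^ (2 * k + 2)"
      unfolding LL_def r2[symmetric] using T m r1 b1 G by (intro block_bound_le) (auto simp: r2)
    also have "\<dots> = r\<^sup>2 * (block_const K k b1 G * T ^ (2 * k + 2))" by (simp add: block_const_def)
    also have "\<dots> \<le> r\<^sup>2 * Kap\<^sup>2" by (intro mult_left_mono bK k) auto
    finally show "LL k m \<le> (r * Kap)\<^sup>2" by (simp add: power_mult_distrib)
  qed (use r1 Kap1 in auto)
  have LLp: "sqrt (LL k p) \<le> r\<^sup>2 * Kap" if k: "k \<le> N" for k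
  proof (rule real_le_lsqrt)
    have le: "b1 * r\<^sup>2 \<le> (b1 + G) * r ^ 4" using G b1 r24 by (intro mult_mono) auto
    have "G * r ^ 4 \<le> (b1 + G) * r ^ 4" using b1 by (intro mult_right_mono) auto
    then have "real p \<le> (b1 + G) * r ^ 4" using p r4 by simp
    then have "LL k p \<le> (b1 + G) * r ^ 4 * ((1 + gmom k)\<^sup>2 + 2 ^ Suc K * kernel_const k * (1 + b1)) * T ^ (2 * k + 2)"
      unfolding LL_def r2[symmetric] using T m r1 b1 G le by (intro block_bound_le) (auto simp: r2)
    also have "\<dots> = r ^ 4 * (block_const K k b1 G * T ^ (2 * k + 2))" by (simp add: block_const_def)
    also have "\<dots> \<le> r ^ 4 * Kap\<^sup>2" by (intro mult_left_mono bK k) auto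
    also have "r ^ 4 = (r\<^sup>2)\<^sup>2" by (simp add: power_mult[symmetric])
    finally show "LL k p \<le> (r\<^sup>2 * Kap)\<^sup>2" by (simp only: power_mult_distrib)
  qed (use r1 Kap1 in auto)
  have vu: "ip p (\<lambda>i. v $ i) (\<lambda>i. v $ i) = 1" by (rule ip_signs[OF m(1,2) v(2,3)])
  have m0: "0 < m" using m by simp
  have vc: "v \<in> carrier_vec p" by (rule v(1))
  obtain E where E: "E \<in> events" "prob E \<le> (real p * real p + real p + 1) * (4 * exp (4 - T))
      + 2 * (real N + 1) * (real m * (1 / T) ^ Suc K)"
    and good: "\<And>w. w \<in> space M - E \<Longrightarrow> near_iso n T p (\<lambda>x. Z w $$ x)
      \<and> (\<forall>i<p. \<bar>(\<Sum>k<p. v $ k * gcov n (\<lambda>x. Z w $$ x) k i) - sqrt (real n) * v $ i\<bar> \<le> T)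
      \<and> \<bar>(\<Sum>k<p. v $ k * (\<Sum>l<p. v $ l * gcov n (\<lambda>x. Z w $$ x) l k)) - sqrt (real n)\<bar> \<le> T
      \<and> (\<forall>k\<le>N. bil_bound p (\<lambda>i j. if j < i \<and> i < m then gcov n (\<lambda>x. Z w $$ x) i j ^ k - gmom k else 0) (sqrt (LL k m)))
      \<and> (\<forall>k\<le>N. bil_bound p (\<lambda>i j. if m \<le> i \<and> j < m then gcov n (\<lambda>x. Z w $$ x) i j ^ k - gmom k else 0) (sqrt (LL k p)))"
    using good_event[OF n T m0 m(2) vu, of N K] unfolding LL_def by blast
  have "e w \<le> B" if w: "w \<in> space M - E" for w
  proof -
    have Zc: "Z w \<in> carrier_mat n p" if "w \<in> space M - E" for w
      using Z that by (auto simp: iid_std_normal_mat_def)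
    note gw = good[OF w]
    interpret spiked_setup q lam b0 b1 G CL CS dL dS n p m "\<lambda>i. v $ i" "\<lambda>x. Z w $$ x" T Kap r
    proof
      show "bil_bound p (\<lambda>i j. if j < i \<and> i < m then gcov n (\<lambda>x. Z w $$ x) i j ^ k - gmom k else 0) (r * Kap)"
        if "k \<le> degree q + 3" for k
        using gw LLm[of k] that unfolding N_def by (blast intro: bil_bound_mono)
      show "bil_bound p (\<lambda>i j. if m \<le> i \<and> j < m then gcov n (\<lambda>x. Z w $$ x) i j ^ k - gmom k else 0) (r\<^sup>2 * Kap)"
        if "k \<le> degree q + 3" for k
        using gw LLp[of k] that unfolding N_def by (blast intro: bil_bound_mono)
      show "real p \<le> G * r ^ 4" using p r4 by simp
      show "b0 * r\<^sup>2 \<le> real m" "real m \<le> b1 * r\<^sup>2" using m by (simp_all add: r2)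
    qed (use odd lam b0 b1 G CL CS lip second r1 r2 m v T Kap1 gw in \<open>auto\<close>)
    from op_norm_error[OF Zc[OF w] refl vc refl n0] show ?thesis
      unfolding e_def B_def Kap_def r_def by (simp only: mult.assoc)
  qed
  then have le: "e w \<le> bd" if "w \<in> space M - E" for w
    using that bd order_trans by blast
  have "{w \<in> space M. e w > bd} \<subseteq> E"
  proof (rule subsetI, rule ccontr)
    fix w assume "w \<in> {w \<in> space M. e w > bd}" "w \<notin> E"
    then show False using le[of w] by simp
  qed
  then have "prob {w \<in> space M. e w > bd} \<le> prob E"
    by (rule finite_measure_mono) (rule E(1))
  also note E(2)
  also have "(real p * real p + real p + 1) * (4 * exp (4 - T)) \<le> 12 * G\<^sup>2 * (real n)\<^sup>2 * exp (4 - T)"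
  proof -
    have p1: "1 \<le> real p" using m by simp
    then have "real p \<le> real p * real p" "1 \<le> real p * real p"
      using mult_mono[of 1 "real p" 1 "real p"] by auto
    then have "real p * real p + real p + 1 \<le> 3 * (real p * real p)" by linarith
    also have "real p * real p \<le> (G * real n) * (G * real n)" using p G by (intro mult_mono) auto
    finally have "real p * real p + real p + 1 \<le> 3 * (G\<^sup>2 * (real n)\<^sup>2)" by (simp add: power2_eq_square ac_simps)
    then have "(real p * real p + real p + 1) * (4 * exp (4 - T)) \<le> 3 * (G\<^sup>2 * (real n)\<^sup>2) * (4 * exp (4 - T))"
      by (intro mult_right_mono) auto
    then show ?thesis by simp
  qed
  also have "2 * (real N + 1) * (real m * (1 / T) ^ Suc K) \<le> 2 * (real N + 1) * (b1 * sqrt (real n) * (1 / T) ^ Suc K)"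
    using m T by (intro mult_left_mono mult_right_mono) auto
  finally show ?thesis by simp
qed

theorem theorem2p1:
  fixes M :: "nat \<Rightarrow> 'a measure"
    and p m :: "nat \<Rightarrow> nat"
    and v :: "nat \<Rightarrow> real vec"
    and Z :: "nat \<Rightarrow> 'a \<Rightarrow> real mat"
    and f :: "real \<Rightarrow> real"
    and lam gamma beta :: real
  assumes prob: "\<And>n. n \<ge> 1 \<Longrightarrow> prob_space (M n)"
    and dims: "\<And>n. n \<ge> 1 \<Longrightarrow> 1 \<le> m n \<and> m n \<le> p n"
    and lam: "lam \<ge> 1"
    and v_dim: "\<And>n. n \<ge> 1 \<Longrightarrow> v n \<in> carrier_vec (p n)"
    and v_supp: "\<And>n i. n \<ge> 1 \<Longrightarrow> i < m n \<Longrightarrow> sqrt (real (m n)) * v n $ i \<in> {-1, 1}"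
    and v_zero: "\<And>n i. n \<ge> 1 \<Longrightarrow> m n \<le> i \<Longrightarrow> i < p n \<Longrightarrow> v n $ i = 0"
    and Z: "\<And>n. n \<ge> 1 \<Longrightarrow> iid_std_normal_mat (M n) n (p n) (Z n)"
    and f_poly: "\<exists>q :: real poly. f = poly q"
    and f_odd: "\<And>x. f (- x) = - f x"
    and gamma: "gamma > 0"
      "(\<lambda>n. real (p n) / real n - gamma) \<in> O(\<lambda>n. real n powr (- 1 / 2))"
    and beta: "beta > 0" "(\<lambda>n. real (m n) / sqrt (real n)) \<longlonglongrightarrow> beta"
  shows "stoch_dominated M
    (\<lambda>n w. op_norm (kernel_mat n f (sample_cov n lam (v n) (Z n w))
                    - approx_mat n lam (v n) (real (m n) / sqrt (real n)) f (Z n w)))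
    (\<lambda>n w. real n powr (- 1 / 4))"
proof -
  obtain q :: "real poly" where f: "f = poly q" using f_poly by blast
  have odd: "poly q (- x) = - poly q x" for x using f_odd f by simp
  obtain CL dL where CL: "0 \<le> CL" and lip: "\<And>S x y. 1 \<le> S \<Longrightarrow> \<bar>x\<bar> \<le> S \<Longrightarrow> \<bar>y\<bar> \<le> S \<Longrightarrow>
      \<bar>poly (centered_poly q) x - poly (centered_poly q) y\<bar> \<le> CL * S ^ dL * \<bar>x - y\<bar>"
    using poly_lipschitz[of "centered_poly q"] by blast
  obtain CS dS where CS: "0 \<le> CS" and second: "\<And>S x h. 1 \<le> S \<Longrightarrow> \<bar>x\<bar> \<le> S \<Longrightarrow> \<bar>x + h\<bar> \<le> S \<Longrightarrow>
      \<bar>poly (centered_poly q) (x + h) - poly (centered_poly q) x - poly (pderiv (centered_poly q)) x * h\<bar>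
        \<le> CS * S ^ dS * h\<^sup>2"
    using poly_second_order[of "centered_poly q"] by blast
  \<comment> \<open>These two constants bracket m / sqrt n for large n.\<close>
  define b0 where "b0 = beta / 2"
  define b1 where "b1 = 2 * beta"
  have b: "0 < b0" "0 \<le> b1" using beta by (auto simp: b0_def b1_def)
  have ev_m: "eventually (\<lambda>n. b0 * sqrt (real n) \<le> real (m n) \<and> real (m n) \<le> b1 * sqrt (real n)) at_top"
  proof -
    have "eventually (\<lambda>n. b0 < real (m n) / sqrt (real n)) at_top"
      using order_tendstoD(1)[OF beta(2), of b0] beta(1) by (simp add: b0_def)
    moreover have "eventually (\<lambda>n. real (m n) / sqrt (real n) < b1) at_top"
      using order_tendstoD(2)[OF beta(2), of b1] beta(1) by (simp add: b1_def)
    ultimately show ?thesis using eventually_gt_at_top[of 0]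
      by eventually_elim (simp add: pos_less_divide_eq pos_divide_less_eq less_imp_le)
  qed
  obtain G where G: "1 \<le> G" and ev_p: "eventually (\<lambda>n. real (p n) \<le> G * real n) at_top"
  proof -
    obtain c where c: "0 < c" "eventually (\<lambda>n. norm (real (p n) / real n - gamma) \<le> c * norm (real n powr (- 1 / 2))) at_top"
      using landau_o.bigE[OF gamma(2)] by blast
    have "eventually (\<lambda>n. real (p n) \<le> (1 + gamma + c) * real n) at_top"
      using c(2) eventually_gt_at_top[of 0]
    proof eventually_elim
      case (elim n)
      have n1: "1 \<le> real n" using elim by simp
      have "real n powr (- 1 / 2) \<le> real n powr 0" using n1 by (intro powr_mono) auto
      then have "c * real n powr (- 1 / 2) \<le> c * 1" using c(1) n1 by (intro mult_left_mono) auto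
      then have "real (p n) / real n \<le> 1 + gamma + c" using elim by simp
      then show ?case using n1 by (simp add: pos_divide_le_eq)
    qed
    then show ?thesis using that[of "1 + gamma + c"] c(1) gamma(1) by simp
  qed
  show ?thesis
    unfolding stoch_dominated_def f
  proof (intro allI impI)
    fix eps D :: real assume eps: "0 < eps" and D: "0 < D"
    define N where "N = degree q + 3"
    \<comment> \<open>The total power of T in the deterministic bound: dL + dS + 2 from the
      polynomial estimates and N + 1 from the block norms.\<close>
    define L where "L = dL + dS + 2 + (N + 1)"
    \<comment> \<open>Half of \<open>eps\<close> absorbs T^L for T = n^delta, the other half the
      constants; the cap 1 / 2 ensures T \<le> sqrt n.\<close>
    define delta where "delta = min (1 / 2) (eps / (2 * real L))"
    have L0: "0 < real L" by (simp add: L_def)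
    have d: "0 < delta" "delta \<le> 1 / 2" using eps L0 by (auto simp: delta_def)
    have dL: "delta * real L \<le> eps / 2"
    proof -
      have "delta * real L \<le> eps / (2 * real L) * real L" using L0 by (intro mult_right_mono) (auto simp: delta_def)
      then show ?thesis using L0 by simp
    qed
    \<comment> \<open>Makes T^(-(K+1)) at most n^(-D-1). The extra factor 1 / n pays for m, of order
      sqrt n, and for the remaining constants, which are eventually at most sqrt n.\<close>
    obtain K :: nat where K: "(D + 1) / delta \<le> real K" using real_arch_simple by blast
    then have "D + 1 \<le> delta * real K" using d by (simp add: pos_divide_le_eq mult.commute)
    also have "\<dots> \<le> delta * real (Suc K)" using d by (intro mult_left_mono) auto
    finally have dK: "D + 1 \<le> delta * real (Suc K)" .
    define Cc where "Cc = 1 + (\<Sum>k\<le>N. block_const K k b1 G)"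
    define Ct where "Ct = spiked_setup.Ctot q lam b0 b1 G CL CS dL dS"
    have ev1: "eventually (\<lambda>n. Ct * Cc \<le> real n powr (eps / 2)) at_top"
      using eps by (intro powr_eventually_ge) auto
    have ev2: "eventually (\<lambda>n. 12 * G\<^sup>2 * (real n)\<^sup>2 * exp (4 - real n powr delta) \<le> real n powr (- D) / 2) at_top"
      using d by (intro exp_powr_eventually_small) auto
    have ev3: "eventually (\<lambda>n. 4 * (real N + 1) * b1 \<le> real n powr (1 / 2)) at_top"
      by (rule powr_eventually_ge) simp
    have "eventually (\<lambda>n. measure (M n) {w \<in> space (M n). real n powr eps * real n powr (- 1 / 4)
        < op_norm (kernel_mat n (poly q) (sample_cov n lam (v n) (Z n w))
            - approx_mat n lam (v n) (real (m n) / sqrt (real n)) (poly q) (Z n w))} \<le> real n powr (- D)) at_top"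
      using ev_m ev_p ev1 ev2 ev3 eventually_ge_at_top[of 16]
    proof eventually_elim
      case (elim n)
      have n: "1 \<le> n" "16 \<le> n" and nr: "1 \<le> real n" "0 < real n" using elim by auto
      define T where "T = real n powr delta"
      have T: "1 \<le> T" "T \<le> sqrt (real n)"
      proof -
        show "1 \<le> T" unfolding T_def using nr d by (intro ge_one_powr_ge_zero) auto
        have "T \<le> real n powr (1 / 2)" unfolding T_def using nr d by (intro powr_mono) auto
        then show "T \<le> sqrt (real n)" using nr by (simp add: powr_half_sqrt)
      qed
      have Tp: "T ^ k = real n powr (delta * real k)" for k
        unfolding T_def using nr by (simp add: powr_powr powr_realpow[symmetric])
      interpret prob_space "M n" by (rule prob[OF n(1)])
      have vabs: "\<bar>v n $ i\<bar> = 1 / sqrt (real (m n))" if "i < m n" for i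
      proof -
        have m0: "0 < sqrt (real (m n))" using dims[OF n(1)] by simp
        have "\<bar>sqrt (real (m n)) * v n $ i\<bar> = 1" using v_supp[OF n(1) that] by auto
        then show ?thesis using m0 by (simp add: abs_mult eq_divide_eq mult.commute)
      qed
      let ?B = "Ct * T ^ (dL + dS + 2) * (Cc * T ^ (N + 1)) / sqrt (sqrt (real n))"
      let ?e = "\<lambda>w. op_norm (kernel_mat n (poly q) (sample_cov n lam (v n) (Z n w))
            - approx_mat n lam (v n) (real (m n) / sqrt (real n)) (poly q) (Z n w))"
      have sub: "?B \<le> real n powr eps * real n powr (- 1 / 4)"
      proof -
        have "sqrt (sqrt (real n)) = (real n powr (1 / 2)) powr (1 / 2)"
          using nr by (simp add: powr_half_sqrt)
        also have "\<dots> = real n powr (1 / 4)" by (simp only: powr_powr) simp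
        finally have r: "1 / sqrt (sqrt (real n)) = real n powr (- 1 / 4)"
          by (simp add: powr_minus_divide)
        have "T ^ L = real n powr (delta * real L)" by (rule Tp)
        also have "\<dots> \<le> real n powr (eps / 2)" using nr dL by (intro powr_mono) auto
        finally have TL: "T ^ L \<le> real n powr (eps / 2)" .
        have "?B = (Ct * Cc) * T ^ L * (1 / sqrt (sqrt (real n)))"
          by (simp add: L_def power_add ac_simps)
        also have "\<dots> = (Ct * Cc) * T ^ L * real n powr (- 1 / 4)" by (simp only: r)
        also have "\<dots> \<le> real n powr (eps / 2) * T ^ L * real n powr (- 1 / 4)"
          using elim T by (intro mult_right_mono) auto
        also have "\<dots> \<le> real n powr (eps / 2) * real n powr (eps / 2) * real n powr (- 1 / 4)"
          using TL by (intro mult_right_mono mult_left_mono) auto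
        also have "real n powr (eps / 2) * real n powr (eps / 2) = real n powr eps"
          by (simp add: powr_add[symmetric])
        finally show ?thesis .
      qed
      have small: "2 * (real N + 1) * (b1 * sqrt (real n) * (1 / T) ^ Suc K) \<le> real n powr (- D) / 2"
      proof -
        have "(1 / T) ^ Suc K = 1 / T ^ Suc K" by (simp add: power_one_over)
        also have "\<dots> = real n powr (- (delta * real (Suc K)))"
          unfolding Tp by (simp only: powr_minus_divide)
        also have "\<dots> \<le> real n powr (- D - 1)" using nr dK by (intro powr_mono) auto
        finally have TK: "(1 / T) ^ Suc K \<le> real n powr (- D - 1)" .
        have "2 * (real N + 1) * (b1 * sqrt (real n) * (1 / T) ^ Suc K)
            \<le> 2 * (real N + 1) * (b1 * sqrt (real n) * real n powr (- D - 1))"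
          using TK b by (intro mult_left_mono) auto
        also have "\<dots> = (4 * (real N + 1) * b1) * (sqrt (real n) * real n powr (- D - 1)) / 2" by simp
        also have "\<dots> \<le> real n powr (1 / 2) * (sqrt (real n) * real n powr (- D - 1)) / 2"
          using elim by (intro divide_right_mono mult_right_mono) auto
        also have "real n powr (1 / 2) * (sqrt (real n) * real n powr (- D - 1)) = real n powr (- D)"
        proof -
          have "sqrt (real n) = real n powr (1 / 2)" using nr by (simp add: powr_half_sqrt)
          then show ?thesis by (simp only: powr_add[symmetric]) simp
        qed
        finally show ?thesis .
      qed
      have tail: "prob {w \<in> space (M n). real n powr eps * real n powr (- 1 / 4) < ?e w}
          \<le> 12 * G\<^sup>2 * (real n)\<^sup>2 * exp (4 - T) + 2 * (real N + 1) * (b1 * sqrt (real n) * (1 / T) ^ Suc K)"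
        unfolding N_def
        by (rule kernel_error_tail[OF prob[OF n(1)] Z[OF n(1)] odd lam b G CL CS lip second n(2) _ _ _ _ _ v_dim[OF n(1)] vabs])
          (use dims[OF n(1)] elim sub v_zero[OF n(1)] T in \<open>auto simp: Ct_def Cc_def N_def\<close>)
      show ?case using tail small elim unfolding T_def by linarith
    qed
    then show "\<exists>N. \<forall>n\<ge>N. measure (M n) {w \<in> space (M n). real n powr eps * real n powr (- 1 / 4)
        < op_norm (kernel_mat n (poly q) (sample_cov n lam (v n) (Z n w))
            - approx_mat n lam (v n) (real (m n) / sqrt (real n)) (poly q) (Z n w))} \<le> real n powr (- D)"
      by (simp add: eventually_sequentially)
  qed
qed

end
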